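(* For each $n$ let $\{x_{i,n};\,i\ge0\}$ be i.i.d. real random variables with all moments finite, such that for every $k\ge1$, $n\,\mathbb E[x_{0,n}^k]\to C_k$ as $n\to\infty$, and suppose that the moments of the random variable whose cumulants are $\{0,C_2,0,C_4,0,C_6,\dots\}$ satisfy Carleman's condition. Let $m_n$ be a sequence of integers with $m_n\to\infty$ and $m_n/n\to\alpha>0$. Let $A_n^B$ be the Type II band version (defined in the context) of $A_n$, where $A_n$ is either the $n\times n$ reverse circulant, the symmetric Toeplitz or the Hankel matrix. Then, for each of these patterns, the EESD of $A_n^B$ converges weakly, as $n\to\infty$, to a symmetric probability measure $\mu_\alpha$ that depends on $\{C_{2k}\}_{k\ge1}$ and on $\alpha=\lim_{n\to\infty} m_n/n$.
   Context: **Link functions** ($1\le i,j\le n$): reverse circulant $L(i,j)=(i+j-2)\bmod n$; symmetric Toeplitz $L(i,j)=|i-j|$; Hankel $L(i,j)=i+j$. **Type II banding.** For the reverse circulant and Toeplitz patterns, $A_n^B=(\hat y_{L(i,j),n})_{1\le i,j\le n}$ with $\hat y_{i,n}=x_{i,n}$ if $i\le m_n$ or $i\ge n-m_n$, and $\hat y_{i,n}=0$ otherwise. For the Hankel pattern, $A_n^B=(\tilde y_{L(i,j),n})_{1\le i,j\le n}$ with $\tilde y_{i,n}=x_{i,n}$ if $n-m_n\le i\le n+m_n$, and $\tilde y_{i,n}=0$ otherwise. **EESD.** For an $n\times n$ real symmetric random matrix $A$ with eigenvalues $\lambda_1,\dots,\lambda_n$, the expected empirical spectral distribution (EESD) is the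 probability distribution with measure $\mathbb E\mu_A$, where $\mu_A=\frac1n\sum_{i=1}^n\delta_{\lambda_i}$. **Carleman's condition** for the even moments $m_{2k}$ is $\sum_{k\ge1}m_{2k}^{-1/(2k)}=\infty$. Here the moments with cumulants $\{0,C_2,0,C_4,\dots\}$ are $m_{2k}=\sum_\sigma\prod_{V\in\sigma}C_{|V|}$, the sum being over all partitions $\sigma$ of $\{1,\dots,2k\}$ with all blocks $V$ of even size (odd moments are $0$). *)

theory Defs
  imports
    "HOL-Probability.Probability"
    "HOL-Library.Disjoint_Sets"
    "Jordan_Normal_Form.Char_Poly"
begin

datatype pattern = Reverse_Circulant | Toeplitz | Hankel

text \<open>Link functions, for row and column indices ranging over \<open>{1..n}\<close>.\<close>

fun link :: "pattern \<Rightarrow> nat \<Rightarrow> nat \<Rightarrow> nat \<Rightarrow> nat" where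
  "link Reverse_Circulant n i j = (i + j - 2) mod n"
| "link Toeplitz n i j = nat \<bar>int i - int j\<bar>"
| "link Hankel n i j = i + j"

text \<open>Type II banding: the values of the link function whose entries are kept.
  The bandwidth is an integer, so that \<open>n - m\<close> is not truncated at \<open>0\<close>.\<close>

fun in_band :: "pattern \<Rightarrow> nat \<Rightarrow> int \<Rightarrow> nat \<Rightarrow> bool" where
  "in_band Reverse_Circulant n m l \<longleftrightarrow> int l \<le> m \<or> int l \<ge> int n - m"
| "in_band Toeplitz n m l \<longleftrightarrow> int l \<le> m \<or> int l \<ge> int n - m"
| "in_band Hankel n m l \<longleftrightarrow> int n - m \<le> int l \<and> int l \<le> int n + m"

text \<open>Matrices of the library are indexed from \<open>0\<close>, hence the successors.\<close>

definition band_matrix :: "pattern \<Rightarrow> nat \<Rightarrow> int \<Rightarrow> (nat \<Rightarrow> real) \<Rightarrow> real mat" where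
  "band_matrix p n m y = Matrix.mat n n (\<lambda>(i, j).
     let l = link p n (Suc i) (Suc j) in if in_band p n m l then y l else 0)"

text \<open>The empirical spectral distribution of a real symmetric matrix. The multiset of real
  roots of the characteristic polynomial is the list of all eigenvalues, with multiplicity.\<close>

definition esd :: "real mat \<Rightarrow> real measure" where
  "esd A = measure_of UNIV (sets borel)
     (\<lambda>B. (\<Sum>l\<in>#proots (char_poly A). indicator B l) / of_nat (dim_row A))"

definition eesd :: "'a measure \<Rightarrow> ('a \<Rightarrow> real mat) \<Rightarrow> real measure" where
  "eesd M A = measure_of UNIV (sets borel) (\<lambda>B. \<integral>\<^sup>+ \<omega>. emeasure (esd (A \<omega>)) B \<partial>M)"

definition iid :: "'a measure \<Rightarrow> (nat \<Rightarrow> 'a \<Rightarrow> real) \<Rightarrow> bool" where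
  "iid M X \<longleftrightarrow> prob_space.indep_vars M (\<lambda>_. borel) X UNIV \<and>
     (\<forall>i. distr M borel (X i) = distr M borel (X 0))"

text \<open>The moment of order \<open>2 * k\<close> belonging to the cumulants \<open>0, C 2, 0, C 4, ...\<close>.\<close>

definition even_moment :: "(nat \<Rightarrow> real) \<Rightarrow> nat \<Rightarrow> real" where
  "even_moment C k =
     (\<Sum>\<sigma> | partition_on {1..2 * k} \<sigma> \<and> (\<forall>V\<in>\<sigma>. even (card V)). \<Prod>V\<in>\<sigma>. C (card V))"

text \<open>Carleman's condition for the even moments \<open>m k\<close>, \<open>k \<ge> 1\<close>. It is stated in \<open>[0, \<infinity>]\<close>,
  where \<open>inverse 0 = \<infinity>\<close>, so that the point mass at \<open>0\<close> satisfies it.\<close>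

definition carleman :: "(nat \<Rightarrow> real) \<Rightarrow> bool" where
  "carleman m \<longleftrightarrow> (\<Sum>k. inverse (ennreal (root (2 * Suc k) (m (Suc k))))) = \<infinity>"

definition symmetric_measure :: "real measure \<Rightarrow> bool" where
  "symmetric_measure \<mu> \<longleftrightarrow> distr \<mu> borel uminus = \<mu>"

end

theory Submission
  imports Defs "Jordan_Normal_Form.Schur_Decomposition"
begin

text \<open>The proof is by moments. The \<open>k\<close>-th moment of the EESD is the expected normalised trace of
the \<open>k\<close>-th power, a sum over closed paths \<open>i\<^sub>0, \<dots>, i\<^sub>k = i\<^sub>0\<close> of expected products of entries. Sort
these circuits by the partition \<open>\<sigma>\<close> of \<open>{1..k}\<close> into positions that carry the same link value.
As the entries are independent, a circuit contributes the product of \<open>E[x\<^bsup>|V|\<^esup>] \<approx> C\<^bsub>|V|\<^esub> / n\<close> over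
the blocks \<open>V\<close>, so that everything depends on the number of circuits of type \<open>\<sigma>\<close>, divided by
\<open>n\<^bsup>1 + |\<sigma>|\<^esup>\<close>.

For all three patterns the equation \<open>L(i,j) = l\<close> can be solved for \<open>j\<close> by at most two affine
expressions \<open>s * i + e * l + t * n + c\<close> with \<open>s\<close> and \<open>e\<close> equal to \<open>1\<close> or \<open>-1\<close> (\<open>link_step\<close>). Once
one of them has been chosen for every step, a circuit of type \<open>\<sigma>\<close> is a lattice point in
\<open>1 + |\<sigma>|\<close> variables, its first vertex and one link value per block, subject to finitely many
affine inequalities (\<open>card_band_circuits\<close>). After division by \<open>n\<close> almost every real point
satisfies none of the nontrivial limiting inequalities with equality, and dominated convergence turns the count
into the volume of a set that depends on the band widths only through \<open>\<alpha>\<close>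
(\<open>stabilises_density\<close>, \<open>ex_weight\<close>). If \<open>\<sigma>\<close> has a block of odd size, then closing the circuit is a
nontrivial linear equation, because its coefficient at that block is a sum of an odd number of
signs; the limit is \<open>0\<close>. Hence only partitions with even blocks survive, the limiting moments
depend on the \<open>C\<^bsub>2k\<^esub>\<close> and \<open>\<alpha>\<close> alone, and the odd ones vanish.

There are at most \<open>2\<^sup>k\<close> choices of solutions and the lattice box has side \<open>3n\<close>, so the limiting
moment of order \<open>2k\<close> is at most \<open>3 * 6\<^bsup>2k\<^esup>\<close> times the moment with cumulants
\<open>0, C\<^sub>2, 0, C\<^sub>4, \<dots>\<close>. It therefore inherits Carleman's condition. Bounded second moments give tightness, so by
Helly's theorem a subsequence converges weakly, and its limit has these moments; Carleman's condition makes it the only such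
distribution (\<open>carleman_unique\<close>), which gives convergence of the whole sequence
(\<open>method_of_moments\<close>) as well as the symmetry of the limit.

Determinacy is derived from a theorem of Denjoy and Carleman, by the argument of Bang: the difference
of the two characteristic functions is flat at \<open>0\<close>, and a function whose derivatives are bounded by
a log-convex sequence \<open>M\<close> needs time at least \<open>M\<^sub>n / (e * M\<^bsub>n+1\<^esub>)\<close> to rise from the level
\<open>e\<^bsup>-n-1\<^esup>\<close> to the level \<open>e\<^bsup>-n\<^esup>\<close> in a suitable norm. Carleman's inequality shows that these
times add up to infinity.\<close>

section \<open>A criterion for quasi-analyticity\<close>

text \<open>Carleman's inequality. The arithmetic-geometric mean inequality is applied to \<open>c i * a i\<close>, where
the weights \<open>c\<close> have \<open>(n + 2) ^ (n + 1)\<close> as their partial products. The resulting factors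
\<open>1 / ((n + 1) * (n + 2))\<close> telescope when the sum over \<open>n\<close> is taken first, and leave
\<open>c i / (i + 1) = (1 + 1 / (i + 1)) ^ (i + 1)\<close>, which is less than \<open>e\<close>.\<close>

lemma carleman_inequality:
  fixes a :: "nat \<Rightarrow> real"
  assumes pos: "\<And>i. 0 < a i" and sa: "summable a"
  shows "summable (\<lambda>n. root (Suc n) (\<Prod>i\<le>n. a i))"
proof -
  define c :: "nat \<Rightarrow> real" where "c i = real (i + 2) ^ Suc i / real (Suc i) ^ i" for i
  have cpos: "0 < c i" for i by (simp add: c_def)
  have prodc: "(\<Prod>i\<le>n. c i) = real (n + 2) ^ Suc n" for n
  proof (induction n)
    case (Suc n)
    have "(\<Prod>i\<le>Suc n. c i) = real (n + 2) ^ Suc n * c (Suc n)" using Suc by simp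
    also have "c (Suc n) = real (Suc n + 2) ^ Suc (Suc n) / real (n + 2) ^ Suc n"
      by (simp add: c_def)
    finally show ?case by simp
  qed (simp add: c_def)
  have G: "root (Suc n) (\<Prod>i\<le>n. a i) \<le> (\<Sum>i\<le>n. c i * a i) * (1 / real (n + 1) - 1 / real (n + 2))" for n
  proof -
    have "root (Suc n) (\<Prod>i\<le>n. c i * a i) = root (Suc n) (real (n + 2) ^ Suc n * (\<Prod>i\<le>n. a i))"
      by (simp only: prod.distrib prodc)
    also have "\<dots> = real (n + 2) * root (Suc n) (\<Prod>i\<le>n. a i)"
      by (simp only: real_root_mult, subst real_root_power_cancel) auto
    finally have 1: "root (Suc n) (\<Prod>i\<le>n. c i * a i) = real (n + 2) * root (Suc n) (\<Prod>i\<le>n. a i)" .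
    have "root (card {..n}) (\<Prod>i\<le>n. c i * a i) \<le> (\<Sum>i\<le>n. c i * a i) / card {..n}"
    proof -
      have "(\<Prod>i\<le>n. c i * a i) powr (1 / real (card {..n})) \<le> (\<Sum>i\<le>n. c i * a i / card {..n})"
        by (rule arith_geom_mean) (auto intro!: mult_nonneg_nonneg less_imp_le[OF cpos] less_imp_le[OF pos])
      moreover have "0 < (\<Prod>i\<le>n. c i * a i)"
        by (intro prod_pos mult_pos_pos ballI cpos pos)
      ultimately show ?thesis
        by (simp add: root_powr_inverse sum_divide_distrib)
    qed
    hence "real (n + 2) * root (Suc n) (\<Prod>i\<le>n. a i) \<le> (\<Sum>i\<le>n. c i * a i) / real (Suc n)"
      using 1 by simp
    hence "root (Suc n) (\<Prod>i\<le>n. a i) \<le> (\<Sum>i\<le>n. c i * a i) / real (Suc n) / real (n + 2)"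
      by (simp add: pos_le_divide_eq mult_ac)
    also have "\<dots> = (\<Sum>i\<le>n. c i * a i) * (1 / real (n + 1) - 1 / real (n + 2))"
      by (simp add: field_simps)
    finally show ?thesis .
  qed
  have c_le: "c i / real (Suc i) \<le> exp 1" for i
  proof -
    have "c i / real (Suc i) = (1 + 1 / real (Suc i)) ^ Suc i"
      by (simp add: c_def field_simps power_divide)
    also have "\<dots> \<le> exp (1 / real (Suc i)) ^ Suc i"
      by (intro power_mono exp_ge_add_one_self) auto
    also have "\<dots> = exp 1"
      by (subst exp_of_nat_mult[symmetric]) simp
    finally show ?thesis .
  qed
  have tele: "(\<Sum>n=i..<N. 1 / real (n + 1) - 1 / real (n + 2)) \<le> 1 / real (Suc i)" if "i \<le> N" for i N
  proof -
    have "(\<Sum>n=i..<N. 1 / real (n + 1) - 1 / real (n + 2)) = (\<Sum>n=i..<N. (- 1 / real (Suc n + 1)) - (- 1 / real (n + 1)))"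
      by (simp add: field_simps)
    also have "\<dots> = - 1 / real (N + 1) - (- 1 / real (i + 1))"
      by (rule sum_Suc_diff'[OF that, where f = "\<lambda>n. - 1 / real (n + 1)"])
    also have "\<dots> \<le> 1 / real (Suc i)" by simp
    finally show ?thesis .
  qed
  have "(\<Sum>n<N. root (Suc n) (\<Prod>i\<le>n. a i)) \<le> exp 1 * suminf a" for N
  proof -
    let ?d = "\<lambda>n. 1 / real (n + 1) - 1 / real (n + 2)"
    have "(\<Sum>n<N. root (Suc n) (\<Prod>i\<le>n. a i)) \<le> (\<Sum>n<N. (\<Sum>i\<le>n. c i * a i) * ?d n)"
      by (intro sum_mono G)
    also have "\<dots> = (\<Sum>n<N. \<Sum>i | i < N \<and> i \<le> n. c i * a i * ?d n)"
      unfolding sum_distrib_right by (intro sum.cong) auto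
    also have "\<dots> = (\<Sum>n<N. \<Sum>i | i\<in>{..<N} \<and> i \<le> n. c i * a i * ?d n)" by simp
    also have "\<dots> = (\<Sum>i<N. \<Sum>n | n\<in>{..<N} \<and> i \<le> n. c i * a i * ?d n)"
      by (rule sum.swap_restrict) auto
    also have "\<dots> = (\<Sum>i<N. c i * a i * (\<Sum>n=i..<N. ?d n))"
      unfolding sum_distrib_left by (intro sum.cong) auto
    also have "\<dots> \<le> (\<Sum>i<N. c i * a i * (1 / real (Suc i)))"
      by (intro sum_mono mult_left_mono tele) (auto intro!: mult_nonneg_nonneg less_imp_le[OF cpos] less_imp_le[OF pos])
    also have "\<dots> = (\<Sum>i<N. (c i / real (Suc i)) * a i)" by (simp add: field_simps)
    also have "\<dots> \<le> (\<Sum>i<N. exp 1 * a i)"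
      by (intro sum_mono mult_right_mono c_le less_imp_le[OF pos])
    also have "\<dots> = exp 1 * (\<Sum>i<N. a i)" by (simp add: sum_distrib_left)
    also have "\<dots> \<le> exp 1 * suminf a"
      by (intro mult_left_mono sum_le_suminf sa less_imp_le[OF pos]) auto
    finally show ?thesis .
  qed
  hence "(\<Sum>n\<le>N. root (Suc n) (\<Prod>i\<le>n. a i)) \<le> exp 1 * suminf a" for N
    by (metis lessThan_Suc_atMost)
  thus ?thesis
    by (rule bounded_imp_summable[rotated]) (auto intro!: real_root_ge_zero prod_nonneg less_imp_le[OF pos])
qed

text \<open>The norm of Bang is the supremum of \<open>|F j t| / (e ^ j * M j)\<close> over all \<open>j\<close>. It is truncated from
below at \<open>e ^ (-N)\<close>: where \<open>|F j| \<le> M j\<close>, the terms with \<open>j \<ge> N\<close> stay below this level, and a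
maximum over finitely many terms is left.\<close>

definition bang :: "(nat \<Rightarrow> real \<Rightarrow> complex) \<Rightarrow> (nat \<Rightarrow> real) \<Rightarrow> nat \<Rightarrow> real \<Rightarrow> real" where
  "bang F M N t = Max (insert (exp (- real N)) ((\<lambda>j. cmod (F j t) / (exp (real j) * M j)) ` {..<N}))"

lemma bang_le_iff:
  "bang F M N t \<le> b \<longleftrightarrow> exp (- real N) \<le> b \<and> (\<forall>j<N. cmod (F j t) / (exp (real j) * M j) \<le> b)"
  unfolding bang_def by (subst Max_le_iff) auto

lemma bang_upper: "exp (- real N) \<le> bang F M N t"
  "j < N \<Longrightarrow> cmod (F j t) / (exp (real j) * M j) \<le> bang F M N t"
  using bang_le_iff[of F M N t "bang F M N t"] by auto

lemma bang_pos: "0 < bang F M N t"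
  using bang_upper(1)[of N F M t] exp_gt_zero[of "- real N"] by linarith

text \<open>\<open>F j\<close> plays the role of the \<open>j\<close>-th derivative of \<open>F 0\<close>. Only the Taylor estimate matters; for
characteristic functions it is obtained by integrating the estimate for the exponential function,
without differentiating under the integral.\<close>

locale quasi_analytic =
  fixes F :: "nat \<Rightarrow> real \<Rightarrow> complex" and M :: "nat \<Rightarrow> real"
  assumes taylor: "\<And>j m t h. cmod (F j (t + h) - (\<Sum>i<m. of_real (h ^ i / fact i) * F (j + i) t))
      \<le> M (j + m) * \<bar>h\<bar> ^ m / fact m"
    and M_pos: "\<And>n. 0 < M n"
    and log_convex: "\<And>n. M (Suc n) ^ 2 \<le> M n * M (Suc (Suc n))"
begin

lemma F_le: "cmod (F j t) \<le> M j"
  using taylor[of j t 0 0] by simp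

lemma ratio_mono: "m \<le> n \<Longrightarrow> M (Suc m) / M m \<le> M (Suc n) / M n"
proof (induction n rule: dec_induct)
  case base
  show ?case by (rule order_refl)
next
  case (step n)
  have "M (Suc n) / M n \<le> M (Suc (Suc n)) / M (Suc n)"
    using log_convex[of n] M_pos[of n] M_pos[of "Suc n"] by (simp add: field_simps power2_eq_square)
  with step show ?case by simp
qed

lemma M_le: "j + i \<le> Suc n \<Longrightarrow> M (j + i) \<le> M j * (M (Suc n) / M n) ^ i"
proof (induction i)
  case 0
  show ?case by simp
next
  case (Suc i)
  have "M (j + Suc i) = M (j + i) * (M (Suc (j + i)) / M (j + i))"
    using M_pos[of "j + i"] by simp
  also have "\<dots> \<le> (M j * (M (Suc n) / M n) ^ i) * (M (Suc n) / M n)"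
    using Suc M_pos by (intro mult_mono ratio_mono) (auto intro!: less_imp_le divide_pos_pos mult_pos_pos zero_less_power)
  finally show ?case by (simp add: mult_ac)
qed

text \<open>Expand \<open>F j\<close> at \<open>t\<close> up to the order \<open>Suc n\<close>. Log-convexity bounds the weights of the higher
derivatives by powers of \<open>M (Suc n) / M n\<close>, so that the Taylor sum is dominated by an exponential
series. Thus the logarithm of the norm is Lipschitz.\<close>

lemma bang_step: "bang F M (Suc n) (t + h) \<le> bang F M (Suc n) t * exp (exp 1 * (M (Suc n) / M n) * \<bar>h\<bar>)"
proof -
  define b where "b = bang F M (Suc n) t"
  define r where "r = M (Suc n) / M n"
  have b0: "0 < b" by (simp add: b_def bang_pos)
  have r0: "0 < r" by (simp add: r_def M_pos)
  have "cmod (F j (t + h)) / (exp (real j) * M j) \<le> b * exp (exp 1 * r * \<bar>h\<bar>)" if j: "j < Suc n" for j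
  proof -
    define m where "m = Suc n - j"
    have jm: "j + m = Suc n" using j by (simp add: m_def)
    have Fb: "cmod (F (j + i) t) \<le> b * exp (real (j + i)) * M (j + i)" if "i < m" for i
      using bang_upper(2)[of "j + i" "Suc n" F t M] that jm M_pos[of "j + i"]
      by (simp add: b_def pos_divide_le_eq mult_ac)
    have Mb: "M (j + m) \<le> b * exp (real (j + m)) * M (j + m)"
    proof -
      have "1 = exp (- real (Suc n)) * exp (real (Suc n))" by (simp only: exp_minus left_inverse exp_not_eq_zero not_False_eq_True)
      also have "\<dots> \<le> b * exp (real (j + m))"
        unfolding jm b_def by (intro mult_right_mono bang_upper) auto
      finally show ?thesis using M_pos[of "j + m"] by simp
    qed
    have "cmod (F j (t + h)) \<le> cmod (\<Sum>i<m. of_real (h ^ i / fact i) * F (j + i) t) + M (j + m) * \<bar>h\<bar> ^ m / fact m"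
      using taylor[of j t h m] norm_triangle_sub[of "F j (t + h)" "\<Sum>i<m. of_real (h ^ i / fact i) * F (j + i) t"]
      by linarith
    also have "\<dots> \<le> (\<Sum>i<m. b * exp (real (j + i)) * M (j + i) * \<bar>h\<bar> ^ i / fact i)
        + b * exp (real (j + m)) * M (j + m) * \<bar>h\<bar> ^ m / fact m"
    proof (rule add_mono)
      show "cmod (\<Sum>i<m. of_real (h ^ i / fact i) * F (j + i) t) \<le> (\<Sum>i<m. b * exp (real (j + i)) * M (j + i) * \<bar>h\<bar> ^ i / fact i)"
      proof (rule sum_norm_le)
        fix i assume "i \<in> {..<m}"
        hence "cmod (F (j + i) t) * (\<bar>h\<bar> ^ i / fact i) \<le> b * exp (real (j + i)) * M (j + i) * (\<bar>h\<bar> ^ i / fact i)"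
          by (intro mult_right_mono Fb) auto
        thus "cmod (of_real (h ^ i / fact i) * F (j + i) t) \<le> b * exp (real (j + i)) * M (j + i) * \<bar>h\<bar> ^ i / fact i"
          by (simp add: norm_mult norm_divide norm_power mult_ac)
      qed
    qed (intro divide_right_mono mult_right_mono Mb; simp)
    also have "\<dots> = (\<Sum>i<Suc m. b * exp (real (j + i)) * M (j + i) * \<bar>h\<bar> ^ i / fact i)" by simp
    also have "\<dots> \<le> (\<Sum>i<Suc m. (b * exp (real j) * M j) * ((exp 1 * r * \<bar>h\<bar>) ^ i / fact i))"
    proof (rule sum_mono)
      fix i assume "i \<in> {..<Suc m}"
      hence "M (j + i) \<le> M j * r ^ i" using M_le[of j i n] jm by (simp add: r_def)
      hence "b * exp (real (j + i)) * M (j + i) * \<bar>h\<bar> ^ i / fact i \<le> b * exp (real (j + i)) * (M j * r ^ i) * \<bar>h\<bar> ^ i / fact i"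
        using b0 by (intro divide_right_mono mult_right_mono mult_left_mono) auto
      also have "\<dots> = (b * exp (real j) * M j) * ((exp 1 * r * \<bar>h\<bar>) ^ i / fact i)"
        by (simp add: exp_add power_mult_distrib exp_of_nat_mult[symmetric])
      finally show "b * exp (real (j + i)) * M (j + i) * \<bar>h\<bar> ^ i / fact i \<le> (b * exp (real j) * M j) * ((exp 1 * r * \<bar>h\<bar>) ^ i / fact i)" .
    qed
    also have "\<dots> = (b * exp (real j) * M j) * (\<Sum>i<Suc m. (exp 1 * r * \<bar>h\<bar>) ^ i / fact i)"
      by (simp only: sum_distrib_left)
    also have "\<dots> \<le> (b * exp (real j) * M j) * exp (exp 1 * r * \<bar>h\<bar>)"
    proof (rule mult_left_mono)
      have s: "(\<lambda>i. (exp 1 * r * \<bar>h\<bar>) ^ i / fact i) sums exp (exp 1 * r * \<bar>h\<bar>)"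
        using exp_converges[of "exp 1 * r * \<bar>h\<bar>"] by (simp add: divide_inverse mult.commute)
      show "(\<Sum>i<Suc m. (exp 1 * r * \<bar>h\<bar>) ^ i / fact i) \<le> exp (exp 1 * r * \<bar>h\<bar>)"
        unfolding sums_unique[OF s] using r0 by (intro sum_le_suminf sums_summable[OF s]) auto
    qed (use b0 M_pos[of j] in auto)
    finally show ?thesis using M_pos[of j] by (simp add: pos_divide_le_eq mult_ac)
  qed
  moreover have "exp (- real (Suc n)) \<le> b * exp (exp 1 * r * \<bar>h\<bar>)"
  proof -
    have "exp (- real (Suc n)) \<le> b * 1" using bang_upper(1)[of "Suc n"] by (simp add: b_def)
    also have "\<dots> \<le> b * exp (exp 1 * r * \<bar>h\<bar>)" using b0 r0 by (intro mult_left_mono) auto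
    finally show ?thesis .
  qed
  ultimately show ?thesis unfolding bang_le_iff b_def r_def by blast
qed

lemma bang_Suc: "bang F M n t = max (bang F M (Suc n) t) (exp (- real n))"
proof (rule antisym)
  show "bang F M n t \<le> max (bang F M (Suc n) t) (exp (- real n))"
    using bang_upper[where F = F and M = M and t = t and N = "Suc n"] unfolding bang_le_iff by (auto simp: le_max_iff_disj)
  have "cmod (F n t) / (exp (real n) * M n) \<le> exp (- real n)"
    using F_le[of n t] M_pos[of n] by (simp add: field_simps exp_minus)
  hence "cmod (F j t) / (exp (real j) * M j) \<le> bang F M n t" if "j < Suc n" for j
    using bang_upper[where F = F and M = M and t = t and N = n] that by (cases "j = n") (auto intro: order_trans)
  moreover have "exp (- real (Suc n)) \<le> exp (- real n)" by simp
  ultimately show "max (bang F M (Suc n) t) (exp (- real n)) \<le> bang F M n t"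
    using bang_upper(1)[of n F M t] bang_le_iff[of F M "Suc n" t "bang F M n t"] by (meson max.boundedI order_trans)
qed

text \<open>The sign \<open>s\<close> selects the direction in which the real line is run through from \<open>0\<close>.\<close>

definition log_bang :: "real \<Rightarrow> nat \<Rightarrow> real \<Rightarrow> real" where
  "log_bang s n t = ln (bang F M n (s * t))"

lemma log_bang_Suc: "log_bang s n t = max (log_bang s (Suc n) t) (- real n)"
proof -
  have "ln (max x (exp y)) = max (ln x) y" if "0 < x" for x y :: real
    using that ln_ge_iff[of x y] by (cases "exp y \<le> x") (simp_all add: max_def)
  from this[OF bang_pos[of F M "Suc n" "s * t"], of "- real n"] show ?thesis
    unfolding log_bang_def bang_Suc[of n "s * t"] .
qed

lemma log_bang_step: "\<bar>s\<bar> = 1 \<Longrightarrow> log_bang s (Suc n) u \<le> log_bang s (Suc n) t + exp 1 * (M (Suc n) / M n) * \<bar>u - t\<bar>"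
proof -
  assume s: "\<bar>s\<bar> = 1"
  have "log_bang s (Suc n) u \<le> ln (bang F M (Suc n) (s * t) * exp (exp 1 * (M (Suc n) / M n) * \<bar>s * (u - t)\<bar>))"
    unfolding log_bang_def using bang_step[of n "s * t" "s * (u - t)"] bang_pos[of F M]
    by (subst ln_le_cancel_iff) (auto simp: algebra_simps)
  also have "\<dots> = log_bang s (Suc n) t + exp 1 * (M (Suc n) / M n) * \<bar>u - t\<bar>"
    unfolding log_bang_def using bang_pos[of F M "Suc n" "s * t"] s by (simp add: ln_mult abs_mult)
  finally show ?thesis .
qed

lemma log_bang_continuous: "\<bar>s\<bar> = 1 \<Longrightarrow> continuous_on X (log_bang s (Suc n))"
proof -
  assume s: "\<bar>s\<bar> = 1"
  have "(exp 1 * (M (Suc n) / M n))-lipschitz_on X (log_bang s (Suc n))"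
  proof (rule lipschitz_onI)
    fix x y
    show "dist (log_bang s (Suc n) x) (log_bang s (Suc n) y) \<le> exp 1 * (M (Suc n) / M n) * dist x y"
      using log_bang_step[OF s, of n x y] log_bang_step[OF s, of n y x]
      unfolding dist_real_def abs_minus_commute[of y x] by linarith
  qed (use M_pos in \<open>auto intro: less_imp_le\<close>)
  thus ?thesis by (rule lipschitz_on_continuous_on)
qed

text \<open>Rising from the level \<open>-(n + 1)\<close> to the level \<open>-n\<close> takes time at least \<open>M n / (e * M (n + 1))\<close>,
by the Lipschitz constant at this level. By the intermediate value theorem all lower levels are passed
before, in disjoint intervals, so that the times add up.\<close>

lemma log_bang_time:
  assumes flat: "\<And>j. F j 0 = 0" and s: "\<bar>s\<bar> = 1"
  shows "0 \<le> t \<Longrightarrow> - real n \<le> log_bang s (Suc n) t \<Longrightarrow> (\<Sum>i<d. M (n + i) / M (Suc (n + i))) \<le> exp 1 * t"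
proof (induction d arbitrary: n t)
  case 0
  then show ?case by simp
next
  case (Suc d)
  have lev0: "log_bang s k 0 = - real k" for k
  proof -
    have "bang F M k 0 = exp (- real k)"
      by (intro antisym bang_upper) (auto simp: bang_le_iff flat)
    thus ?thesis by (simp add: log_bang_def)
  qed
  have ge: "- real (Suc n) \<le> log_bang s (Suc (Suc n)) t"
    using Suc.prems(2) unfolding log_bang_Suc[of s "Suc n"] by (auto simp: max_def split: if_splits)
  obtain u where u: "0 \<le> u" "u \<le> t" "log_bang s (Suc (Suc n)) u = - real (Suc n)"
    using IVT'[of "log_bang s (Suc (Suc n))" 0 "- real (Suc n)" t] ge log_bang_continuous[OF s] Suc.prems(1) lev0[of "Suc (Suc n)"]
    by auto
  have IH: "(\<Sum>i<d. M (Suc n + i) / M (Suc (Suc n + i))) \<le> exp 1 * u"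
    using Suc.IH[of u "Suc n"] u by simp
  have "log_bang s (Suc n) u = - real (Suc n)" using u(3) unfolding log_bang_Suc[of s "Suc n"] by simp
  hence "1 \<le> exp 1 * (M (Suc n) / M n) * (t - u)"
    using log_bang_step[OF s, of n t u] Suc.prems(2) u(2) by simp
  hence "M n / M (Suc n) \<le> exp 1 * (t - u)"
    using M_pos[of n] M_pos[of "Suc n"] by (simp add: field_simps)
  with IH show ?case
    unfolding sum.lessThan_Suc_shift by (simp add: algebra_simps)
qed

text \<open>The theorem of Denjoy and Carleman: otherwise the levels passed on the way from \<open>0\<close> to \<open>t\<close> would
bound the series.\<close>

theorem flat_imp_zero:
  assumes flat: "\<And>j. F j 0 = 0" and div: "\<not> summable (\<lambda>n. M n / M (Suc n))"
  shows "F 0 t = 0"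
proof (rule ccontr)
  assume nz: "F 0 t \<noteq> 0"
  define s where "s = (if t \<ge> 0 then 1 else - 1 :: real)"
  have s: "\<bar>s\<bar> = 1" "s * \<bar>t\<bar> = t" unfolding s_def by (cases "t \<ge> 0"; simp)+
  define b where "b = cmod (F 0 t) / M 0"
  have b: "0 < b" using nz M_pos[of 0] by (simp add: b_def)
  obtain n :: nat where n: "- ln b \<le> real n" using real_arch_simple[of "- ln b"] by (elim exE)
  have "b \<le> bang F M (Suc n) t"
    using bang_upper(2)[of 0 "Suc n" F t M] by (simp add: b_def)
  hence "ln b \<le> log_bang s (Suc n) \<bar>t\<bar>" unfolding log_bang_def s(2) using b bang_pos[of F M] by simp
  hence "(\<Sum>i<d. M (n + i) / M (Suc (n + i))) \<le> exp 1 * \<bar>t\<bar>" for d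
    using log_bang_time[OF flat s(1), of "\<bar>t\<bar>" n d] n by simp
  hence "(\<Sum>i\<le>d. M (n + i) / M (Suc (n + i))) \<le> exp 1 * \<bar>t\<bar>" for d
    by (metis lessThan_Suc_atMost)
  hence "summable (\<lambda>i. M (n + i) / M (Suc (n + i)))"
    by (rule bounded_imp_summable[rotated]) (auto intro!: less_imp_le divide_pos_pos M_pos)
  hence "summable (\<lambda>i. M (i + n) / M (Suc (i + n)))" by (simp add: add.commute)
  with div show False using summable_iff_shift[of "\<lambda>i. M i / M (Suc i)" n] by simp
qed

end

section \<open>Determinacy under Carleman's condition\<close>

lemma (in real_distribution) integrable_iexp_moment:
  assumes "integrable M (\<lambda>x. x ^ j)"
  shows "integrable M (\<lambda>x. (\<i> * of_real x) ^ j * iexp (t * x))"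
  by (rule Bochner_Integration.integrable_bound[OF assms]) (auto simp: norm_mult norm_power power_abs)

lemma (in real_distribution) char_taylor:
  assumes moment: "\<And>k. integrable M (\<lambda>x. x ^ k)"
  defines "D \<equiv> \<lambda>j t. (CLINT x|M. (\<i> * of_real x) ^ j * iexp (t * x))"
  shows "cmod (D j (t + h) - (\<Sum>i<m. of_real (h ^ i / fact i) * D (j + i) t))
      \<le> expectation (\<lambda>x. \<bar>x\<bar> ^ (j + m)) * \<bar>h\<bar> ^ m / fact m"
proof -
  let ?g = "\<lambda>j t x. (\<i> * complex_of_real x) ^ j * iexp (t * x)"
  note int = integrable_iexp_moment[OF moment]
  have "D j (t + h) - (\<Sum>i<m. of_real (h ^ i / fact i) * D (j + i) t)
      = (CLINT x|M. ?g j (t + h) x - (\<Sum>i<m. of_real (h ^ i / fact i) * ?g (j + i) t x))"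
    unfolding D_def
    by (simp only: Bochner_Integration.integral_diff[OF int Bochner_Integration.integrable_sum[OF integrable_mult_right[OF int]]]
          Bochner_Integration.integral_sum[OF integrable_mult_right[OF int]] integral_mult_right_zero)
  also have "cmod \<dots> \<le> expectation (\<lambda>x. \<bar>x\<bar> ^ (j + m) * (\<bar>h\<bar> ^ m / fact m))"
  proof (rule Bochner_Integration.integral_norm_bound_integral)
    show "integrable M (\<lambda>x. ?g j (t + h) x - (\<Sum>i<m. of_real (h ^ i / fact i) * ?g (j + i) t x))"
      by (intro Bochner_Integration.integrable_diff int Bochner_Integration.integrable_sum integrable_mult_right)
    show "integrable M (\<lambda>x. \<bar>x\<bar> ^ (j + m) * (\<bar>h\<bar> ^ m / fact m))"
      using integrable_abs[OF moment[of "j + m"]] by (intro integrable_mult_left) (simp add: power_abs)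
    fix x
    have approx: "cmod (iexp y - (\<Sum>i<m. (\<i> * of_real y) ^ i / fact i)) \<le> \<bar>y\<bar> ^ m / fact m" for y
      using iexp_approx1[of y "m - 1"] by (cases m) (simp_all add: lessThan_Suc_atMost)
    have "?g j (t + h) x - (\<Sum>i<m. of_real (h ^ i / fact i) * ?g (j + i) t x)
        = ?g j t x * (iexp (h * x) - (\<Sum>i<m. (\<i> * of_real (h * x)) ^ i / fact i))"
      by (simp add: right_diff_distrib sum_distrib_left exp_add[symmetric] algebra_simps power_add power_mult_distrib)
    hence "cmod (?g j (t + h) x - (\<Sum>i<m. of_real (h ^ i / fact i) * ?g (j + i) t x))
        = \<bar>x\<bar> ^ j * cmod (iexp (h * x) - (\<Sum>i<m. (\<i> * of_real (h * x)) ^ i / fact i))"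
      by (simp only: norm_mult norm_power norm_exp_i_times norm_of_real norm_ii mult_1 mult_1_right)
    also have "\<dots> \<le> \<bar>x\<bar> ^ j * (\<bar>h * x\<bar> ^ m / fact m)"
      by (intro mult_left_mono approx) auto
    also have "\<dots> = \<bar>x\<bar> ^ (j + m) * (\<bar>h\<bar> ^ m / fact m)"
      by (simp add: abs_mult power_mult_distrib power_add)
    finally show "cmod (?g j (t + h) x - (\<Sum>i<m. of_real (h ^ i / fact i) * ?g (j + i) t x)) \<le> \<bar>x\<bar> ^ (j + m) * (\<bar>h\<bar> ^ m / fact m)" .
  qed
  also have "\<dots> = expectation (\<lambda>x. \<bar>x\<bar> ^ (j + m)) * \<bar>h\<bar> ^ m / fact m" by simp
  finally show ?thesis .
qed

lemma (in real_distribution) char_eq_1: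
  assumes "integrable M (\<lambda>x. x ^ 2)" "expectation (\<lambda>x. x ^ 2) = 0"
  shows "char M t = 1"
proof -
  have "AE x in M. x = 0"
    using integral_nonneg_eq_0_iff_AE[OF assms(1)] assms(2) by simp
  hence "char M t = (CLINT x|M. 1)"
    unfolding char_def by (intro integral_cong_AE) auto
  thus ?thesis using prob_space by simp
qed

definition moment :: "real measure \<Rightarrow> nat \<Rightarrow> real" where
  "moment M k = (\<integral>x. x ^ k \<partial>M)"

definition all_moments :: "real measure \<Rightarrow> bool" where
  "all_moments M \<longleftrightarrow> (\<forall>k. integrable M (\<lambda>x. x ^ k))"

text \<open>Log-convexity of absolute moments in the form of a quadratic form, which is additive in the measure.\<close>

lemma abs_moments_quadratic:
  fixes M :: "real measure"
  assumes "all_moments M"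
  shows "0 \<le> (\<integral>x. \<bar>x\<bar> ^ Suc (Suc n) \<partial>M) * s ^ 2 - 2 * (\<integral>x. \<bar>x\<bar> ^ Suc n \<partial>M) * s + (\<integral>x. \<bar>x\<bar> ^ n \<partial>M)"
proof -
  have int: "integrable M (\<lambda>x. \<bar>x\<bar> ^ k)" for k
    using integrable_abs[of M "\<lambda>x. x ^ k"] assms by (simp add: all_moments_def power_abs)
  have "0 \<le> (\<integral>x. \<bar>x\<bar> ^ n * (\<bar>x\<bar> * s - 1) ^ 2 \<partial>M)"
    by (intro Bochner_Integration.integral_nonneg mult_nonneg_nonneg) auto
  also have "\<dots> = (\<integral>x. \<bar>x\<bar> ^ Suc (Suc n) * s ^ 2 - \<bar>x\<bar> ^ Suc n * (2 * s) + \<bar>x\<bar> ^ n \<partial>M)"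
    by (intro Bochner_Integration.integral_cong) (simp_all add: power2_eq_square algebra_simps)
  also have "\<dots> = (\<integral>x. \<bar>x\<bar> ^ Suc (Suc n) \<partial>M) * s ^ 2 - (\<integral>x. \<bar>x\<bar> ^ Suc n \<partial>M) * (2 * s) + (\<integral>x. \<bar>x\<bar> ^ n \<partial>M)"
    by (simp only: Bochner_Integration.integral_add[OF Bochner_Integration.integrable_diff[OF integrable_mult_left[OF int] integrable_mult_left[OF int]] int]
          Bochner_Integration.integral_diff[OF integrable_mult_left[OF int] integrable_mult_left[OF int]] integral_mult_left_zero)
  finally show ?thesis by (simp add: mult_ac)
qed

text \<open>The odd absolute moments of \<open>M\<close> and \<open>N\<close> may differ, so the majorants are the sums of the
absolute moments of both. They are positive unless the second moment is \<open>0\<close>, a case in which both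
measures are the point mass at \<open>0\<close>.\<close>

theorem carleman_unique:
  assumes "real_distribution M" "real_distribution N"
    and mM: "all_moments M" and mN: "all_moments N"
    and eq: "\<And>k. moment M k = moment N k"
    and carl: "(\<Sum>k. inverse (ennreal (root (2 * Suc k) (moment M (2 * Suc k))))) = \<infinity>"
  shows "M = N"
proof -
  interpret M: real_distribution M by fact
  interpret N: real_distribution N by fact
  have iM: "integrable M (\<lambda>x. x ^ k)" and iN: "integrable N (\<lambda>x. x ^ k)" for k
    using mM mN by (auto simp: all_moments_def)
  have iMa: "integrable M (\<lambda>x. \<bar>x\<bar> ^ k)" and iNa: "integrable N (\<lambda>x. \<bar>x\<bar> ^ k)" for k
    using integrable_abs[OF iM] integrable_abs[OF iN] by (simp_all add: power_abs)
  have "char M = char N"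
  proof (cases "moment M 2 = 0")
    case True
    hence "moment N 2 = 0" using eq by simp
    with True show ?thesis
      using M.char_eq_1[OF iM] N.char_eq_1[OF iN] unfolding moment_def by (intro ext) auto
  next
    case False
    define A where "A n = (\<integral>x. \<bar>x\<bar> ^ n \<partial>M) + (\<integral>x. \<bar>x\<bar> ^ n \<partial>N)" for n
    define F where "F j t = (CLINT x|M. (\<i> * of_real x) ^ j * iexp (t * x)) - (CLINT x|N. (\<i> * of_real x) ^ j * iexp (t * x))"
      for j t
    have Apos: "0 < A n" for n
    proof -
      have nn: "0 \<le> (\<integral>x. \<bar>x\<bar> ^ n \<partial>M)" "0 \<le> (\<integral>x. \<bar>x\<bar> ^ n \<partial>N)" by (auto intro!: Bochner_Integration.integral_nonneg)
      have "(\<integral>x. \<bar>x\<bar> ^ n \<partial>M) \<noteq> 0"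
      proof
        assume "(\<integral>x. \<bar>x\<bar> ^ n \<partial>M) = 0"
        hence ae: "AE x in M. \<bar>x\<bar> ^ n = 0"
          using integral_nonneg_eq_0_iff_AE[OF iMa[of n]] by simp
        hence "AE x in M. x ^ 2 = 0" by eventually_elim (auto split: if_splits)
        hence "moment M 2 = 0" unfolding moment_def by (rule integral_eq_zero_AE)
        with False show False by simp
      qed
      with nn show ?thesis unfolding A_def by (intro add_pos_nonneg) (auto simp only: less_le)
    qed
    have quad: "0 \<le> A (Suc (Suc n)) * s ^ 2 - 2 * A (Suc n) * s + A n" for n s
      using add_mono[OF abs_moments_quadratic[OF mM, of n s] abs_moments_quadratic[OF mN, of n s]]
      by (simp add: A_def algebra_simps)
    interpret quasi_analytic F A
    proof
      fix j m t h
      define DM where "DM j t = (CLINT x|M. (\<i> * of_real x) ^ j * iexp (t * x))" for j t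
      define DN where "DN j t = (CLINT x|N. (\<i> * of_real x) ^ j * iexp (t * x))" for j t
      have F: "F = (\<lambda>j t. DM j t - DN j t)" by (simp add: F_def DM_def DN_def fun_eq_iff)
      have "F j (t + h) - (\<Sum>i<m. of_real (h ^ i / fact i) * F (j + i) t)
         = (DM j (t + h) - (\<Sum>i<m. of_real (h ^ i / fact i) * DM (j + i) t))
         - (DN j (t + h) - (\<Sum>i<m. of_real (h ^ i / fact i) * DN (j + i) t))"
        unfolding F right_diff_distrib sum_subtractf by (simp only: algebra_simps)
      also have "cmod \<dots> \<le> (\<integral>x. \<bar>x\<bar> ^ (j + m) \<partial>M) * \<bar>h\<bar> ^ m / fact m + (\<integral>x. \<bar>x\<bar> ^ (j + m) \<partial>N) * \<bar>h\<bar> ^ m / fact m"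
        unfolding DM_def DN_def by (intro order_trans[OF norm_triangle_ineq4] add_mono M.char_taylor N.char_taylor iM iN)
      also have "\<dots> = A (j + m) * \<bar>h\<bar> ^ m / fact m"
        by (simp add: A_def add_divide_distrib distrib_right)
      finally show "cmod (F j (t + h) - (\<Sum>i<m. of_real (h ^ i / fact i) * F (j + i) t)) \<le> A (j + m) * \<bar>h\<bar> ^ m / fact m" .
    next
      show "0 < A n" for n by (rule Apos)
      show "A (Suc n) ^ 2 \<le> A n * A (Suc (Suc n))" for n
        using quad[of n "A (Suc n) / A (Suc (Suc n))"] Apos[of "Suc (Suc n)"]
        by (simp add: field_simps power2_eq_square)
    qed
    have flat: "F j 0 = 0" for j
    proof -
      have "(CLINT x|M. (\<i> * of_real x) ^ j * iexp (0 * x)) = \<i> ^ j * of_real (moment M j)"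
        unfolding moment_def integral_complex_of_real[symmetric] integral_mult_right_zero[symmetric]
        by (simp add: power_mult_distrib)
      moreover have "(CLINT x|N. (\<i> * of_real x) ^ j * iexp (0 * x)) = \<i> ^ j * of_real (moment N j)"
        unfolding moment_def integral_complex_of_real[symmetric] integral_mult_right_zero[symmetric]
        by (simp add: power_mult_distrib)
      ultimately show ?thesis unfolding F_def eq by simp
    qed
    have div: "\<not> summable (\<lambda>n. A n / A (Suc n))"
    proof
      assume "summable (\<lambda>n. A n / A (Suc n))"
      hence s: "summable (\<lambda>n. root (Suc n) (\<Prod>i\<le>n. A i / A (Suc i)))"
        by (intro carleman_inequality divide_pos_pos Apos)
      have prod_eq: "(\<Prod>i\<le>n. A i / A (Suc i)) = A 0 / A (Suc n)" for n
      proof (induction n)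
        case (Suc n)
        thus ?case using Apos[of "Suc n"] by simp
      qed simp
      have A0: "A 0 = 2" using M.prob_space N.prob_space by (simp add: A_def)
      have Aev: "A (2 * k) = 2 * moment M (2 * k)" for k
        using eq[of "2 * k"] by (simp add: A_def moment_def power_even_abs)
      have mpos: "0 < moment M (2 * k)" for k using Apos[of "2 * k"] by (simp add: Aev)
      have "root (Suc (2 * k + 1)) (\<Prod>i\<le>2 * k + 1. A i / A (Suc i)) = inverse (root (2 * Suc k) (moment M (2 * Suc k)))" for k
      proof -
        have e: "Suc (2 * k + 1) = 2 * Suc k" by simp
        have 2: "2 / (2 * x) = inverse x" for x :: real by (simp add: field_simps)
        show ?thesis unfolding prod_eq e A0 Aev 2 by (rule real_root_inverse)
      qed
      moreover have "summable (\<lambda>k. f (2 * k + 1))" if "\<And>n. 0 \<le> f n" "summable f" for f :: "nat \<Rightarrow> real"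
      proof -
        have "summable (\<lambda>n. if odd n then f n else 0)"
          using that(1) by (intro summable_comparison_test'[OF that(2), of 0]) auto
        moreover have "strict_mono (\<lambda>k::nat. 2 * k + 1)" by (auto simp: strict_mono_def)
        ultimately have "summable (\<lambda>k. if odd (2 * k + 1) then f (2 * k + 1) else 0)"
          by (subst summable_mono_reindex[of "\<lambda>k::nat. 2 * k + 1" "\<lambda>n. if odd n then f n else 0"]) (auto elim!: oddE)
        thus ?thesis by simp
      qed
      from this[OF _ s] have "summable (\<lambda>k. root (Suc (2 * k + 1)) (\<Prod>i\<le>2 * k + 1. A i / A (Suc i)))"
        by (blast intro: real_root_ge_zero prod_nonneg divide_nonneg_pos Apos less_imp_le)
      ultimately have sm: "summable (\<lambda>k. inverse (root (2 * Suc k) (moment M (2 * Suc k))))" by simp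
      have "inverse (ennreal (root (2 * Suc k) (moment M (2 * Suc k)))) = ennreal (inverse (root (2 * Suc k) (moment M (2 * Suc k))))" for k
        by (rule inverse_ennreal) (intro real_root_gt_zero mpos; simp)
      hence "(\<Sum>k. ennreal (inverse (root (2 * Suc k) (moment M (2 * Suc k))))) = \<infinity>"
        using carl by simp
      moreover have "(\<Sum>k. ennreal (inverse (root (2 * Suc k) (moment M (2 * Suc k))))) = ennreal (\<Sum>k. inverse (root (2 * Suc k) (moment M (2 * Suc k))))"
        by (intro suminf_ennreal2 sm) (auto intro!: real_root_ge_zero less_imp_le mpos simp del: mult_Suc_right)
      ultimately show False by simp
    qed
    show ?thesis
    proof
      fix t
      show "char M t = char N t"
        using flat_imp_zero[OF flat div, of t] by (simp add: F_def char_def)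
    qed
  qed
  thus ?thesis by (intro Levy_uniqueness assms)
qed

section \<open>The method of moments\<close>

definition clip :: "real \<Rightarrow> real \<Rightarrow> real" where
  "clip R x = max (- R) (min R x)"

lemma clip_cont: "isCont (\<lambda>x. clip R x ^ k) x"
  unfolding clip_def by (intro continuous_intros)

lemma clip_measurable [measurable]: "clip R \<in> borel_measurable borel"
  unfolding clip_def[abs_def] by measurable

lemma clip_abs: "0 \<le> R \<Longrightarrow> \<bar>clip R x\<bar> = min R \<bar>x\<bar>"
  by (auto simp: clip_def)

lemma clip_power_bound: "0 \<le> R \<Longrightarrow> \<bar>clip R x ^ k\<bar> \<le> R ^ k"
  unfolding power_abs by (intro power_mono) (auto simp: clip_abs)

lemma clip_power_le: "0 \<le> R \<Longrightarrow> clip R x ^ (2 * k) \<le> x ^ (2 * k)"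
proof -
  assume "0 \<le> R"
  hence "\<bar>clip R x\<bar> ^ (2 * k) \<le> \<bar>x\<bar> ^ (2 * k)" by (intro power_mono) (auto simp: clip_abs)
  thus ?thesis by (simp add: power_even_abs)
qed

text \<open>Unbounded powers are replaced by the bounded continuous powers of the truncation, at the price of a
moment of twice the order.\<close>

lemma clip_power_diff:
  assumes R: "0 < R" shows "\<bar>x ^ k - clip R x ^ k\<bar> \<le> x ^ (2 * k) / R ^ k"
proof (cases "\<bar>x\<bar> \<le> R")
  case True
  hence "clip R x = x" by (auto simp: clip_def)
  thus ?thesis using R by (simp add: power_mult)
next
  case False
  have "x ^ k - clip R x ^ k = (if x < 0 then (- 1) ^ k * (\<bar>x\<bar> ^ k - R ^ k) else \<bar>x\<bar> ^ k - R ^ k)"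
    using False R by (auto simp: clip_def right_diff_distrib power_mult_distrib[symmetric])
  moreover have "R ^ k \<le> \<bar>x\<bar> ^ k" using False R by (intro power_mono) auto
  ultimately have "\<bar>x ^ k - clip R x ^ k\<bar> = \<bar>x\<bar> ^ k - R ^ k"
    by (auto simp: abs_mult power_abs)
  also have "\<dots> \<le> \<bar>x\<bar> ^ k * 1" using R by simp
  also have "\<dots> \<le> \<bar>x\<bar> ^ k * (\<bar>x\<bar> ^ k / R ^ k)"
    using \<open>R ^ k \<le> \<bar>x\<bar> ^ k\<close> R by (intro mult_left_mono) auto
  also have "\<dots> = x ^ (2 * k) / R ^ k"
    by (simp add: power_add[symmetric] mult_2[symmetric] power_even_abs)
  finally show ?thesis .
qed

lemma (in real_distribution) integrable_clip: "0 \<le> R \<Longrightarrow> integrable M (\<lambda>x. clip R x ^ k)"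
  using clip_power_bound[of R _ k]
  by (intro integrable_const_bound[where B = "R ^ k"]) auto

lemma (in real_distribution) clip_moment_diff:
  assumes "all_moments M" and R: "0 < R"
  shows "\<bar>moment M k - (\<integral>x. clip R x ^ k \<partial>M)\<bar> \<le> moment M (2 * k) / R ^ k"
proof -
  have int: "integrable M (\<lambda>x. x ^ j)" for j using assms(1) by (simp add: all_moments_def)
  have "moment M k - (\<integral>x. clip R x ^ k \<partial>M) = (\<integral>x. x ^ k - clip R x ^ k \<partial>M)"
    unfolding moment_def using R
    by (intro Bochner_Integration.integral_diff[symmetric] int integrable_clip less_imp_le)
  also have "\<bar>\<dots>\<bar> \<le> (\<integral>x. x ^ (2 * k) / R ^ k \<partial>M)"
    unfolding real_norm_def[symmetric] using R clip_power_diff[OF R]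
    by (intro Bochner_Integration.integral_norm_bound_integral Bochner_Integration.integrable_diff int integrable_clip
          Bochner_Integration.integrable_divide) auto
  finally show ?thesis by (simp add: moment_def)
qed

text \<open>Convergent moments of all orders are bounded, which gives uniform integrability of every power.\<close>

theorem weak_limit_moments:
  assumes rd: "\<And>n. real_distribution (\<nu> n)" "real_distribution \<mu>"
    and am: "\<And>n. all_moments (\<nu> n)"
    and lim: "\<And>k. (\<lambda>n. moment (\<nu> n) k) \<longlonglongrightarrow> m k"
    and wc: "weak_conv_m \<nu> \<mu>"
  shows "all_moments \<mu> \<and> (\<forall>k. moment \<mu> k = m k)"
proof -
  interpret real_distribution \<mu> by fact
  have "\<exists>K. \<forall>n. \<bar>moment (\<nu> n) k\<bar> \<le> K" for k
    using convergent_imp_Bseq[OF convergentI[OF lim[of k]]] by (auto simp: Bseq_def)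
  then obtain K where K: "\<And>k n. \<bar>moment (\<nu> n) k\<bar> \<le> K k" by metis
  have Kn: "\<And>k n. moment (\<nu> n) k \<le> K k" using K abs_le_D1 by blast
  have clim: "(\<lambda>n. \<integral>x. clip R x ^ k \<partial>\<nu> n) \<longlonglongrightarrow> (\<integral>x. clip R x ^ k \<partial>\<mu>)" if "0 < R" for R k
    using that clip_power_bound[of R _ k]
    by (intro weak_conv_imp_integral_bdd_continuous_conv[OF rd wc, where B = "R ^ k"] clip_cont) auto
  have even_le: "(\<integral>x. clip R x ^ (2 * k) \<partial>\<mu>) \<le> K (2 * k)" if R: "0 < R" for R k
  proof (rule LIMSEQ_le_const2[OF clim[OF R]])
    have "(\<integral>x. clip R x ^ (2 * k) \<partial>\<nu> n) \<le> moment (\<nu> n) (2 * k)" for n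
    proof -
      interpret n: real_distribution "\<nu> n" by (rule rd)
      show ?thesis unfolding moment_def
        using R am[of n] by (intro Bochner_Integration.integral_mono n.integrable_clip clip_power_le) (auto simp: all_moments_def)
    qed
    thus "\<exists>N. \<forall>n\<ge>N. (\<integral>x. clip R x ^ (2 * k) \<partial>\<nu> n) \<le> K (2 * k)"
      using Kn order_trans by blast
  qed
  have int_even: "integrable \<mu> (\<lambda>x. x ^ (2 * k))" for k
  proof -
    let ?f = "\<lambda>i x. clip (real (Suc i)) x ^ (2 * k)"
    have mono: "mono (\<lambda>i. ?f i x)" for x
    proof (rule monoI)
      fix i j :: nat assume "i \<le> j"
      hence "\<bar>clip (real (Suc i)) x\<bar> ^ (2 * k) \<le> \<bar>clip (real (Suc j)) x\<bar> ^ (2 * k)"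
        by (intro power_mono) (auto simp: clip_abs)
      thus "?f i x \<le> ?f j x" by (simp only: power_even_abs even_mult_iff even_numeral simp_thms)
    qed
    have "incseq (\<lambda>i. \<integral>x. ?f i x \<partial>\<mu>)"
      by (intro incseq_SucI Bochner_Integration.integral_mono integrable_clip monoD[OF mono]) auto
    then obtain L where L: "(\<lambda>i. \<integral>x. ?f i x \<partial>\<mu>) \<longlonglongrightarrow> L"
      using even_le[of _ k] by (elim incseq_convergent[where B = "K (2 * k)"]) auto
    show ?thesis
    proof (rule integrable_monotone_convergence[OF _ _ _ L])
      show "integrable \<mu> (?f i)" for i by (intro integrable_clip) auto
      show "AE x in \<mu>. mono (\<lambda>i. ?f i x)" using mono by auto
      show "AE x in \<mu>. (\<lambda>i. ?f i x) \<longlonglongrightarrow> x ^ (2 * k)"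
      proof (rule AE_I2)
        fix x
        obtain N :: nat where "\<bar>x\<bar> \<le> real N" using real_arch_simple by blast
        hence "\<forall>i\<ge>N. ?f i x = x ^ (2 * k)" by (auto simp: clip_def max_def min_def)
        thus "(\<lambda>i. ?f i x) \<longlonglongrightarrow> x ^ (2 * k)"
          by (intro tendsto_eventually) (auto simp: eventually_sequentially)
      qed
    qed simp
  qed
  have int: "integrable \<mu> (\<lambda>x. x ^ k)" for k
  proof (rule Bochner_Integration.integrable_bound)
    show "integrable \<mu> (\<lambda>x. 1 + x ^ (2 * k))" using int_even by simp
    have "\<bar>x ^ k\<bar> \<le> 1 + x ^ (2 * k)" for x :: real
      using sum_squares_bound[of "\<bar>x ^ k\<bar>" 1] by (simp add: power_mult power2_eq_square power_mult_distrib[symmetric])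
    thus "AE x in \<mu>. norm (x ^ k) \<le> norm (1 + x ^ (2 * k))" by (intro AE_I2) (auto intro: order_trans)
  qed simp
  hence am\<mu>: "all_moments \<mu>" by (simp add: all_moments_def)
  have mom_even: "moment \<mu> (2 * k) \<le> K (2 * k)" for k
  proof (rule LIMSEQ_le_const2)
    show "(\<lambda>i. \<integral>x. clip (real (Suc i)) x ^ (2 * k) \<partial>\<mu>) \<longlonglongrightarrow> moment \<mu> (2 * k)"
      unfolding moment_def
    proof (rule integral_dominated_convergence[where w = "\<lambda>x. x ^ (2 * k)"])
      show "AE x in \<mu>. (\<lambda>i. clip (real (Suc i)) x ^ (2 * k)) \<longlonglongrightarrow> x ^ (2 * k)"
      proof (rule AE_I2)
        fix x
        obtain N :: nat where "\<bar>x\<bar> \<le> real N" using real_arch_simple by blast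
        hence "\<forall>i\<ge>N. clip (real (Suc i)) x ^ (2 * k) = x ^ (2 * k)" by (auto simp: clip_def max_def min_def)
        thus "(\<lambda>i. clip (real (Suc i)) x ^ (2 * k)) \<longlonglongrightarrow> x ^ (2 * k)"
          by (intro tendsto_eventually) (auto simp: eventually_sequentially)
      qed
    qed (use int_even in \<open>auto intro!: clip_power_le\<close>)
    show "\<exists>N. \<forall>i\<ge>N. (\<integral>x. clip (real (Suc i)) x ^ (2 * k) \<partial>\<mu>) \<le> K (2 * k)"
      using even_le by auto
  qed
  have "moment \<mu> k = m k" for k
  proof (cases "k = 0")
    case True
    have "moment (\<nu> n) 0 = 1" for n
    proof -
      interpret n: real_distribution "\<nu> n" by (rule rd)
      show ?thesis using n.prob_space by (simp add: moment_def)
    qed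
    hence "(\<lambda>n. 1) \<longlonglongrightarrow> m 0" using lim[of 0] by simp
    hence "m 0 = 1" using LIMSEQ_unique tendsto_const by blast
    thus ?thesis using True prob_space by (simp add: moment_def)
  next
    case False
    have bound: "\<bar>moment \<mu> k - m k\<bar> \<le> 2 * K (2 * k) / R ^ k" if R: "0 < R" for R
    proof -
      have "\<bar>moment (\<nu> n) k - (\<integral>x. clip R x ^ k \<partial>\<nu> n)\<bar> \<le> K (2 * k) / R ^ k" for n
      proof -
        interpret n: real_distribution "\<nu> n" by (rule rd)
        have "moment (\<nu> n) (2 * k) / R ^ k \<le> K (2 * k) / R ^ k"
          using R by (intro divide_right_mono Kn) auto
        with n.clip_moment_diff[OF am R, of k] show ?thesis by linarith
      qed
      hence 1: "\<bar>m k - (\<integral>x. clip R x ^ k \<partial>\<mu>)\<bar> \<le> K (2 * k) / R ^ k"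
        by (intro LIMSEQ_le_const2[OF tendsto_rabs[OF tendsto_diff[OF lim clim[OF R]]]]) auto
      have "moment \<mu> (2 * k) / R ^ k \<le> K (2 * k) / R ^ k"
        using R by (intro divide_right_mono mom_even) auto
      with clip_moment_diff[OF am\<mu> R, of k] 1 show ?thesis by (simp add: field_simps)
    qed
    have "(\<lambda>i. 2 * K (2 * k) / real (Suc i) ^ k) \<longlonglongrightarrow> 0"
      using False
      by (intro tendsto_divide_0[OF tendsto_const] filterlim_at_top_imp_at_infinity
            filterlim_compose[OF filterlim_pow_at_top[of k "\<lambda>x. x", OF _ filterlim_ident]]
            filterlim_compose[OF filterlim_real_sequentially filterlim_Suc]) auto
    hence "\<bar>moment \<mu> k - m k\<bar> \<le> 0"
      by (rule LIMSEQ_le_const) (intro exI allI impI bound; simp)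
    thus ?thesis by simp
  qed
  with am\<mu> show ?thesis by simp
qed

lemma tight_of_second_moments:
  assumes rd: "\<And>n. real_distribution (\<nu> n)"
    and am: "\<And>n. all_moments (\<nu> n)"
    and K: "\<And>n. moment (\<nu> n) 2 \<le> K"
  shows "tight \<nu>"
  unfolding tight_def
proof (intro conjI allI impI rd)
  fix e :: real assume e: "0 < e"
  define a where "a = sqrt (\<bar>K\<bar> / e) + 1"
  have a: "1 \<le> a" using e by (simp add: a_def)
  have "\<bar>K\<bar> / e < a ^ 2"
    using e real_sqrt_ge_zero[of "\<bar>K\<bar> / e"] unfolding a_def power2_sum
    by (simp del: real_sqrt_ge_0_iff)
  hence Ka: "K / a ^ 2 < e"
    using e a by (simp add: field_simps)
  have "1 - e < measure (\<nu> n) {-a<..a}" for n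
  proof -
    interpret n: real_distribution "\<nu> n" by (rule rd)
    have "measure (\<nu> n) {x \<in> space (\<nu> n). a ^ 2 \<le> x ^ 2} \<le> (\<integral>x. x ^ 2 \<partial>\<nu> n) / a ^ 2"
      using a am[of n] by (intro integral_Markov_inequality_measure[where A = "{}"]) (auto simp: all_moments_def)
    also have "\<dots> \<le> K / a ^ 2" using K[of n] by (intro divide_right_mono) (auto simp: moment_def)
    finally have "measure (\<nu> n) {x. a ^ 2 \<le> x ^ 2} < e" using Ka by simp
    moreover have "measure (\<nu> n) (UNIV - {-a<..a}) \<le> measure (\<nu> n) {x. a ^ 2 \<le> x ^ 2}"
    proof (rule n.finite_measure_mono)
      show "UNIV - {-a<..a} \<subseteq> {x. a ^ 2 \<le> x ^ 2}"
        using a by (auto simp: abs_le_square_iff[symmetric])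
    qed simp
    moreover have "measure (\<nu> n) (UNIV - {-a<..a}) = 1 - measure (\<nu> n) {-a<..a}"
      using n.prob_compl[of "{-a<..a}"] by simp
    ultimately show ?thesis by simp
  qed
  thus "\<exists>a b::real. a < b \<and> (\<forall>n. 1 - e < measure (\<nu> n) {a<..b})"
    using a by (intro exI[of _ "- a"] exI[of _ a]) auto
qed

text \<open>Every weakly convergent subsequence has a limit with the moments \<open>m\<close>, and there is only one such
limit.\<close>

theorem method_of_moments:
  assumes rd: "\<And>n. real_distribution (\<nu> n)"
    and am: "\<And>n. all_moments (\<nu> n)"
    and lim: "\<And>k. (\<lambda>n. moment (\<nu> n) k) \<longlonglongrightarrow> m k"
    and carl: "(\<Sum>k. inverse (ennreal (root (2 * Suc k) (m (2 * Suc k))))) = \<infinity>"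
  obtains \<mu> where "real_distribution \<mu>" "all_moments \<mu>" "\<And>k. moment \<mu> k = m k" "weak_conv_m \<nu> \<mu>"
proof -
  have "\<exists>K. \<forall>n. \<bar>moment (\<nu> n) 2\<bar> \<le> K"
    using convergent_imp_Bseq[OF convergentI[OF lim[of 2]]] by (auto simp: Bseq_def)
  then obtain K where "\<And>n. moment (\<nu> n) 2 \<le> K" using abs_le_D1 by blast
  hence tight: "tight \<nu>" by (intro tight_of_second_moments rd am)
  have sub: "all_moments \<rho> \<and> (\<forall>k. moment \<rho> k = m k)"
    if "strict_mono s" "real_distribution \<rho>" "weak_conv_m (\<nu> \<circ> s) \<rho>" for s \<rho>
    using that LIMSEQ_subseq_LIMSEQ[OF lim that(1)] 
    by (intro weak_limit_moments[of "\<nu> \<circ> s"]) (auto simp: rd am o_def)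
  obtain r \<mu> where r: "strict_mono (r :: nat \<Rightarrow> nat)" "real_distribution \<mu>" "weak_conv_m (\<nu> \<circ> id \<circ> r) \<mu>"
    using tight_imp_convergent_subsubsequence[OF tight strict_mono_id] by blast
  have \<mu>: "all_moments \<mu>" "\<And>k. moment \<mu> k = m k" using sub[OF r(1,2)] r(3) by auto
  have "weak_conv_m \<nu> \<mu>"
  proof (rule tight_subseq_weak_converge[OF rd r(2) tight])
    fix s \<rho> assume *: "strict_mono s" "real_distribution \<rho>" "weak_conv_m (\<nu> \<circ> s) \<rho>"
    have "\<rho> = \<mu>"
      using sub[OF *] \<mu> carl * r by (intro carleman_unique) auto
    with * show "weak_conv_m (\<nu> \<circ> s) \<mu>" by simp
  qed
  with r \<mu> that show thesis by blast
qed

section \<open>Counting lattice points of dilated sets\<close>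

abbreviation leb :: "'i set \<Rightarrow> ('i \<Rightarrow> real) measure" where
  "leb I \<equiv> PiM I (\<lambda>_. lborel)"

interpretation lborel_product: product_sigma_finite "\<lambda>_. lborel :: real measure"
  by (simp add: product_sigma_finite_def sigma_finite_lborel)

text \<open>By Fubini: when all coordinates except \<open>w v\<close> are fixed, the equation has one solution.\<close>

lemma AE_affine_nonzero:
  fixes a :: "'i \<Rightarrow> real"
  assumes I: "finite I" and v: "v \<in> I" "a v \<noteq> 0"
  shows "AE w in leb I. (\<Sum>i\<in>I. a i * w i) + t \<noteq> 0"
proof -
  define J where "J = I - {v}"
  have J: "finite J" "v \<notin> J" "I = insert v J" using I v by (auto simp: J_def)
  let ?N = "{w \<in> space (leb I). (\<Sum>i\<in>I. a i * w i) + t = 0}"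
  have meas: "?N \<in> sets (leb I)" by measurable
  have "emeasure (leb I) ?N = (\<integral>\<^sup>+ w. indicator ?N w \<partial>leb I)" using meas by simp
  also have "\<dots> = (\<integral>\<^sup>+ w. (\<integral>\<^sup>+ y. indicator ?N (w(v := y)) \<partial>lborel) \<partial>leb J)"
    using meas unfolding J(3) by (intro lborel_product.product_nn_integral_insert J) simp
  also have "\<dots> = (\<integral>\<^sup>+ w. 0 \<partial>leb J)"
  proof (rule nn_integral_cong)
    fix w :: "'i \<Rightarrow> real"
    let ?y = "- ((\<Sum>i\<in>J. a i * w i) + t) / a v"
    have "(\<Sum>i\<in>I. a i * (w(v := y)) i) = a v * y + (\<Sum>i\<in>J. a i * w i)" for y
      unfolding J(3) using J(1,2) by (simp add: sum.insert) (intro sum.cong, auto)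
    hence "indicator ?N (w(v := y)) \<le> (indicator {?y} y :: ennreal)" for y
      using v(2) by (auto simp: indicator_def field_simps)
    hence "(\<integral>\<^sup>+ y. indicator ?N (w(v := y)) \<partial>lborel) \<le> (\<integral>\<^sup>+ y. indicator {?y} y \<partial>lborel)"
      by (intro nn_integral_mono)
    thus "(\<integral>\<^sup>+ y. indicator ?N (w(v := y)) \<partial>lborel) = 0" by simp
  qed
  finally have "emeasure (leb I) ?N = 0" by simp
  thus ?thesis using meas by (intro AE_I[where N = ?N]) auto
qed

definition grid :: "'i set \<Rightarrow> nat \<Rightarrow> ('i \<Rightarrow> real) \<Rightarrow> 'i \<Rightarrow> int" where
  "grid I n w = (\<lambda>i\<in>I. \<lfloor>real n * w i\<rfloor>)"

lemma grid_LIMSEQ: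
  assumes "i \<in> I" shows "(\<lambda>n. real_of_int (grid I n w i) / real n) \<longlonglongrightarrow> w i"

proof (rule LIM_zero_cancel, rule Lim_null_comparison)
  have "norm (real_of_int (grid I n w i) / real n - w i) \<le> inverse (real n)" if "0 < n" for n
  proof -
    have "real_of_int (grid I n w i) / real n - w i = (real_of_int \<lfloor>real n * w i\<rfloor> - real n * w i) / real n"
      using assms that by (simp add: grid_def diff_divide_distrib)
    also have "\<bar>\<dots>\<bar> \<le> 1 / real n"
      unfolding abs_divide by (intro frac_le) (use that in linarith)+
    finally show ?thesis by (simp add: inverse_eq_divide)
  qed
  thus "\<forall>\<^sub>F n in sequentially. norm (real_of_int (grid I n w i) / real n - w i) \<le> inverse (real n)"
    by (intro eventually_mono[OF eventually_gt_at_top[of 0]]) auto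
  show "(\<lambda>n. inverse (real n)) \<longlonglongrightarrow> 0" by (rule lim_inverse_n)
qed

text \<open>The side \<open>3 * n\<close> leaves room for all link values, which are at most \<open>2 * n\<close>.\<close>

definition lattice_box :: "'i set \<Rightarrow> nat \<Rightarrow> ('i \<Rightarrow> int) set" where
  "lattice_box I n = PiE I (\<lambda>_. {0..<3 * int n})"

lemma finite_lattice_box: "finite I \<Longrightarrow> finite (lattice_box I n)"
  by (simp add: lattice_box_def finite_PiE)

lemma card_lattice_box: "finite I \<Longrightarrow> card (lattice_box I n) = (3 * n) ^ card I"
  by (simp add: lattice_box_def card_PiE nat_mult_distrib)

lemma grid_in_lattice_box_iff:
  assumes "0 < n" "w \<in> space (leb I)"
  shows "grid I n w \<in> lattice_box I n \<longleftrightarrow> w \<in> PiE I (\<lambda>_. {0..<3})"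
proof -
  have "0 \<le> \<lfloor>real n * x\<rfloor> \<and> \<lfloor>real n * x\<rfloor> < 3 * int n \<longleftrightarrow> 0 \<le> x \<and> x < 3" for x
  proof -
    have "\<lfloor>real n * x\<rfloor> < 3 * int n \<longleftrightarrow> real n * x < real n * 3" by (simp add: floor_less_iff mult.commute)
    thus ?thesis using assms(1) by (simp add: zero_le_mult_iff)
  qed
  thus ?thesis using assms(2) by (auto simp: grid_def lattice_box_def PiE_iff space_PiM)
qed

definition cube :: "'i set \<Rightarrow> nat \<Rightarrow> ('i \<Rightarrow> int) \<Rightarrow> ('i \<Rightarrow> real) set" where
  "cube I n z = PiE I (\<lambda>i. {of_int (z i) / real n..<(of_int (z i) + 1) / real n})"

lemma in_cube_iff:
  assumes "0 < n" "w \<in> space (leb I)" "z \<in> extensional I"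
  shows "w \<in> cube I n z \<longleftrightarrow> grid I n w = z"
proof -
  have "x \<in> {of_int c / real n..<(of_int c + 1) / real n} \<longleftrightarrow> \<lfloor>real n * x\<rfloor> = c" for x c
    using assms(1) by (auto simp: floor_eq_iff field_simps)
  thus ?thesis using assms(2,3)
    by (auto simp: cube_def PiE_iff space_PiM grid_def fun_eq_iff extensional_def restrict_def)
qed

lemma cube_sets: "finite I \<Longrightarrow> cube I n z \<in> sets (leb I)"
  unfolding cube_def by (intro sets_PiM_I_finite) auto

lemma emeasure_cube:
  assumes "finite I" "0 < n"
  shows "emeasure (leb I) (cube I n z) = ennreal ((1 / real n) ^ card I)"
proof -
  have "emeasure (leb I) (cube I n z) = (\<Prod>i\<in>I. emeasure lborel {of_int (z i) / real n..<(of_int (z i) + 1) / real n})"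
    unfolding cube_def by (intro lborel_product.emeasure_PiM assms) auto
  also have "\<dots> = (\<Prod>i\<in>I. ennreal (1 / real n))"
    using assms(2) by (intro prod.cong refl) (simp add: divide_right_mono flip: diff_divide_distrib)
  also have "\<dots> = ennreal ((1 / real n) ^ card I)" by (simp add: ennreal_power)
  finally show ?thesis .
qed

text \<open>Each lattice point stands for the cube of side \<open>1 / n\<close> on which \<open>grid\<close> takes it as its value.\<close>

lemma card_eq_measure:
  fixes P :: "('i \<Rightarrow> int) \<Rightarrow> bool"
  assumes I: "finite I" and n: "0 < n"
  defines "E \<equiv> {w \<in> space (leb I). grid I n w \<in> lattice_box I n \<and> P (grid I n w)}"
  shows "E \<in> sets (leb I)"
    and "real (card {z \<in> lattice_box I n. P z}) / real n ^ card I = measure (leb I) E"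
proof -
  let ?Z = "{z \<in> lattice_box I n. P z}"
  have Z: "finite ?Z" using finite_lattice_box[OF I] by simp
  have ext: "z \<in> extensional I" if "z \<in> ?Z" for z using that by (auto simp: lattice_box_def PiE_iff)
  have cs: "cube I n z \<subseteq> space (leb I)" for z using sets.sets_into_space[OF cube_sets[OF I]] .
  have E: "E = (\<Union>z\<in>?Z. cube I n z)"
  proof (intro equalityI subsetI)
    fix w assume "w \<in> E"
    thus "w \<in> (\<Union>z\<in>?Z. cube I n z)"
      using in_cube_iff[OF n, of w I "grid I n w"] ext by (auto simp: E_def)
  next
    fix w assume "w \<in> (\<Union>z\<in>?Z. cube I n z)"
    then obtain z where z: "z \<in> ?Z" "w \<in> cube I n z" by blast
    hence "w \<in> space (leb I)" using cs by blast
    with z in_cube_iff[OF n this ext[OF z(1)]] show "w \<in> E" by (auto simp: E_def)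
  qed
  show "E \<in> sets (leb I)" unfolding E using Z cube_sets[OF I] by auto
  have disj: "disjoint_family_on (cube I n) ?Z"
    unfolding disjoint_family_on_def
  proof (intro ballI impI)
    fix y z assume yz: "y \<in> ?Z" "z \<in> ?Z" "y \<noteq> z"
    have False if "w \<in> cube I n y" "w \<in> cube I n z" for w
    proof -
      have "w \<in> space (leb I)" using that cs by blast
      thus False using that yz in_cube_iff[OF n _ ext] by metis
    qed
    thus "cube I n y \<inter> cube I n z = {}" by blast
  qed
  have "emeasure (leb I) E = (\<Sum>z\<in>?Z. emeasure (leb I) (cube I n z))"
    unfolding E using Z cube_sets[OF I] disj by (intro sum_emeasure[symmetric]) auto
  also have "\<dots> = ennreal (real (card ?Z) / real n ^ card I)"
    by (simp add: emeasure_cube[OF I n] ennreal_of_nat_eq_real_of_nat ennreal_mult[symmetric] power_one_over divide_inverse power_inverse)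
  finally show "real (card ?Z) / real n ^ card I = measure (leb I) E"
    by (simp add: measure_def)
qed

text \<open>The parameter \<open>s\<close> ranges over a family of sequences, here of band widths, and the limiting
predicate \<open>Q\<close> must be the same for all of them. This is what makes the limits depend on \<open>\<alpha>\<close>
alone.\<close>

definition stabilises :: "'i set \<Rightarrow> 's set \<Rightarrow> ('s \<Rightarrow> nat \<Rightarrow> ('i \<Rightarrow> int) \<Rightarrow> bool) \<Rightarrow> (('i \<Rightarrow> real) \<Rightarrow> bool) \<Rightarrow> bool" where
  "stabilises I S P Q \<longleftrightarrow> Measurable.pred (leb I) Q \<and>
     (\<forall>s\<in>S. AE w in leb I. \<forall>\<^sub>F n in sequentially. P s n (grid I n w) \<longleftrightarrow> Q w)"

text \<open>Dominated convergence for the indicator functions of the sets of cubes.\<close>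

theorem stabilises_density:
  assumes I: "finite I" and st: "stabilises I S P Q" and s: "s \<in> S"
  shows "(\<lambda>n. real (card {z \<in> lattice_box I n. P s n z}) / real n ^ card I)
     \<longlonglongrightarrow> measure (leb I) {w \<in> PiE I (\<lambda>_. {0..<3}). Q w}"
proof -
  define E where "E n = {w \<in> space (leb I). grid I n w \<in> lattice_box I n \<and> P s n (grid I n w)}" for n
  define B where "B = PiE I (\<lambda>_. {0..<3::real})"
  have Bs: "B \<in> sets (leb I)" unfolding B_def using I by (intro sets_PiM_I_finite) auto
  hence Bsp: "B \<subseteq> space (leb I)" by (rule sets.sets_into_space)
  have Bm: "emeasure (leb I) B = (\<Prod>i\<in>I. 3)"
    unfolding B_def using I by (subst lborel_product.emeasure_PiM) auto
  have Bfin: "emeasure (leb I) B < \<infinity>"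
    unfolding Bm by (simp add: power_less_top_ennreal)
  have Q: "{w \<in> space (leb I). Q w} \<in> sets (leb I)" using st by (simp add: stabilises_def pred_def)
  have BQ: "{w \<in> B. Q w} \<in> sets (leb I)"
  proof -
    have "{w \<in> B. Q w} = B \<inter> {w \<in> space (leb I). Q w}" using Bsp by auto
    thus ?thesis using Bs Q by simp
  qed
  have Es: "E n \<in> sets (leb I)" if "0 < n" for n unfolding E_def by (rule card_eq_measure[OF I that])
  have "(\<lambda>n. \<integral>w. indicator (E (Suc n)) w \<partial>leb I) \<longlonglongrightarrow> (\<integral>w. (indicator {w \<in> B. Q w} w :: real) \<partial>leb I)"
  proof (rule integral_dominated_convergence[where w = "indicator B"])
    show "integrable (leb I) (indicator B :: _ \<Rightarrow> real)"
      using Bs Bfin by simp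
    show "AE w in leb I. (\<lambda>n. indicator (E (Suc n)) w :: real) \<longlonglongrightarrow> indicator {w \<in> B. Q w} w"
    proof -
      have "AE w in leb I. \<forall>\<^sub>F n in sequentially. P s n (grid I n w) \<longleftrightarrow> Q w"
        using st s by (simp add: stabilises_def)
      thus ?thesis
      proof eventually_elim
        case (elim w)
        show ?case
        proof (cases "w \<in> space (leb I)")
          case True
          have "\<forall>\<^sub>F n in sequentially. P s (Suc n) (grid I (Suc n) w) \<longleftrightarrow> Q w"
            using elim by (subst eventually_sequentially_Suc)
          hence "\<forall>\<^sub>F n in sequentially. indicator (E (Suc n)) w = (indicator {w \<in> B. Q w} w :: real)"
            by (rule eventually_mono) (use True grid_in_lattice_box_iff[OF _ True] in \<open>auto simp: indicator_def E_def B_def\<close>)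
          thus ?thesis by (rule tendsto_eventually)
        next
          case False
          hence "w \<notin> B" "\<And>n. w \<notin> E n" using Bsp by (auto simp: E_def)
          thus ?thesis by (simp add: indicator_def)
        qed
      qed
    qed
    show "AE w in leb I. norm (indicator (E (Suc n)) w :: real) \<le> indicator B w" for n
      using grid_in_lattice_box_iff[of "Suc n" _ I] by (intro AE_I2) (auto simp: indicator_def E_def B_def)
  qed (use Es BQ in auto)
  moreover have "(\<integral>w. indicator (E (Suc n)) w \<partial>leb I) = real (card {z \<in> lattice_box I (Suc n). P s (Suc n) z}) / real (Suc n) ^ card I" for n
    using card_eq_measure(2)[OF I, of "Suc n" "P s (Suc n)"] Es[of "Suc n"] sets.sets_into_space[OF Es[of "Suc n"]]
    by (simp add: E_def Int_absorb2)
  moreover have "(\<integral>w. (indicator {w \<in> B. Q w} w :: real) \<partial>leb I) = measure (leb I) {w \<in> B. Q w}"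
    using BQ sets.sets_into_space[OF BQ] by (simp add: Int_absorb2)
  ultimately have "(\<lambda>n. real (card {z \<in> lattice_box I (Suc n). P s (Suc n) z}) / real (Suc n) ^ card I) \<longlonglongrightarrow> measure (leb I) {w \<in> B. Q w}"
    by simp
  thus ?thesis unfolding B_def by (rule LIMSEQ_imp_Suc)
qed

definition stable :: "'i set \<Rightarrow> 's set \<Rightarrow> ('s \<Rightarrow> nat \<Rightarrow> ('i \<Rightarrow> int) \<Rightarrow> bool) \<Rightarrow> bool" where
  "stable I S P \<longleftrightarrow> (\<exists>Q. stabilises I S P Q)"

lemma stable_comb:
  assumes "stable I S P" "stable I S P'"
  shows "stable I S (\<lambda>s n z. f (P s n z) (P' s n z))"
proof -
  obtain Q Q' where Q: "stabilises I S P Q" "stabilises I S P' Q'" using assms by (auto simp: stable_def)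
  have m: "Measurable.pred (leb I) Q" "Measurable.pred (leb I) Q'" using Q by (auto simp: stabilises_def)
  have "f (Q w) (Q' w) \<longleftrightarrow> (f True True \<and> Q w \<and> Q' w) \<or> (f True False \<and> Q w \<and> \<not> Q' w)
     \<or> (f False True \<and> \<not> Q w \<and> Q' w) \<or> (f False False \<and> \<not> Q w \<and> \<not> Q' w)" for w
    by (cases "Q w"; cases "Q' w") auto
  hence "Measurable.pred (leb I) (\<lambda>w. f (Q w) (Q' w))" using m by simp
  moreover have "AE w in leb I. \<forall>\<^sub>F n in sequentially. f (P s n (grid I n w)) (P' s n (grid I n w)) \<longleftrightarrow> f (Q w) (Q' w)"
    if "s \<in> S" for s
  proof -
    have "AE w in leb I. \<forall>\<^sub>F n in sequentially. P s n (grid I n w) \<longleftrightarrow> Q w"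
      "AE w in leb I. \<forall>\<^sub>F n in sequentially. P' s n (grid I n w) \<longleftrightarrow> Q' w"
      using Q that by (auto simp: stabilises_def)
    thus ?thesis
    proof eventually_elim
      case (elim w)
      thus ?case by eventually_elim simp
    qed
  qed
  ultimately show ?thesis unfolding stable_def stabilises_def by blast
qed

lemma stable_const: "stable I S (\<lambda>_ _ _. c)"
  unfolding stable_def stabilises_def by (intro exI[of _ "\<lambda>_. c"]) simp

lemmas stable_conj = stable_comb[where f = "(\<and>)"] and stable_disj = stable_comb[where f = "(\<or>)"]
  and stable_imp = stable_comb[where f = "(\<longrightarrow>)"]

lemma stable_ball:
  "finite J \<Longrightarrow> (\<And>j. j \<in> J \<Longrightarrow> stable I S (P j)) \<Longrightarrow> stable I S (\<lambda>s n z. \<forall>j\<in>J. P j s n z)"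
proof (induction J rule: finite_induct)
  case (insert j J)
  have "stable I S (\<lambda>s n z. P j s n z \<and> (\<forall>j\<in>J. P j s n z))"
    using insert by (intro stable_conj) auto
  thus ?case by simp
qed (simp add: stable_const)

definition band_widths :: "real \<Rightarrow> (nat \<Rightarrow> int) set" where
  "band_widths \<alpha> = {m. (\<lambda>n. real_of_int (m n) / real n) \<longlonglongrightarrow> \<alpha>}"

lemma affine_LIMSEQ:
  fixes a :: "'i \<Rightarrow> int" and b t c :: int
  assumes I: "finite I" and m: "m \<in> band_widths \<alpha>"
  shows "(\<lambda>n. real_of_int ((\<Sum>i\<in>I. a i * grid I n w i) + b * m n + t * int n + c) / real n)
     \<longlonglongrightarrow> (\<Sum>i\<in>I. real_of_int (a i) * w i) + (of_int b * \<alpha> + of_int t)"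
proof (rule Lim_transform_eventually)
  show "(\<lambda>n. (\<Sum>i\<in>I. of_int (a i) * (of_int (grid I n w i) / real n)) + (of_int b * (of_int (m n) / real n) + of_int t) + of_int c * inverse (real n))
     \<longlonglongrightarrow> (\<Sum>i\<in>I. real_of_int (a i) * w i) + (of_int b * \<alpha> + of_int t)"
  proof -
    have "(\<lambda>n. of_int c * inverse (real n)) \<longlonglongrightarrow> 0"
      by (rule tendsto_mult_right_zero[OF lim_inverse_n])
    moreover have "(\<lambda>n. (\<Sum>i\<in>I. of_int (a i) * (of_int (grid I n w i) / real n)) + (of_int b * (of_int (m n) / real n) + of_int t))
       \<longlonglongrightarrow> (\<Sum>i\<in>I. real_of_int (a i) * w i) + (of_int b * \<alpha> + of_int t)"
      using m unfolding band_widths_def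
      by (intro tendsto_add tendsto_sum tendsto_mult tendsto_const grid_LIMSEQ) auto
    ultimately show ?thesis using tendsto_add by fastforce
  qed
  show "\<forall>\<^sub>F n in sequentially. (\<Sum>i\<in>I. of_int (a i) * (of_int (grid I n w i) / real n)) + (of_int b * (of_int (m n) / real n) + of_int t) + of_int c * inverse (real n)
     = real_of_int ((\<Sum>i\<in>I. a i * grid I n w i) + b * m n + t * int n + c) / real n"
    using eventually_gt_at_top[of 0]
    by eventually_elim (simp add: add_divide_distrib sum_divide_distrib inverse_eq_divide)
qed

lemma affine_eventually_nonzero:
  fixes a :: "'i \<Rightarrow> int" and b t c :: int
  assumes I: "finite I" and v: "v \<in> I" "a v \<noteq> 0" and m: "m \<in> band_widths \<alpha>"
  shows "AE w in leb I. \<forall>\<^sub>F n in sequentially. (\<Sum>i\<in>I. a i * grid I n w i) + b * m n + t * int n + c \<noteq> 0"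
proof -
  have "AE w in leb I. (\<Sum>i\<in>I. real_of_int (a i) * w i) + (of_int b * \<alpha> + of_int t) \<noteq> 0"
    using v by (intro AE_affine_nonzero[OF I]) auto
  thus ?thesis
  proof eventually_elim
    case (elim w)
    from tendsto_imp_eventually_ne[OF affine_LIMSEQ[OF I m, of a w b t c] this]
    show ?case by eventually_elim (auto simp del: of_int_add of_int_sum of_int_mult)
  qed
qed

text \<open>Divided by \<open>n\<close>, the form converges to a limit that is almost surely nonzero if some variable occurs;
then its sign stabilises. If no variable occurs, the sign is decided by \<open>t\<close> or else by \<open>c\<close>. The
band width is excluded in this case, since the sign of \<open>b * m n + t * int n + c\<close> is not determined
by the limit of \<open>m n / n\<close>.\<close>

lemma stable_affine:
  fixes a :: "'i \<Rightarrow> int" and b t c :: int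
  assumes I: "finite I" and b: "b = 0 \<or> (\<exists>i\<in>I. a i \<noteq> 0)"
  shows "stable I (band_widths \<alpha>) (\<lambda>m n z. 0 \<le> (\<Sum>i\<in>I. a i * z i) + b * m n + t * int n + c)"
proof (cases "\<exists>i\<in>I. a i \<noteq> 0")
  case True
  then obtain v where v: "v \<in> I" "a v \<noteq> 0" by blast
  define L where "L w = (\<Sum>i\<in>I. real_of_int (a i) * w i) + (of_int b * \<alpha> + of_int t)" for w
  have "Measurable.pred (leb I) (\<lambda>w. 0 < L w)" unfolding L_def by measurable
  moreover have "AE w in leb I. \<forall>\<^sub>F n in sequentially. (0 \<le> (\<Sum>i\<in>I. a i * grid I n w i) + b * m n + t * int n + c) \<longleftrightarrow> 0 < L w"
    if m: "m \<in> band_widths \<alpha>" for m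
  proof -
    have "AE w in leb I. L w \<noteq> 0" unfolding L_def using v by (intro AE_affine_nonzero[OF I]) auto
    thus ?thesis
    proof eventually_elim
      case (elim w)
      define F where "F n = (\<Sum>i\<in>I. a i * grid I n w i) + b * m n + t * int n + c" for n
      have lim: "(\<lambda>n. real_of_int (F n) / real n) \<longlonglongrightarrow> L w" unfolding L_def F_def by (rule affine_LIMSEQ[OF I m])
      have "\<forall>\<^sub>F n in sequentially. 0 \<le> F n \<longleftrightarrow> 0 < L w"
      proof (cases "0 < L w")
        case True
        from order_tendstoD(1)[OF lim this] eventually_gt_at_top[of 0] show ?thesis
          by eventually_elim (use True in \<open>simp add: zero_less_divide_iff\<close>)
      next
        case False
        hence "L w < 0" using elim by simp
        from order_tendstoD(2)[OF lim this] eventually_gt_at_top[of 0] show ?thesis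
          by eventually_elim (use False in \<open>simp add: divide_less_0_iff\<close>)
      qed
      thus ?case unfolding F_def .
    qed
  qed
  ultimately show ?thesis unfolding stable_def stabilises_def by blast
next
  case False
  hence a: "(\<Sum>i\<in>I. a i * z i) = 0" for z by (intro sum.neutral) auto
  have "b = 0" using b False by blast
  have "\<exists>q. \<forall>\<^sub>F n in sequentially. (0 \<le> t * int n + c) \<longleftrightarrow> q"
  proof -
    consider "t = 0" | "t > 0" | "t < 0" by linarith
    thus ?thesis
    proof cases
      case 1
      thus ?thesis by (intro exI[of _ "0 \<le> c"]) simp
    next
      case 2
      have "\<forall>\<^sub>F n in sequentially. 0 \<le> t * int n + c"
        using eventually_ge_at_top[of "nat \<bar>c\<bar>"]
      proof eventually_elim
        case (elim n)
        have "1 * int n \<le> t * int n" using 2 by (intro mult_right_mono) auto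
        thus ?case using elim by linarith
      qed
      thus ?thesis by (intro exI[of _ True]) simp
    next
      case 3
      have "\<forall>\<^sub>F n in sequentially. \<not> 0 \<le> t * int n + c"
        using eventually_gt_at_top[of "nat \<bar>c\<bar>"]
      proof eventually_elim
        case (elim n)
        have "t * int n \<le> (- 1) * int n" using 3 by (intro mult_right_mono) auto
        thus ?case using elim by linarith
      qed
      thus ?thesis by (intro exI[of _ False]) simp
    qed
  qed
  then obtain q where "\<forall>\<^sub>F n in sequentially. (0 \<le> t * int n + c) \<longleftrightarrow> q" by blast
  thus ?thesis unfolding stable_def stabilises_def a \<open>b = 0\<close>
    by (intro exI[of _ "\<lambda>_. q"]) simp
qed

section \<open>Circuits and their link values\<close>

type_synonym step = "int \<times> int \<times> int \<times> int"

text \<open>The ways of solving \<open>L(i,j) = l\<close> for \<open>j = s * i + e * l + t * n + c\<close>, as quadruples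
\<open>(s, e, t, c)\<close>, for vertices counted from \<open>0\<close>. For the reverse circulant pattern \<open>t\<close> is the carry
of the reduction modulo \<open>n\<close>; for the Toeplitz pattern \<open>e\<close> is the sign of \<open>j - i\<close>; for the Hankel
pattern \<open>c\<close> accounts for the shift of the vertices.\<close>

fun steps :: "pattern \<Rightarrow> step set" where
  "steps Reverse_Circulant = {(- 1, 1, 0, 0), (- 1, 1, 1, 0)}"
| "steps Toeplitz = {(1, 1, 0, 0), (1, - 1, 0, 0)}"
| "steps Hankel = {(- 1, 1, 0, - 2)}"

fun move :: "nat \<Rightarrow> step \<Rightarrow> int \<Rightarrow> int \<Rightarrow> int" where
  "move n (s, e, t, c) i l = s * i + e * l + t * int n + c"

text \<open>The lower bound \<open>1\<close> for decreasing Toeplitz steps avoids counting \<open>l = 0\<close> twice; for the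
reverse circulant pattern the upper bound selects the representative modulo \<open>n\<close>.\<close>

definition admissible :: "pattern \<Rightarrow> nat \<Rightarrow> step \<Rightarrow> int \<Rightarrow> bool" where
  "admissible p n q l \<longleftrightarrow> (if fst (snd q) = - 1 then 1 else 0) \<le> l \<and> (p \<noteq> Hankel \<longrightarrow> l < int n)"

lemma finite_steps: "finite (steps p)" and card_steps: "card (steps p) \<le> 2"
  by (cases p; simp)+

lemma link_step:
  assumes "i < n" "j < n"
  shows "(\<exists>q\<in>steps p. admissible p n q l \<and> int j = move n q (int i) l) \<longleftrightarrow> l = int (link p n (Suc i) (Suc j))"
proof (cases p)
  case Reverse_Circulant
  have "int (link p n (Suc i) (Suc j)) = (int i + int j) mod int n"
    by (simp add: Reverse_Circulant zmod_int)
  also have "\<dots> = (if int i + int j < int n then int i + int j else int i + int j - int n)"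
    using assms mod_pos_pos_trivial[of "int i + int j - int n" "int n"] by (auto simp: mod_pos_pos_trivial)
  finally show ?thesis using assms by (auto simp: Reverse_Circulant admissible_def)
next
  case Toeplitz
  show ?thesis using assms by (auto simp: Toeplitz admissible_def)
next
  case Hankel
  show ?thesis by (auto simp: Hankel admissible_def)
qed

lemma step_unique:
  assumes "q \<in> steps p" "q' \<in> steps p" "admissible p n q l" "admissible p n q' l"
    "move n q i l = move n q' i l" "0 < n"
  shows "q = q'"
  using assms by (cases p) (auto simp: admissible_def)

lemma link_bound: "i < n \<Longrightarrow> j < n \<Longrightarrow> link p n (Suc i) (Suc j) < 3 * n"
proof (cases p)
  case Reverse_Circulant
  assume "i < n" "j < n"
  hence "(i + j) mod n < n" by simp
  thus ?thesis by (simp add: Reverse_Circulant del: mod_less_divisor)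
qed auto

fun int_band :: "pattern \<Rightarrow> nat \<Rightarrow> int \<Rightarrow> int \<Rightarrow> bool" where
  "int_band Reverse_Circulant n m l \<longleftrightarrow> l \<le> m \<or> int n - m \<le> l"
| "int_band Toeplitz n m l \<longleftrightarrow> l \<le> m \<or> int n - m \<le> l"
| "int_band Hankel n m l \<longleftrightarrow> int n - m \<le> l \<and> l \<le> int n + m"

lemma int_band_of_nat: "int_band p n m (int l) \<longleftrightarrow> in_band p n m l"
  by (cases p) auto

definition link_at :: "pattern \<Rightarrow> nat \<Rightarrow> (nat \<Rightarrow> nat) \<Rightarrow> nat \<Rightarrow> nat" where
  "link_at p n \<pi> j = link p n (Suc (\<pi> (j - 1))) (Suc (\<pi> j))"

definition circuits :: "nat \<Rightarrow> nat \<Rightarrow> (nat \<Rightarrow> nat) set" where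
  "circuits n k = {\<pi> \<in> PiE {..k} (\<lambda>_. {..<n}). \<pi> k = \<pi> 0}"

definition level_sets :: "nat \<Rightarrow> (nat \<Rightarrow> nat) \<Rightarrow> nat set set" where
  "level_sets k f = (\<lambda>j. {i \<in> {1..k}. f i = f j}) ` {1..k}"

lemma partition_on_level_sets: "partition_on {1..k} (level_sets k f)"
  unfolding level_sets_def by (rule partition_onI) (auto simp: disjnt_def)

definition band_circuits :: "pattern \<Rightarrow> nat \<Rightarrow> int \<Rightarrow> nat \<Rightarrow> nat set set \<Rightarrow> (nat \<Rightarrow> nat) set" where
  "band_circuits p n m k \<sigma> = {\<pi> \<in> circuits n k. level_sets k (link_at p n \<pi>) = \<sigma> \<and>
     (\<forall>j\<in>{1..k}. in_band p n m (link_at p n \<pi> j))}"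

definition block :: "nat set set \<Rightarrow> nat \<Rightarrow> nat set" where
  "block \<sigma> j = (THE V. V \<in> \<sigma> \<and> j \<in> V)"

lemma block_eqI:
  assumes "partition_on A \<sigma>" "V \<in> \<sigma>" "j \<in> V" shows "block \<sigma> j = V"
  unfolding block_def using assms partition_onD2[OF assms(1)]
  by (intro the_equality) (auto simp: disjoint_def)

lemma block_in:
  assumes "partition_on A \<sigma>" "j \<in> A" shows "block \<sigma> j \<in> \<sigma>" "j \<in> block \<sigma> j"
proof -
  obtain V where "V \<in> \<sigma>" "j \<in> V" using assms partition_onD1 by blast
  with block_eqI[OF assms(1) this] show "block \<sigma> j \<in> \<sigma>" "j \<in> block \<sigma> j" by auto
qed

lemma level_sets_eq_iff:
  assumes "partition_on {1..k} \<sigma>"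
  shows "level_sets k f = \<sigma> \<longleftrightarrow> (\<forall>i\<in>{1..k}. \<forall>j\<in>{1..k}. f i = f j \<longleftrightarrow> block \<sigma> i = block \<sigma> j)"
proof
  assume eq: "level_sets k f = \<sigma>"
  have "block \<sigma> j = {i \<in> {1..k}. f i = f j}" if "j \<in> {1..k}" for j
    using that by (intro block_eqI[OF assms]) (auto simp: eq[symmetric] level_sets_def)
  thus "\<forall>i\<in>{1..k}. \<forall>j\<in>{1..k}. f i = f j \<longleftrightarrow> block \<sigma> i = block \<sigma> j" by auto
next
  assume *: "\<forall>i\<in>{1..k}. \<forall>j\<in>{1..k}. f i = f j \<longleftrightarrow> block \<sigma> i = block \<sigma> j"
  have sub: "V \<subseteq> {1..k}" if "V \<in> \<sigma>" for V using assms that partition_onD1 by blast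
  have b: "{i \<in> {1..k}. f i = f j} = block \<sigma> j" if "j \<in> {1..k}" for j
  proof -
    have "{i \<in> {1..k}. f i = f j} = {i \<in> {1..k}. block \<sigma> i = block \<sigma> j}" using * that by auto
    also have "\<dots> = block \<sigma> j"
      using block_in[OF assms] sub[OF block_in(1)[OF assms that]] block_eqI[OF assms block_in(1)[OF assms that]] by blast
    finally show ?thesis .
  qed
  have "level_sets k f = block \<sigma> ` {1..k}" unfolding level_sets_def using b by (intro image_cong) auto
  also have "\<dots> = \<sigma>"
  proof (intro equalityI subsetI)
    fix V assume V: "V \<in> \<sigma>"
    then obtain j where j: "j \<in> V" using partition_onD3[OF assms] by fastforce
    hence "j \<in> {1..k}" "block \<sigma> j = V" using sub[OF V] block_eqI[OF assms V] by auto
    thus "V \<in> block \<sigma> ` {1..k}" by blast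
  qed (use block_in[OF assms] in auto)
  finally show "level_sets k f = \<sigma>" .
qed

primrec walk :: "nat set set \<Rightarrow> (nat \<Rightarrow> step) \<Rightarrow> nat \<Rightarrow> (nat set \<Rightarrow> int) \<Rightarrow> nat \<Rightarrow> int" where
  "walk \<sigma> q n z 0 = z {}"
| "walk \<sigma> q n z (Suc j) = move n (q (Suc j)) (walk \<sigma> q n z j) (z (block \<sigma> (Suc j)))"

definition consistent :: "pattern \<Rightarrow> nat \<Rightarrow> nat set set \<Rightarrow> (nat \<Rightarrow> step) \<Rightarrow> int \<Rightarrow> nat \<Rightarrow> (nat set \<Rightarrow> int) \<Rightarrow> bool" where
  "consistent p k \<sigma> q m n z \<longleftrightarrow>
     (\<forall>j\<in>{..k}. 0 \<le> walk \<sigma> q n z j \<and> walk \<sigma> q n z j < int n) \<and>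
     walk \<sigma> q n z k = walk \<sigma> q n z 0 \<and>
     (\<forall>j\<in>{1..k}. admissible p n (q j) (z (block \<sigma> j))) \<and>
     (\<forall>V\<in>\<sigma>. \<forall>W\<in>\<sigma>. V \<noteq> W \<longrightarrow> z V \<noteq> z W) \<and>
     (\<forall>V\<in>\<sigma>. int_band p n m (z V))"

abbreviation step_words :: "pattern \<Rightarrow> nat \<Rightarrow> (nat \<Rightarrow> step) set" where
  "step_words p k \<equiv> PiE {1..k} (\<lambda>_. steps p)"

text \<open>A circuit determines the choice \<open>q\<close> made at each step and the point \<open>z\<close> formed by its first vertex
and its link values; conversely it is recovered from them as the walk. The index \<open>{}\<close>, which is
never a block, is used for the first vertex.\<close>

lemma card_band_circuits:
  assumes \<sigma>: "partition_on {1..k} \<sigma>" and n: "0 < n"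
  shows "card (band_circuits p n m k \<sigma>) =
    (\<Sum>q\<in>step_words p k. card {z \<in> lattice_box (insert {} \<sigma>) n. consistent p k \<sigma> q m n z})"
proof -
  let ?I = "insert {} \<sigma>"
  define Z where "Z q = {z \<in> lattice_box ?I n. consistent p k \<sigma> q m n z}" for q
  define G where "G = (\<lambda>(q, z). \<lambda>j\<in>{..k}. nat (walk \<sigma> q n z j))"
  have fin\<sigma>: "finite \<sigma>" by (rule finite_elements[OF _ \<sigma>]) simp
  have ne: "{} \<notin> \<sigma>" using partition_onD3[OF \<sigma>] .
  have sub: "V \<subseteq> {1..k}" if "V \<in> \<sigma>" for V using \<sigma> that partition_onD1 by blast
  have bl: "block \<sigma> j \<in> \<sigma>" if "j \<in> {1..k}" for j using block_in[OF \<sigma> that] by simp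
  have rep: "\<exists>j\<in>{1..k}. block \<sigma> j = V" if "V \<in> \<sigma>" for V
  proof -
    obtain j where "j \<in> V" using ne \<open>V \<in> \<sigma>\<close> by fastforce
    thus ?thesis using sub[OF that] block_eqI[OF \<sigma> that] by blast
  qed
  have walk_step: "walk \<sigma> q n z j = move n (q j) (walk \<sigma> q n z (j - 1)) (z (block \<sigma> j))" if "j \<in> {1..k}" for q z j
    using that by (cases j) auto
  have G: "G (q, z) \<in> circuits n k"
    "\<And>j. j \<in> {1..k} \<Longrightarrow> int (link_at p n (G (q, z)) j) = z (block \<sigma> j)"
    "\<And>j. j \<le> k \<Longrightarrow> int (G (q, z) j) = walk \<sigma> q n z j"
    if q: "q \<in> step_words p k" and z: "z \<in> Z q" for q z
  proof -
    have con: "consistent p k \<sigma> q m n z" using z by (simp add: Z_def)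
    have bd: "0 \<le> walk \<sigma> q n z j" "walk \<sigma> q n z j < int n" if "j \<le> k" for j
      using con that by (auto simp: consistent_def)
    show G_int: "int (G (q, z) j) = walk \<sigma> q n z j" if "j \<le> k" for j
      using bd(1)[OF that] that by (simp add: G_def)
    have G_less: "G (q, z) j < n" if "j \<le> k" for j
      using bd(2)[OF that] G_int[OF that] by simp
    have "G (q, z) k = G (q, z) 0"
      using con by (simp add: G_def consistent_def)
    thus "G (q, z) \<in> circuits n k"
      using G_less by (auto simp: circuits_def G_def PiE_iff)
    fix j assume j: "j \<in> {1..k}"
    have "admissible p n (q j) (z (block \<sigma> j))" using con j by (simp add: consistent_def)
    moreover have "int (G (q, z) j) = move n (q j) (int (G (q, z) (j - 1))) (z (block \<sigma> j))"
      using walk_step[OF j, of q z] G_int[of j] G_int[of "j - 1"] j by auto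
    moreover have "q j \<in> steps p" using q j by auto
    ultimately have "z (block \<sigma> j) = int (link p n (Suc (G (q, z) (j - 1))) (Suc (G (q, z) j)))"
      using j by (intro iffD1[OF link_step] G_less bexI[of _ "q j"]) auto
    thus "int (link_at p n (G (q, z)) j) = z (block \<sigma> j)" by (simp add: link_at_def)
  qed
  have inj: "inj_on G (Sigma (step_words p k) Z)"
  proof (rule inj_onI, clarify)
    fix q z q' z' assume q: "q \<in> step_words p k" "z \<in> Z q" and q': "q' \<in> step_words p k" "z' \<in> Z q'"
      and eq: "G (q, z) = G (q', z')"
    have "z V = z' V" if V: "V \<in> ?I" for V
    proof (cases "V = {}")
      case True
      thus ?thesis using G(3)[OF q, of 0] G(3)[OF q', of 0] eq by simp
    next
      case False
      then obtain j where "j \<in> {1..k}" "block \<sigma> j = V" using V rep by blast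
      thus ?thesis using G(2)[OF q, of j] G(2)[OF q', of j] eq by simp
    qed
    moreover have "z \<in> extensional ?I" "z' \<in> extensional ?I"
      using q q' by (auto simp: Z_def lattice_box_def PiE_iff)
    ultimately have zz: "z = z'" by (auto intro: extensionalityI)
    have "q j = q' j" if j: "j \<in> {1..k}" for j
    proof (rule step_unique[where p = p and n = n and l = "z (block \<sigma> j)" and i = "int (G (q, z) (j - 1))"])
      show "q j \<in> steps p" "q' j \<in> steps p" using q q' j by auto
      show "admissible p n (q j) (z (block \<sigma> j))" "admissible p n (q' j) (z (block \<sigma> j))"
        using q q' j by (auto simp: Z_def consistent_def zz)
      have "int (G (q, z) j) = move n (q j) (int (G (q, z) (j - 1))) (z (block \<sigma> j))"
        using walk_step[OF j, of q z] G(3)[OF q, of j] G(3)[OF q, of "j - 1"] j by auto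
      moreover have "int (G (q', z') j) = move n (q' j) (int (G (q', z') (j - 1))) (z' (block \<sigma> j))"
        using walk_step[OF j, of q' z'] G(3)[OF q', of j] G(3)[OF q', of "j - 1"] j by auto
      ultimately show "move n (q j) (int (G (q, z) (j - 1))) (z (block \<sigma> j)) = move n (q' j) (int (G (q, z) (j - 1))) (z (block \<sigma> j))"
        using eq zz by simp
    qed (rule n)
    hence "q = q'" using q q' by (auto intro: PiE_ext)
    with zz show "q = q' \<and> z = z'" by simp
  qed
  have img: "G ` Sigma (step_words p k) Z = band_circuits p n m k \<sigma>"
  proof (intro equalityI subsetI)
    fix \<pi> assume "\<pi> \<in> G ` Sigma (step_words p k) Z"
    then obtain q z where q: "q \<in> step_words p k" "z \<in> Z q" and \<pi>: "\<pi> = G (q, z)" by auto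
    have con: "consistent p k \<sigma> q m n z" using q by (simp add: Z_def)
    have l: "int (link_at p n \<pi> j) = z (block \<sigma> j)" if "j \<in> {1..k}" for j
      unfolding \<pi> using G(2)[OF q that] .
    have "link_at p n \<pi> i = link_at p n \<pi> j \<longleftrightarrow> block \<sigma> i = block \<sigma> j" if ij: "i \<in> {1..k}" "j \<in> {1..k}" for i j
    proof -
      have "link_at p n \<pi> i = link_at p n \<pi> j \<longleftrightarrow> z (block \<sigma> i) = z (block \<sigma> j)"
        unfolding l[OF ij(1), symmetric] l[OF ij(2), symmetric] by simp
      also have "\<dots> \<longleftrightarrow> block \<sigma> i = block \<sigma> j"
        using con bl[OF ij(1)] bl[OF ij(2)] unfolding consistent_def by metis
      finally show ?thesis .
    qed
    hence "level_sets k (link_at p n \<pi>) = \<sigma>" using level_sets_eq_iff[OF \<sigma>] by blast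
    moreover have "in_band p n m (link_at p n \<pi> j)" if "j \<in> {1..k}" for j
      using con bl[OF that] unfolding int_band_of_nat[symmetric] l[OF that] by (auto simp: consistent_def)
    ultimately show "\<pi> \<in> band_circuits p n m k \<sigma>"
      using G(1)[OF q] by (simp add: band_circuits_def \<pi>)
  next
    fix \<pi> assume "\<pi> \<in> band_circuits p n m k \<sigma>"
    hence \<pi>: "\<pi> \<in> PiE {..k} (\<lambda>_. {..<n})" "\<pi> k = \<pi> 0" and ker: "level_sets k (link_at p n \<pi>) = \<sigma>"
      and band: "\<And>j. j \<in> {1..k} \<Longrightarrow> in_band p n m (link_at p n \<pi> j)"
      by (auto simp: band_circuits_def circuits_def)
    have less: "\<pi> j < n" if "j \<le> k" for j using \<pi>(1) that by auto
    have ker': "link_at p n \<pi> i = link_at p n \<pi> j \<longleftrightarrow> block \<sigma> i = block \<sigma> j" if "i \<in> {1..k}" "j \<in> {1..k}" for i j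
      using ker level_sets_eq_iff[OF \<sigma>] that by blast
    have "\<exists>q\<in>steps p. admissible p n q (int (link_at p n \<pi> j)) \<and> int (\<pi> j) = move n q (int (\<pi> (j - 1))) (int (link_at p n \<pi> j))"
      if "j \<in> {1..k}" for j
      using that by (intro iffD2[OF link_step] less) (auto simp: link_at_def)
    then obtain q0 where q0: "\<And>j. j \<in> {1..k} \<Longrightarrow> q0 j \<in> steps p"
      "\<And>j. j \<in> {1..k} \<Longrightarrow> admissible p n (q0 j) (int (link_at p n \<pi> j))"
      "\<And>j. j \<in> {1..k} \<Longrightarrow> int (\<pi> j) = move n (q0 j) (int (\<pi> (j - 1))) (int (link_at p n \<pi> j))"
      by metis
    define q where "q = restrict q0 {1..k}"
    have q: "q \<in> step_words p k" using q0(1) by (auto simp: q_def)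
    obtain r where r: "\<And>V. V \<in> \<sigma> \<Longrightarrow> r V \<in> {1..k}" "\<And>V. V \<in> \<sigma> \<Longrightarrow> block \<sigma> (r V) = V" using rep by metis
    define z where "z = (\<lambda>V\<in>?I. if V = {} then int (\<pi> 0) else int (link_at p n \<pi> (r V)))"
    have z0: "z {} = int (\<pi> 0)" by (simp add: z_def)
    have zV: "z V = int (link_at p n \<pi> (r V))" if "V \<in> \<sigma>" for V using that ne by (auto simp: z_def)
    have zb: "z (block \<sigma> j) = int (link_at p n \<pi> j)" if "j \<in> {1..k}" for j
      using zV[OF bl[OF that]] ker'[OF r(1)[OF bl[OF that]] that] r(2)[OF bl[OF that]] by simp
    have w: "j \<le> k \<Longrightarrow> walk \<sigma> q n z j = int (\<pi> j)" for j
    proof (induction j)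
      case (Suc j)
      thus ?case using q0(3)[of "Suc j"] zb[of "Suc j"] by (simp add: q_def)
    qed (simp add: z0)
    have "consistent p k \<sigma> q m n z"
      unfolding consistent_def
    proof (intro conjI ballI impI)
      fix j assume j: "j \<in> {1..k}"
      show "admissible p n (q j) (z (block \<sigma> j))" using q0(2)[OF j] zb[OF j] j by (simp add: q_def)
    next
      fix V W assume "V \<in> \<sigma>" "W \<in> \<sigma>" "V \<noteq> W"
      thus "z V \<noteq> z W" using zV ker' r by (metis of_nat_eq_iff)
    next
      fix V assume "V \<in> \<sigma>"
      thus "int_band p n m (z V)" using zV band r by (simp add: int_band_of_nat)
    qed (use w less \<pi>(2) z0 in auto)
    moreover have "z \<in> lattice_box ?I n"
    proof -
      have "z V \<in> {0..<3 * int n}" if "V \<in> ?I" for V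
      proof (cases "V = {}")
        case True
        thus ?thesis using less[of 0] by (simp add: z0)
      next
        case False
        hence "V \<in> \<sigma>" using that by simp
        have "link_at p n \<pi> (r V) < 3 * n"
          unfolding link_at_def using r(1)[OF \<open>V \<in> \<sigma>\<close>] by (intro link_bound less) auto
        thus ?thesis using zV[OF \<open>V \<in> \<sigma>\<close>] by simp
      qed
      thus ?thesis by (simp add: lattice_box_def PiE_iff z_def)
    qed
    ultimately have "z \<in> Z q" by (simp add: Z_def)
    moreover have "G (q, z) = \<pi>"
      using w \<pi>(1) by (auto simp: G_def fun_eq_iff PiE_iff extensional_def)
    ultimately show "\<pi> \<in> G ` Sigma (step_words p k) Z" using q by force
  qed
  have "card (band_circuits p n m k \<sigma>) = card (Sigma (step_words p k) Z)"
    unfolding img[symmetric] by (rule card_image[OF inj])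
  also have "\<dots> = (\<Sum>q\<in>step_words p k. card (Z q))"
    using fin\<sigma> finite_lattice_box[of ?I n]
    by (intro card_SigmaI) (auto intro!: finite_PiE finite_steps simp: Z_def)
  finally show ?thesis by (simp add: Z_def)
qed

section \<open>Asymptotic circuit counts\<close>

definition affine_form :: "'i set \<Rightarrow> (nat \<Rightarrow> ('i \<Rightarrow> int) \<Rightarrow> int) \<Rightarrow> bool" where
  "affine_form I f \<longleftrightarrow> (\<exists>a t c. \<forall>n z. f n z = (\<Sum>i\<in>I. a i * z i) + t * int n + c)"

lemma affine_formI: "(\<And>n z. f n z = (\<Sum>i\<in>I. a i * z i) + t * int n + c) \<Longrightarrow> affine_form I f"
  unfolding affine_form_def by blast

lemma affine_form_const: "affine_form I (\<lambda>_ _. c)"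
  by (rule affine_formI[where a = "\<lambda>_. 0" and t = 0 and c = c]) simp

lemma affine_form_n: "affine_form I (\<lambda>n _. int n)"
  by (rule affine_formI[where a = "\<lambda>_. 0" and t = 1 and c = 0]) simp

lemma affine_form_var: "finite I \<Longrightarrow> i \<in> I \<Longrightarrow> affine_form I (\<lambda>_ z. z i)"
  by (rule affine_formI[where a = "\<lambda>j. if j = i then 1 else 0" and t = 0 and c = 0])
     (simp add: if_distrib[of "\<lambda>x. x * _"] sum.delta' cong: if_cong)

lemma affine_form_diff: "affine_form I f \<Longrightarrow> affine_form I g \<Longrightarrow> affine_form I (\<lambda>n z. f n z - g n z)"
proof -
  assume "affine_form I f" "affine_form I g"
  then obtain a t c a' t' c' where
    "\<And>n z. f n z = (\<Sum>i\<in>I. a i * z i) + t * int n + c" "\<And>n z. g n z = (\<Sum>i\<in>I. a' i * z i) + t' * int n + c'"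
    unfolding affine_form_def by metis
  thus ?thesis
    by (intro affine_formI[where a = "\<lambda>i. a i - a' i" and t = "t - t'" and c = "c - c'"])
       (simp add: left_diff_distrib sum_subtractf)
qed

lemma stable_le:
  assumes I: "finite I" and "affine_form I f" "affine_form I g"
  shows "stable I (band_widths \<alpha>) (\<lambda>_ n z. f n z \<le> g n z)"
proof -
  from affine_form_diff[OF assms(3,2)] obtain a t c where
    *: "\<And>n z. g n z - f n z = (\<Sum>i\<in>I. a i * z i) + t * int n + c" unfolding affine_form_def by blast
  have "f n z \<le> g n z \<longleftrightarrow> 0 \<le> (\<Sum>i\<in>I. a i * z i) + 0 * m n + t * int n + c" for m n z
    using *[of n z] by auto
  thus ?thesis using stable_affine[OF I, of 0 a \<alpha> t c] by simp
qed

lemma stable_less: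
  assumes I: "finite I" and "affine_form I f" "affine_form I g"
  shows "stable I (band_widths \<alpha>) (\<lambda>_ n z. f n z < g n z)"
proof -
  have "stable I (band_widths \<alpha>) (\<lambda>_ n z. f n z \<le> g n z - 1)"
    by (intro stable_le I assms affine_form_diff affine_form_const)
  thus ?thesis by (simp add: zle_diff1_eq)
qed

lemma stable_eq:
  assumes I: "finite I" and "affine_form I f" "affine_form I g"
  shows "stable I (band_widths \<alpha>) (\<lambda>_ n z. f n z = g n z)"
proof -
  have "stable I (band_widths \<alpha>) (\<lambda>_ n z. f n z \<le> g n z \<and> g n z \<le> f n z)"
    by (intro stable_conj stable_le assms)
  thus ?thesis by (simp add: eq_iff)
qed

lemma stable_band:
  assumes I: "finite I" and V: "V \<in> I"
  shows "stable I (band_widths \<alpha>) (\<lambda>m n z. int_band p n (m n) (z V))"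
proof -
  have sum: "(\<Sum>i\<in>I. (if i = V then u else 0) * z i) = u * z V" for u :: int and z
    using I V by (simp add: if_distrib[of "\<lambda>x. x * _"] sum.delta' cong: if_cong)
  have aff: "stable I (band_widths \<alpha>) (\<lambda>m n z. 0 \<le> u * z V + b * m n + t * int n + 0)" if "u \<noteq> 0" for u b t :: int
    using stable_affine[OF I, of b "\<lambda>i. if i = V then u else 0" \<alpha> t 0] V that unfolding sum by auto
  have 1: "stable I (band_widths \<alpha>) (\<lambda>m n z. z V \<le> m n)" using aff[of "- 1" 1 0] by simp
  have 2: "stable I (band_widths \<alpha>) (\<lambda>m n z. int n - m n \<le> z V)" using aff[of 1 1 "- 1"] by (simp add: algebra_simps)
  have 3: "stable I (band_widths \<alpha>) (\<lambda>m n z. z V \<le> int n + m n)" using aff[of "- 1" 1 1] by (simp add: algebra_simps)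
  show ?thesis
    by (cases p) (auto intro: stable_disj[OF 1 2] stable_conj[OF 2 3])
qed

lemma steps_cases:
  assumes "q \<in> steps p"
  obtains s e t c where "q = (s, e, t, c)" "odd s" "odd e"
  using assms by (cases p) auto

text \<open>Every coefficient \<open>s\<close> and \<open>e\<close> of a step is odd, so modulo \<open>2\<close> the coefficient at \<open>V\<close> counts the
positions in \<open>V\<close> that were passed.\<close>

lemma walk_affine:
  assumes \<sigma>: "partition_on {1..k} \<sigma>" and q: "q \<in> step_words p k"
  shows "j \<le> k \<Longrightarrow> \<exists>a t c. (\<forall>n z. walk \<sigma> q n z j = (\<Sum>i\<in>insert {} \<sigma>. a i * z i) + t * int n + c) \<and>
     (\<forall>V\<in>\<sigma>. odd (a V) \<longleftrightarrow> odd (card (V \<inter> {1..j})))"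
proof (induction j)
  case 0
  have fin: "finite \<sigma>" by (rule finite_elements[OF _ \<sigma>]) simp
  have ne: "{} \<notin> \<sigma>" using partition_onD3[OF \<sigma>] .
  let ?a = "\<lambda>i. if i = {} then 1 else 0 :: int"
  have "(\<Sum>i\<in>insert {} \<sigma>. ?a i * z i) = z {}" for z
  proof -
    have "(\<Sum>i\<in>\<sigma>. ?a i * z i) = 0" using ne by (intro sum.neutral) auto
    thus ?thesis using fin ne by simp
  qed
  thus ?case using ne by (intro exI[of _ ?a] exI[of _ "0::int"]) auto
next
  case (Suc j)
  have fin: "finite \<sigma>" by (rule finite_elements[OF _ \<sigma>]) simp
  have ne: "{} \<notin> \<sigma>" using partition_onD3[OF \<sigma>] .
  have j: "Suc j \<in> {1..k}" using Suc.prems by simp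
  let ?B = "block \<sigma> (Suc j)"
  have blk: "?B \<in> \<sigma>" "Suc j \<in> ?B" using block_in[OF \<sigma> j] by auto
  obtain a t c where w: "\<And>n z. walk \<sigma> q n z j = (\<Sum>i\<in>insert {} \<sigma>. a i * z i) + t * int n + c"
    and par: "\<And>V. V \<in> \<sigma> \<Longrightarrow> odd (a V) \<longleftrightarrow> odd (card (V \<inter> {1..j}))" using Suc by auto
  have "q (Suc j) \<in> steps p" using q j by auto
  then obtain s e t' c' where qj: "q (Suc j) = (s, e, t', c')" "odd s" "odd e" by (rule steps_cases)
  let ?a = "\<lambda>i. s * a i + (if i = ?B then e else 0)"
  have "(\<Sum>i\<in>insert {} \<sigma>. ?a i * z i) = s * (\<Sum>i\<in>insert {} \<sigma>. a i * z i) + e * z ?B" for z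
  proof -
    have "(\<Sum>i\<in>insert {} \<sigma>. ?a i * z i) = (\<Sum>i\<in>insert {} \<sigma>. s * (a i * z i)) + (\<Sum>i\<in>insert {} \<sigma>. if i = ?B then e * z i else 0)"
      unfolding sum.distrib[symmetric] by (intro sum.cong refl) (simp add: algebra_simps)
    also have "(\<Sum>i\<in>insert {} \<sigma>. if i = ?B then e * z i else 0) = e * z ?B"
      using blk(1) fin by (subst sum.delta) auto
    finally show ?thesis by (simp only: sum_distrib_left)
  qed
  hence A: "walk \<sigma> q n z (Suc j) = (\<Sum>i\<in>insert {} \<sigma>. ?a i * z i) + (s * t + t') * int n + (s * c + c')" for n z
    by (simp only: walk.simps qj(1) move.simps w) (simp add: algebra_simps)
  have B: "odd (?a V) \<longleftrightarrow> odd (card (V \<inter> {1..Suc j}))" if V: "V \<in> \<sigma>" for V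
  proof (cases "V = ?B")
    case True
    have "V \<inter> {1..Suc j} = insert (Suc j) (V \<inter> {1..j})" using True blk(2) by auto
    hence "card (V \<inter> {1..Suc j}) = Suc (card (V \<inter> {1..j}))" by simp
    thus ?thesis using True par[OF V] qj(2,3) by auto
  next
    case False
    hence "Suc j \<notin> V" using block_eqI[OF \<sigma> V, of "Suc j"] by auto
    hence "V \<inter> {1..Suc j} = V \<inter> {1..j}" by (auto simp: le_Suc_eq)
    thus ?thesis using False par[OF V] qj(2) by auto
  qed
  show ?case by (intro exI[of _ ?a] exI[of _ "s * t + t'"] exI[of _ "s * c + c'"] conjI allI ballI A B)
qed

lemma stable_consistent:
  assumes \<sigma>: "partition_on {1..k} \<sigma>" and q: "q \<in> step_words p k"
  shows "stable (insert {} \<sigma>) (band_widths \<alpha>) (\<lambda>m n z. consistent p k \<sigma> q (m n) n z)"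
proof -
  have fin: "finite \<sigma>" by (rule finite_elements[OF _ \<sigma>]) simp
  hence I: "finite (insert {} \<sigma>)" by simp
  have w: "affine_form (insert {} \<sigma>) (\<lambda>n z. walk \<sigma> q n z j)" if "j \<le> k" for j
    using walk_affine[OF \<sigma> q that] unfolding affine_form_def by blast
  have v: "affine_form (insert {} \<sigma>) (\<lambda>n z. z V)" if "V \<in> \<sigma>" for V
    using that I by (intro affine_form_var) auto
  show ?thesis
    unfolding consistent_def admissible_def using block_in(1)[OF \<sigma>]
    by (intro stable_conj stable_ball stable_imp stable_le stable_less stable_eq stable_band
         stable_comb[where f = "\<lambda>P Q. P \<longrightarrow> \<not> Q"] stable_const affine_form_const affine_form_n w v fin I) auto
qed

text \<open>By parity the closing condition of the circuit has a nonzero coefficient at \<open>V\<close>, so it fails almost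
surely in the limit.\<close>

lemma odd_block_not_consistent:
  assumes \<sigma>: "partition_on {1..k} \<sigma>" and q: "q \<in> step_words p k" and V: "V \<in> \<sigma>" "odd (card V)"
  shows "stabilises (insert {} \<sigma>) (band_widths \<alpha>) (\<lambda>m n z. consistent p k \<sigma> q (m n) n z) (\<lambda>_. False)"
proof -
  have fin: "finite \<sigma>" by (rule finite_elements[OF _ \<sigma>]) simp
  hence I: "finite (insert {} \<sigma>)" by simp
  have ne: "{} \<notin> \<sigma>" using partition_onD3[OF \<sigma>] .
  obtain a t c where w: "\<And>n z. walk \<sigma> q n z k = (\<Sum>i\<in>insert {} \<sigma>. a i * z i) + t * int n + c"
    and par: "\<And>V. V \<in> \<sigma> \<Longrightarrow> odd (a V) \<longleftrightarrow> odd (card (V \<inter> {1..k}))" using walk_affine[OF \<sigma> q, of k] by auto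
  have "V \<inter> {1..k} = V" using \<sigma> V(1) partition_onD1 by blast
  hence "odd (a V)" using par[OF V(1)] V(2) by simp
  hence aV: "a V \<noteq> 0" by auto
  let ?a = "\<lambda>i. a i - (if i = {} then 1 else 0)"
  have V0: "V \<noteq> {}" using V(1) ne by auto
  have sum: "(\<Sum>i\<in>insert {} \<sigma>. ?a i * z i) = (\<Sum>i\<in>insert {} \<sigma>. a i * z i) - z {}" for z
  proof -
    have "(\<Sum>i\<in>insert {} \<sigma>. ?a i * z i) = (\<Sum>i\<in>insert {} \<sigma>. a i * z i) - (\<Sum>i\<in>insert {} \<sigma>. if i = {} then z i else 0)"
      unfolding sum_subtractf[symmetric] by (intro sum.cong refl) (simp add: algebra_simps)
    also have "(\<Sum>i\<in>insert {} \<sigma>. if i = {} then z i else 0) = z {}"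
      using I by (subst sum.delta) auto
    finally show ?thesis .
  qed
  have "AE x in leb (insert {} \<sigma>). \<forall>\<^sub>F n in sequentially. \<not> consistent p k \<sigma> q (m n) n (grid (insert {} \<sigma>) n x)"
    if m: "m \<in> band_widths \<alpha>" for m
  proof -
    have "AE x in leb (insert {} \<sigma>). \<forall>\<^sub>F n in sequentially.
       (\<Sum>i\<in>insert {} \<sigma>. ?a i * grid (insert {} \<sigma>) n x i) + 0 * m n + t * int n + c \<noteq> 0"
      using V aV V0 by (intro affine_eventually_nonzero[OF I _ _ m, of V]) auto
    thus ?thesis
    proof eventually_elim
      case (elim x)
      thus ?case
        by eventually_elim (auto simp: consistent_def w sum)
    qed
  qed
  thus ?thesis unfolding stabilises_def by simp
qed

text \<open>The bound is \<open>2 ^ k\<close>, for the choices of steps, times \<open>3 ^ (k + 1)\<close>, for the volume of the box in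
at most \<open>k + 1\<close> dimensions.\<close>

definition is_weight :: "pattern \<Rightarrow> nat \<Rightarrow> real \<Rightarrow> nat set set \<Rightarrow> real \<Rightarrow> bool" where
  "is_weight p k \<alpha> \<sigma> c \<longleftrightarrow>
     (\<forall>m\<in>band_widths \<alpha>. (\<lambda>n. real (card (band_circuits p n (m n) k \<sigma>)) / real n ^ Suc (card \<sigma>)) \<longlonglongrightarrow> c) \<and>
     0 \<le> c \<and> c \<le> 3 * 6 ^ k \<and> ((\<exists>V\<in>\<sigma>. odd (card V)) \<longrightarrow> c = 0)"

lemma card_partition_le:
  assumes \<sigma>: "partition_on {1..k} \<sigma>" shows "card \<sigma> \<le> k"
proof -
  have "card \<sigma> = card (block \<sigma> ` {1..k})"
  proof -
    have "block \<sigma> ` {1..k} = \<sigma>"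
    proof (intro equalityI subsetI)
      fix V assume V: "V \<in> \<sigma>"
      then obtain j where j: "j \<in> V" using partition_onD3[OF \<sigma>] by fastforce
      hence "j \<in> {1..k}" "block \<sigma> j = V" using partition_onD1[OF \<sigma>] V block_eqI[OF \<sigma> V] by auto
      thus "V \<in> block \<sigma> ` {1..k}" by blast
    qed (use block_in[OF \<sigma>] in auto)
    thus ?thesis by simp
  qed
  also have "\<dots> \<le> card {1..k}" by (rule card_image_le) simp
  finally show ?thesis by simp
qed

lemma ex_weight:
  assumes \<sigma>: "partition_on {1..k} \<sigma>"
  shows "\<exists>c. is_weight p k \<alpha> \<sigma> c"
proof -
  let ?I = "insert {} \<sigma>"
  have fin: "finite \<sigma>" by (rule finite_elements[OF _ \<sigma>]) simp
  hence I: "finite ?I" by simp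
  have ne: "{} \<notin> \<sigma>" using partition_onD3[OF \<sigma>] .
  have cI: "card ?I = Suc (card \<sigma>)" using fin ne by simp
  define N where "N m q n = real (card {z \<in> lattice_box ?I n. consistent p k \<sigma> q (m n) n z}) / real n ^ Suc (card \<sigma>)"
    for m :: "nat \<Rightarrow> int" and q n
  have fw: "finite (step_words p k)" by (intro finite_PiE) (auto simp: finite_steps)
  have N_le: "N m q n \<le> 3 * 3 ^ k" for m q n
  proof -
    have "card {z \<in> lattice_box ?I n. consistent p k \<sigma> q (m n) n z} \<le> (3 * n) ^ Suc (card \<sigma>)"
      unfolding cI[symmetric] card_lattice_box[OF I, symmetric] by (intro card_mono finite_lattice_box I) auto
    hence "real (card {z \<in> lattice_box ?I n. consistent p k \<sigma> q (m n) n z}) \<le> real ((3 * n) ^ Suc (card \<sigma>))"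
      by (rule of_nat_mono)
    also have "\<dots> = 3 ^ Suc (card \<sigma>) * real n ^ Suc (card \<sigma>)" by (simp only: of_nat_power of_nat_mult power_mult_distrib of_nat_numeral)
    finally have "N m q n \<le> 3 ^ Suc (card \<sigma>)"
      unfolding N_def by (cases "n = 0") (simp_all add: pos_divide_le_eq del: power_Suc)
    also have "\<dots> \<le> 3 ^ Suc k" using card_partition_le[OF \<sigma>] by (intro power_increasing) auto
    finally show ?thesis by simp
  qed
  have "\<exists>c. (\<forall>m\<in>band_widths \<alpha>. (\<lambda>n. N m q n) \<longlonglongrightarrow> c) \<and> 0 \<le> c \<and> c \<le> 3 * 3 ^ k \<and> ((\<exists>V\<in>\<sigma>. odd (card V)) \<longrightarrow> c = 0)"
    if q: "q \<in> step_words p k" for q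
  proof (cases "\<exists>V\<in>\<sigma>. odd (card V)")
    case True
    then obtain V where "V \<in> \<sigma>" "odd (card V)" by blast
    from stabilises_density[OF I odd_block_not_consistent[OF \<sigma> q this]]
    have "(\<lambda>n. N m q n) \<longlonglongrightarrow> 0" if "m \<in> band_widths \<alpha>" for m using that unfolding N_def cI by simp
    thus ?thesis by (intro exI[of _ 0]) auto
  next
    case False
    obtain Q where Q: "stabilises ?I (band_widths \<alpha>) (\<lambda>m n z. consistent p k \<sigma> q (m n) n z) Q"
      using stable_consistent[OF \<sigma> q] unfolding stable_def by blast
    define c where "c = measure (leb ?I) {w \<in> PiE ?I (\<lambda>_. {0..<3}). Q w}"
    have lim: "(\<lambda>n. N m q n) \<longlonglongrightarrow> c" if "m \<in> band_widths \<alpha>" for m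
      using stabilises_density[OF I Q that] unfolding N_def cI c_def .
    have "(\<lambda>n. real_of_int \<lfloor>\<alpha> * real n\<rfloor> / real n) \<longlonglongrightarrow> \<alpha>"
      using grid_LIMSEQ[of "()" "{()}" "\<lambda>_. \<alpha>"] by (simp add: grid_def mult.commute)
    hence "(\<lambda>n. \<lfloor>\<alpha> * real n\<rfloor>) \<in> band_widths \<alpha>" by (simp add: band_widths_def)
    from LIMSEQ_le_const2[OF lim[OF this]] N_le have "c \<le> 3 * 3 ^ k" by blast
    thus ?thesis using lim False by (intro exI[of _ c]) (auto simp: c_def)
  qed
  hence "\<forall>q\<in>step_words p k. \<exists>c. (\<forall>m\<in>band_widths \<alpha>. (\<lambda>n. N m q n) \<longlonglongrightarrow> c) \<and> 0 \<le> c \<and> c \<le> 3 * 3 ^ k \<and> ((\<exists>V\<in>\<sigma>. odd (card V)) \<longrightarrow> c = 0)"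
    by (intro ballI)
  from bchoice[OF this] obtain c where c': "\<forall>q\<in>step_words p k. (\<forall>m\<in>band_widths \<alpha>. (\<lambda>n. N m q n) \<longlonglongrightarrow> c q)
      \<and> 0 \<le> c q \<and> c q \<le> 3 * 3 ^ k \<and> ((\<exists>V\<in>\<sigma>. odd (card V)) \<longrightarrow> c q = 0)" by (elim exE)
  have c: "\<And>q m. q \<in> step_words p k \<Longrightarrow> m \<in> band_widths \<alpha> \<Longrightarrow> (\<lambda>n. N m q n) \<longlonglongrightarrow> c q"
    "\<And>q. q \<in> step_words p k \<Longrightarrow> 0 \<le> c q" "\<And>q. q \<in> step_words p k \<Longrightarrow> c q \<le> 3 * 3 ^ k"
    "\<And>q. q \<in> step_words p k \<Longrightarrow> (\<exists>V\<in>\<sigma>. odd (card V)) \<Longrightarrow> c q = 0"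
    using c' by simp_all
  have "is_weight p k \<alpha> \<sigma> (\<Sum>q\<in>step_words p k. c q)"
    unfolding is_weight_def
  proof (intro conjI ballI impI)
    fix m assume m: "m \<in> band_widths \<alpha>"
    have "(\<lambda>n. \<Sum>q\<in>step_words p k. N m q n) \<longlonglongrightarrow> (\<Sum>q\<in>step_words p k. c q)"
      by (intro tendsto_sum c m)
    moreover have "\<forall>\<^sub>F n in sequentially. (\<Sum>q\<in>step_words p k. N m q n) = real (card (band_circuits p n (m n) k \<sigma>)) / real n ^ Suc (card \<sigma>)"
      using eventually_gt_at_top[of 0]
      by eventually_elim (simp add: N_def card_band_circuits[OF \<sigma>] sum_divide_distrib)
    ultimately show "(\<lambda>n. real (card (band_circuits p n (m n) k \<sigma>)) / real n ^ Suc (card \<sigma>)) \<longlonglongrightarrow> (\<Sum>q\<in>step_words p k. c q)"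
      by (rule Lim_transform_eventually)
  next
    show "0 \<le> (\<Sum>q\<in>step_words p k. c q)" using c(2) by (rule sum_nonneg)
  next
    have "(\<Sum>q\<in>step_words p k. c q) \<le> real (card (step_words p k)) * (3 * 3 ^ k)"
      by (rule sum_bounded_above) (rule c(3))
    also have "real (card (step_words p k)) * (3 * 3 ^ k) \<le> 2 ^ k * (3 * 3 ^ k)"
    proof (rule mult_right_mono)
      have "card (step_words p k) \<le> 2 ^ k"
        using power_mono[OF card_steps[of p], of k] by (simp add: card_PiE)
      hence "real (card (step_words p k)) \<le> real (2 ^ k)" by (rule of_nat_mono)
      thus "real (card (step_words p k)) \<le> 2 ^ k" by simp
    qed simp
    also have "\<dots> = 3 * (6::real) ^ k" by (simp add: power_mult_distrib[symmetric])
    finally show "(\<Sum>q\<in>step_words p k. c q) \<le> 3 * 6 ^ k" .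
  next
    assume "\<exists>V\<in>\<sigma>. odd (card V)"
    thus "(\<Sum>q\<in>step_words p k. c q) = 0" using c(4) by (intro sum.neutral) auto
  qed
  thus ?thesis by blast
qed

section \<open>Spectral distributions of random symmetric matrices\<close>

text \<open>Over the complex numbers the characteristic polynomial splits, and its roots are real because the
sesquilinear form of a real symmetric matrix takes real values on the diagonal.\<close>

lemma symmetric_char_poly_splits:
  fixes A :: "real mat"
  assumes A: "A \<in> carrier_mat n n" and sym: "\<And>i j. i < n \<Longrightarrow> j < n \<Longrightarrow> A $$ (i, j) = A $$ (j, i)"
  obtains es where "char_poly A = (\<Prod>e\<leftarrow>es. [:- e, 1:])" "length es = n"
proof -
  define B where "B = map_mat complex_of_real A"
  have B: "B \<in> carrier_mat n n" using A by (simp add: B_def)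
  have B_ij: "B $$ (i, j) = complex_of_real (A $$ (i, j))" if "i < n" "j < n" for i j
    using that A by (simp add: B_def)
  obtain as where as: "char_poly B = (\<Prod>a\<leftarrow>as. [:- a, 1:])" "length as = n"
    using char_poly_factorized[OF B] by blast
  have real: "complex_of_real (Re a) = a" if "a \<in> set as" for a
  proof -
    have "poly (char_poly B) a = 0" unfolding as(1) using that by (auto simp: poly_prod_list prod_list_zero_iff)
    hence "eigenvalue B a" using eigenvalue_root_char_poly[OF B] by simp
    then obtain v where v: "v \<in> carrier_vec n" "v \<noteq> 0\<^sub>v n" and ev: "B *\<^sub>v v = a \<cdot>\<^sub>v v"
      using B by (auto simp: eigenvalue_def eigenvector_def)
    have ev_i: "(\<Sum>j<n. B $$ (i, j) * v $ j) = a * v $ i" if "i < n" for i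
    proof -
      have "(B *\<^sub>v v) $ i = (\<Sum>j<n. B $$ (i, j) * v $ j)"
        using that B v(1) by (simp add: scalar_prod_def lessThan_atLeast0)
      with ev that v(1) show ?thesis by simp
    qed
    define s where "s = (\<Sum>i<n. \<Sum>j<n. cnj (v $ i) * (B $$ (i, j) * v $ j))"
    define N where "N = (\<Sum>i<n. (cmod (v $ i))\<^sup>2)"
    have s1: "s = a * of_real N"
    proof -
      have "s = (\<Sum>i<n. cnj (v $ i) * (a * v $ i))"
        unfolding s_def sum_distrib_left[symmetric] by (intro sum.cong refl) (simp add: ev_i)
      also have "\<dots> = a * (\<Sum>i<n. v $ i * cnj (v $ i))"
        unfolding sum_distrib_left by (intro sum.cong refl) (simp add: mult_ac)
      finally show ?thesis unfolding N_def of_real_sum complex_norm_square .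
    qed
    have "cnj s = (\<Sum>i<n. \<Sum>j<n. v $ i * (B $$ (i, j) * cnj (v $ j)))"
      by (simp add: s_def B_ij)
    also have "\<dots> = (\<Sum>j<n. \<Sum>i<n. v $ i * (B $$ (i, j) * cnj (v $ j)))" by (rule sum.swap)
    also have "\<dots> = s"
      unfolding s_def by (intro sum.cong) (simp_all add: B_ij sym mult_ac)
    finally have "cnj a * of_real N = a * of_real N" by (simp add: s1)
    moreover have "N \<noteq> 0"
    proof
      assume "N = 0"
      hence "\<forall>i<n. v $ i = 0" unfolding N_def by (subst (asm) sum_nonneg_eq_0_iff) auto
      with v show False by (auto intro!: eq_vecI)
    qed
    ultimately have "cnj a = a" by simp
    thus ?thesis using Reals_cnj_iff[of a] by (auto elim: Reals_cases)
  qed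
  define es where "es = map Re as"
  interpret mp: map_poly_inj_idom_hom complex_of_real ..
  have "map_poly complex_of_real (\<Prod>e\<leftarrow>es. [:- e, 1:]) = (\<Prod>a\<leftarrow>as. [:- a, 1:])"
    unfolding es_def using real by (induction as) (auto simp: of_real_hom.map_poly_pCons_hom mp.hom_mult simp del: mult_pCons_left)
  also have "\<dots> = map_poly complex_of_real (char_poly A)"
    using of_real_hom.char_poly_hom[OF A] by (simp add: as(1)[symmetric] B_def)
  finally have "char_poly A = (\<Prod>e\<leftarrow>es. [:- e, 1:])" using mp.injectivity by metis
  with that[of es] as(2) show thesis by (simp add: es_def)
qed

definition mat_trace :: "real mat \<Rightarrow> real" where
  "mat_trace A = (\<Sum>i<dim_row A. A $$ (i, i))"

lemma mat_trace_commute: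
  assumes "A \<in> carrier_mat n n" "B \<in> carrier_mat n n"
  shows "mat_trace (A * B) = mat_trace (B * A)"
proof -
  have "mat_trace (X * Y) = (\<Sum>i<n. \<Sum>j<n. X $$ (i, j) * Y $$ (j, i))"
    if "X \<in> carrier_mat n n" "Y \<in> carrier_mat n n" for X Y
    using that by (simp add: mat_trace_def scalar_prod_def lessThan_atLeast0)
  note tr2 = this
  show ?thesis
    unfolding tr2[OF assms] tr2[OF assms(2,1)] by (subst sum.swap) (simp add: mult.commute)
qed

lemma upper_triangular_pow:
  fixes B :: "real mat"
  assumes B: "B \<in> carrier_mat n n" and ut: "upper_triangular B"
  shows "upper_triangular (B ^\<^sub>m k) \<and> (\<forall>i<n. (B ^\<^sub>m k) $$ (i, i) = (B $$ (i, i)) ^ k)"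
proof (induction k)
  case 0
  show ?case using B by (auto simp: upper_triangular_def)
next
  case (Suc k)
  have Bk: "B ^\<^sub>m k \<in> carrier_mat n n" using B by simp
  have entry: "(B ^\<^sub>m Suc k) $$ (i, j) = (\<Sum>l<n. (B ^\<^sub>m k) $$ (i, l) * B $$ (l, j))" if "i < n" "j < n" for i j
    using that B Bk by (simp add: scalar_prod_def lessThan_atLeast0)
  have z: "(B ^\<^sub>m k) $$ (i, l) * B $$ (l, j) = 0" if "i < n" "l < n" "l < i \<or> j < l" for i j l
    using that Suc ut Bk B by (auto simp: upper_triangular_def)
  have "upper_triangular (B ^\<^sub>m Suc k)"
  proof (rule upper_triangularI)
    fix i j assume ij: "j < i" "i < dim_row (B ^\<^sub>m Suc k)"
    hence "i < n" "j < n" using B by (auto simp del: pow_mat.simps)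
    thus "(B ^\<^sub>m Suc k) $$ (i, j) = 0"
      unfolding entry[OF \<open>i < n\<close> \<open>j < n\<close>] using ij by (intro sum.neutral ballI z) auto
  qed
  moreover have "(B ^\<^sub>m Suc k) $$ (i, i) = (B $$ (i, i)) ^ Suc k" if i: "i < n" for i
  proof -
    have "(B ^\<^sub>m Suc k) $$ (i, i) = (\<Sum>l<n. if l = i then (B ^\<^sub>m k) $$ (i, i) * B $$ (i, i) else 0)"
      unfolding entry[OF i i] by (intro sum.cong refl) (use z i in \<open>auto simp: neq_iff\<close>)
    thus ?thesis using i Suc by (simp add: sum.delta mult.commute)
  qed
  ultimately show ?case by blast
qed

text \<open>Triangular form suffices: the diagonal of a power of a triangular matrix consists of the powers of the
diagonal entries.\<close>

lemma mat_trace_pow_eq_power_sum: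
  fixes A :: "real mat"
  assumes A: "A \<in> carrier_mat n n" and cp: "char_poly A = (\<Prod>e\<leftarrow>es. [:- e, 1:])"
  shows "mat_trace (A ^\<^sub>m k) = (\<Sum>i<length es. (es ! i) ^ k)"
proof -
  obtain B P Q where sd: "schur_decomposition A es = (B, P, Q)" by (cases "schur_decomposition A es") auto
  from schur_decomposition[OF A cp sd]
  have w: "similar_mat_wit A B P Q" and ut: "upper_triangular B" and dg: "diag_mat B = es" by auto
  from w A have c: "B \<in> carrier_mat n n" "P \<in> carrier_mat n n" "Q \<in> carrier_mat n n" and QP: "Q * P = 1\<^sub>m n"
    by (auto simp: similar_mat_wit_def Let_def)
  have Bk: "B ^\<^sub>m k \<in> carrier_mat n n" using c by simp
  have "mat_trace (A ^\<^sub>m k) = mat_trace (P * B ^\<^sub>m k * Q)" using similar_mat_wit_pow_id[OF w] by simp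
  also have "\<dots> = mat_trace (P * (B ^\<^sub>m k * Q))" using c Bk by (simp add: assoc_mult_mat[of _ n n _ n _ n])
  also have "\<dots> = mat_trace (B ^\<^sub>m k * Q * P)" using c Bk by (intro mat_trace_commute[of _ n]) auto
  also have "\<dots> = mat_trace (B ^\<^sub>m k)" using c Bk QP by (simp add: assoc_mult_mat[of _ n n _ n _ n])
  also have "\<dots> = (\<Sum>i<n. (B $$ (i, i)) ^ k)"
    using upper_triangular_pow[OF c(1) ut, of k] c(1) by (simp add: mat_trace_def)
  also have "\<dots> = (\<Sum>i<length es. (es ! i) ^ k)"
    using c(1) unfolding dg[symmetric] by (auto simp: diag_mat_def)
  finally show ?thesis .
qed

definition uniform_on_list :: "real list \<Rightarrow> real measure" where
  "uniform_on_list es = distr (measure_pmf (pmf_of_set {..<length es})) borel ((!) es)"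

lemma esd_eq_uniform_on_list:
  assumes cp: "char_poly A = (\<Prod>e\<leftarrow>es. [:- e, 1:])" and len: "length es = dim_row A" "es \<noteq> []"
  shows "esd A = uniform_on_list es"
proof -
  have ne: "{..<length es} \<noteq> {}" using len(2) by (simp add: lessThan_empty_iff)
  have pr: "proots (char_poly A) = mset es"
    unfolding cp
  proof (induction es)
    case (Cons e es)
    have "proots ([:- e, 1:] * (\<Prod>e\<leftarrow>es. [:- e, 1:])) = proots [:- e, 1:] + proots (\<Prod>e\<leftarrow>es. [:- e, 1:])"
      by (rule proots_mult) (auto simp: prod_list_zero_iff)
    with Cons show ?case by (simp del: mult_pCons_left)
  qed simp
  have "(\<Sum>l\<in>#proots (char_poly A). indicator B l) / of_nat (dim_row A) = emeasure (uniform_on_list es) B" if "B \<in> sets borel" for B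
  proof -
    have "(\<Sum>l\<in>#proots (char_poly A). indicator B l :: ennreal) = (\<Sum>i<length es. indicator B (es ! i))"
      unfolding pr mset_map[symmetric] sum_mset_sum_list sum_list_sum_nth by (simp add: lessThan_atLeast0)
    also have "\<dots> = of_nat (card ({..<length es} \<inter> (!) es -` B))"
      by (simp add: indicator_def sum.If_cases vimage_def Int_def)
    finally have 1: "(\<Sum>l\<in>#proots (char_poly A). indicator B l :: ennreal) = of_nat (card ({..<length es} \<inter> (!) es -` B))" .
    have "emeasure (uniform_on_list es) B = emeasure (measure_pmf (pmf_of_set {..<length es})) ((!) es -` B)"
      using that by (simp add: uniform_on_list_def emeasure_distr)
    also have "\<dots> = ennreal (real (card ({..<length es} \<inter> (!) es -` B)) / real (length es))"
      by (subst emeasure_pmf_of_set) (use ne in auto)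
    also have "\<dots> = of_nat (card ({..<length es} \<inter> (!) es -` B)) / of_nat (length es)"
      using len(2) by (simp add: ennreal_of_nat_eq_real_of_nat divide_ennreal)
    finally show ?thesis unfolding 1 len(1) ..
  qed
  hence "esd A = measure_of UNIV (sets borel) (emeasure (uniform_on_list es))"
    unfolding esd_def by (intro measure_of_eq) (auto simp: sets.sigma_sets_eq[of borel, simplified])
  also have "\<dots> = uniform_on_list es"
    using measure_of_of_measure[of "uniform_on_list es"] by (simp add: uniform_on_list_def)
  finally show ?thesis .
qed

locale symmetric_matrix =
  fixes A :: "real mat" and n :: nat
  assumes carrier: "A \<in> carrier_mat n n" and npos: "0 < n"
    and sym: "\<And>i j. i < n \<Longrightarrow> j < n \<Longrightarrow> A $$ (i, j) = A $$ (j, i)"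
begin

lemma esd_list:
  obtains es where "esd A = uniform_on_list es" "length es = n" "\<And>k. mat_trace (A ^\<^sub>m k) = (\<Sum>i<n. (es ! i) ^ k)"
proof -
  obtain es where es: "char_poly A = (\<Prod>e\<leftarrow>es. [:- e, 1:])" "length es = n"
    using symmetric_char_poly_splits[OF carrier sym] by blast
  show thesis
    using that[of es] esd_eq_uniform_on_list[OF es(1)] mat_trace_pow_eq_power_sum[OF carrier es(1)] es(2) carrier npos
    by (cases es) auto
qed

lemma integral_esd: "(\<integral>x. f x \<partial>uniform_on_list es) = (\<Sum>i<n. f (es ! i)) / n" "integrable (uniform_on_list es) f"
  if "length es = n" "f \<in> borel_measurable borel" for f :: "real \<Rightarrow> real"
proof -
  have ne: "{..<length es} \<noteq> {}" using that npos by (simp add: lessThan_empty_iff)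
  show "(\<integral>x. f x \<partial>uniform_on_list es) = (\<Sum>i<n. f (es ! i)) / n"
    using that ne by (simp add: uniform_on_list_def integral_distr integral_pmf_of_set)
  show "integrable (uniform_on_list es) f"
    unfolding uniform_on_list_def using that ne
    by (subst integrable_distr_eq) (simp_all add: integrable_measure_pmf_finite set_pmf_of_set[OF ne])
qed

lemma esd_moment: "(\<integral>x. x ^ k \<partial>esd A) = mat_trace (A ^\<^sub>m k) / n"
  by (rule esd_list) (simp add: integral_esd)

lemma esd_integrable: "f \<in> borel_measurable borel \<Longrightarrow> integrable (esd A) (f :: real \<Rightarrow> real)"
  by (rule esd_list) (simp add: integral_esd)

lemma real_distribution_esd: "real_distribution (esd A)"
proof (rule esd_list)
  fix es assume "esd A = uniform_on_list es"
  thus "real_distribution (esd A)"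
    unfolding real_distribution_def real_distribution_axioms_def uniform_on_list_def
    by (auto intro!: measure_pmf.prob_space_distr)
qed

lemma esd_integral_LIMSEQ:
  assumes "\<And>x. (\<lambda>k. q k x) \<longlonglongrightarrow> f x" and [measurable]: "\<And>k. q k \<in> borel_measurable borel" "f \<in> borel_measurable borel"
  shows "(\<lambda>k. \<integral>x. q k x \<partial>esd A) \<longlonglongrightarrow> (\<integral>x. f x \<partial>esd A :: real)"
  by (rule esd_list) (use npos in \<open>auto simp: integral_esd intro!: tendsto_intros assms\<close>)

end

text \<open>Weierstrass approximation on growing intervals of continuous functions that decrease to the indicator.\<close>

lemma polynomials_to_indicator:
  fixes a :: real
  obtains q :: "nat \<Rightarrow> real \<Rightarrow> real" where "\<And>k. real_polynomial_function (q k)"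
    "\<And>x. (\<lambda>k. q k x) \<longlonglongrightarrow> indicator {..a} x"
proof -
  define g where "g k x = max 0 (min 1 (1 - real k * (x - a)))" for k x
  have "\<exists>q. real_polynomial_function q \<and> (\<forall>x\<in>{-real k..real k}. \<bar>g k x - q x\<bar> < 1 / Suc k)" for k
  proof -
    have c: "continuous_on {-real k..real k} (g k)" unfolding g_def by (intro continuous_intros)
    have e: "0 < 1 / real (Suc k)" by simp
    obtain q where "real_polynomial_function q" "\<And>x. x \<in> {-real k..real k} \<Longrightarrow> \<bar>g k x - q x\<bar> < 1 / Suc k"
      using Stone_Weierstrass_real_polynomial_function[OF compact_Icc c e] by blast
    thus ?thesis by blast
  qed
  then obtain q where q: "\<And>k. real_polynomial_function (q k)"
    "\<And>k x. x \<in> {-real k..real k} \<Longrightarrow> \<bar>g k x - q k x\<bar> < 1 / Suc k" by metis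
  have "(\<lambda>k. q k x) \<longlonglongrightarrow> indicator {..a} x" for x
  proof -
    have g: "(\<lambda>k. g k x) \<longlonglongrightarrow> indicator {..a} x"
    proof (cases "x \<le> a")
      case True
      hence "g k x = 1" for k using mult_nonneg_nonpos[of "real k" "x - a"] by (simp add: g_def)
      thus ?thesis using True by simp
    next
      case False
      obtain N :: nat where N: "1 / (x - a) \<le> real N" using real_arch_simple by blast
      have "g k x = 0" if "k \<ge> N" for k
      proof -
        have "1 / (x - a) \<le> real k" using N that by linarith
        hence "1 \<le> real k * (x - a)" using False by (simp add: field_simps)
        thus ?thesis by (simp add: g_def)
      qed
      hence "eventually (\<lambda>k. g k x = 0) sequentially" by (auto simp: eventually_sequentially)
      thus ?thesis using False by (simp add: tendsto_eventually)
    qed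
    obtain N :: nat where N: "\<bar>x\<bar> \<le> real N" using real_arch_simple by blast
    have "norm (g k x - q k x) \<le> 1 / Suc k" if "k \<ge> N" for k
    proof -
      have "\<bar>x\<bar> \<le> real k" using N that by linarith
      hence "x \<in> {-real k..real k}" by (simp add: abs_le_iff)
      from less_imp_le[OF q(2)[OF this]] show ?thesis by (simp only: real_norm_def)
    qed
    hence "eventually (\<lambda>k. norm (g k x - q k x) \<le> 1 / Suc k) sequentially"
      by (rule eventually_sequentiallyI)
    hence "(\<lambda>k. g k x - q k x) \<longlonglongrightarrow> 0"
      by (rule Lim_null_comparison) (use LIMSEQ_inverse_real_of_nat in \<open>simp add: inverse_eq_divide\<close>)
    from tendsto_diff[OF g this] show ?thesis by simp
  qed
  with q(1) that show thesis by blast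
qed

locale symmetric_random_matrix = prob_space M for M :: "'a measure" +
  fixes A :: "'a \<Rightarrow> real mat" and n :: nat
  assumes symm: "\<And>\<omega>. symmetric_matrix (A \<omega>) n"
    and entries_measurable: "\<And>i j. i < n \<Longrightarrow> j < n \<Longrightarrow> (\<lambda>\<omega>. A \<omega> $$ (i, j)) \<in> borel_measurable M"
begin

lemma carrier: "A \<omega> \<in> carrier_mat n n" and npos: "0 < n"
  using symmetric_matrix.carrier[OF symm] symmetric_matrix.npos[OF symm] by auto

lemma pow_entries_measurable: "i < n \<Longrightarrow> j < n \<Longrightarrow> (\<lambda>\<omega>. (A \<omega> ^\<^sub>m k) $$ (i, j)) \<in> borel_measurable M"
proof (induction k arbitrary: i j)
  case 0
  have "(A \<omega> ^\<^sub>m 0) $$ (i, j) = (if i = j then 1 else 0)" for \<omega> using 0 carrier[of \<omega>] by auto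
  thus ?case by simp
next
  case (Suc k)
  have "(A \<omega> ^\<^sub>m Suc k) $$ (i, j) = (\<Sum>l<n. (A \<omega> ^\<^sub>m k) $$ (i, l) * A \<omega> $$ (l, j))" for \<omega>
    using Suc.prems carrier[of \<omega>] pow_carrier_mat[OF carrier[of \<omega>], of k]
    by (simp add: scalar_prod_def lessThan_atLeast0)
  thus ?case using Suc entries_measurable by (auto intro!: borel_measurable_sum borel_measurable_times)
qed

lemma mat_trace_measurable: "(\<lambda>\<omega>. mat_trace (A \<omega> ^\<^sub>m k)) \<in> borel_measurable M"
proof -
  have "mat_trace (A \<omega> ^\<^sub>m k) = (\<Sum>i<n. (A \<omega> ^\<^sub>m k) $$ (i, i))" for \<omega>
    using carrier[of \<omega>] by (simp add: mat_trace_def)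
  thus ?thesis using pow_entries_measurable by (auto intro!: borel_measurable_sum)
qed

text \<open>Integrals of polynomials against the spectral distribution are traces and hence measurable, and
distribution functions are pointwise limits of such integrals. This avoids a measurable choice of the
eigenvalues.\<close>

lemma esd_measurable: "(\<lambda>\<omega>. esd (A \<omega>)) \<in> M \<rightarrow>\<^sub>M prob_algebra borel"
proof (rule measurable_prob_algebra_generated)
  show "sets (borel :: real measure) = sigma_sets UNIV (range (\<lambda>a. {..a}))"
    by (subst borel_eq_atMost) (simp add: sets_measure_of)
  show "Int_stable (range (\<lambda>a::real. {..a}))" by (auto simp: Int_stable_def)
  fix \<omega>
  interpret rd: real_distribution "esd (A \<omega>)" by (rule symmetric_matrix.real_distribution_esd[OF symm])
  show "prob_space (esd (A \<omega>))" by (rule rd.prob_space_axioms)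
  show "sets (esd (A \<omega>)) = sets borel" by simp
next
  fix B assume "B \<in> range (\<lambda>a::real. {..a})"
  then obtain a where B: "B = {..a}" by auto
  obtain q :: "nat \<Rightarrow> real \<Rightarrow> real" where q: "\<And>k. real_polynomial_function (q k)"
    "\<And>x. (\<lambda>k. q k x) \<longlonglongrightarrow> indicator {..a} x" using polynomials_to_indicator[of a] by blast
  obtain c d where qc: "\<And>k. q k = (\<lambda>x. \<Sum>i\<le>d k. c k i * x ^ i)"
    using q(1) unfolding real_polynomial_function_iff_sum by metis
  have qm: "q k \<in> borel_measurable borel" for k unfolding qc by measurable
  have int: "(\<integral>x. q k x \<partial>esd (A \<omega>)) = (\<Sum>i\<le>d k. c k i * (mat_trace (A \<omega> ^\<^sub>m i) / n))" for k \<omega>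
  proof -
    interpret symmetric_matrix "A \<omega>" n by (rule symm)
    show ?thesis unfolding qc by (simp add: esd_integrable esd_moment)
  qed
  have "(\<lambda>\<omega>. \<integral>x. indicator {..a} x \<partial>esd (A \<omega>) :: real) \<in> borel_measurable M"
  proof (rule borel_measurable_LIMSEQ_real)
    fix \<omega>
    show "(\<lambda>k. \<integral>x. q k x \<partial>esd (A \<omega>)) \<longlonglongrightarrow> (\<integral>x. indicator {..a} x \<partial>esd (A \<omega>))"
      by (rule symmetric_matrix.esd_integral_LIMSEQ[OF symm]) (auto simp: q(2) qm)
  qed (unfold int, use mat_trace_measurable in measurable)
  moreover have "emeasure (esd (A \<omega>)) B = ennreal (\<integral>x. indicator {..a} x \<partial>esd (A \<omega>))" for \<omega>
  proof -
    interpret rd: real_distribution "esd (A \<omega>)" by (rule symmetric_matrix.real_distribution_esd[OF symm])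
    show ?thesis unfolding B by (simp add: rd.emeasure_eq_measure)
  qed
  ultimately show "(\<lambda>\<omega>. emeasure (esd (A \<omega>)) B) \<in> borel_measurable M" by simp
qed auto

lemma eesd_eq_bind: "eesd M A = M \<bind> (\<lambda>\<omega>. esd (A \<omega>))"
proof -
  let ?B = "M \<bind> (\<lambda>\<omega>. esd (A \<omega>))"
  have m: "(\<lambda>\<omega>. esd (A \<omega>)) \<in> M \<rightarrow>\<^sub>M subprob_algebra borel"
    using esd_measurable by (rule measurable_prob_algebraD)
  have s: "sets ?B = sets borel" using not_empty m by (intro sets_bind) (auto dest: sets_kernel)
  hence sp: "space ?B = UNIV" using sets_eq_imp_space_eq by fastforce
  have "eesd M A = measure_of UNIV (sets borel) (emeasure ?B)"
    unfolding eesd_def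
    by (intro measure_of_eq) (auto simp: sets.sigma_sets_eq[of borel, simplified] emeasure_bind[OF not_empty m])
  also have "\<dots> = ?B" using measure_of_of_measure[of ?B] by (simp add: s sp)
  finally show ?thesis .
qed

lemma real_distribution_eesd: "real_distribution (eesd M A)"
proof -
  have "prob_space (eesd M A)" unfolding eesd_eq_bind
    using esd_measurable prob_space_axioms by (intro prob_space_bind'[where M = M]) (auto simp: space_prob_algebra)
  moreover have "sets (eesd M A) = sets borel" by (simp add: eesd_def sets.sigma_sets_eq[of borel, simplified])
  ultimately show ?thesis by (simp add: real_distribution_def real_distribution_axioms_def)
qed

lemma eesd_has_integral_nonneg:
  fixes f :: "real \<Rightarrow> real"
  assumes f[measurable]: "f \<in> borel_measurable borel" and nn: "\<And>x. 0 \<le> f x"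
    and int: "integrable M (\<lambda>\<omega>. \<integral>x. f x \<partial>esd (A \<omega>))"
  shows "has_bochner_integral (eesd M A) f (\<integral>\<omega>. (\<integral>x. f x \<partial>esd (A \<omega>)) \<partial>M)"
proof (rule has_bochner_integral_nn_integral)
  have s: "sets (eesd M A) = sets borel" by (simp add: eesd_def sets.sigma_sets_eq[of borel, simplified])
  show "f \<in> borel_measurable (eesd M A)" using f measurable_cong_sets[OF s refl] by blast
  have "(\<integral>\<^sup>+x. ennreal (f x) \<partial>eesd M A) = (\<integral>\<^sup>+\<omega>. (\<integral>\<^sup>+x. ennreal (f x) \<partial>esd (A \<omega>)) \<partial>M)"
    unfolding eesd_eq_bind by (rule nn_integral_bind[OF _ measurable_prob_algebraD[OF esd_measurable]]) simp
  also have "\<dots> = (\<integral>\<^sup>+\<omega>. ennreal (\<integral>x. f x \<partial>esd (A \<omega>)) \<partial>M)"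
    using nn by (intro nn_integral_cong nn_integral_eq_integral symmetric_matrix.esd_integrable[OF symm] f) auto
  also have "\<dots> = ennreal (\<integral>\<omega>. (\<integral>x. f x \<partial>esd (A \<omega>)) \<partial>M)"
    using nn int by (intro nn_integral_eq_integral) (auto intro!: Bochner_Integration.integral_nonneg)
  finally show "(\<integral>\<^sup>+x. ennreal (f x) \<partial>eesd M A) = ennreal (\<integral>\<omega>. (\<integral>x. f x \<partial>esd (A \<omega>)) \<partial>M)" .
qed (use nn in \<open>auto intro!: Bochner_Integration.integral_nonneg\<close>)

text \<open>The iterated integral is available for nonnegative functions, hence \<open>x ^ k\<close> is written as a
difference of the nonnegative polynomials \<open>x ^ (2 * k) + 1 + x ^ k\<close> and \<open>x ^ (2 * k) + 1\<close>.\<close>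

lemma eesd_moment:
  assumes int: "\<And>k. integrable M (\<lambda>\<omega>. mat_trace (A \<omega> ^\<^sub>m k))"
  shows "has_bochner_integral (eesd M A) (\<lambda>x. x ^ k) ((\<integral>\<omega>. mat_trace (A \<omega> ^\<^sub>m k) \<partial>M) / n)"
proof -
  let ?t = "\<lambda>k \<omega>. mat_trace (A \<omega> ^\<^sub>m k) / n"
  have J: "(\<integral>x. x ^ (2 * k) + 1 \<partial>esd (A \<omega>)) = ?t (2 * k) \<omega> + ?t 0 \<omega>"
    "(\<integral>x. (x ^ (2 * k) + 1) + x ^ k \<partial>esd (A \<omega>)) = (?t (2 * k) \<omega> + ?t 0 \<omega>) + ?t k \<omega>" for \<omega>
  proof -
    interpret symmetric_matrix "A \<omega>" n by (rule symm)
    show "(\<integral>x. x ^ (2 * k) + 1 \<partial>esd (A \<omega>)) = ?t (2 * k) \<omega> + ?t 0 \<omega>"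
      "(\<integral>x. (x ^ (2 * k) + 1) + x ^ k \<partial>esd (A \<omega>)) = (?t (2 * k) \<omega> + ?t 0 \<omega>) + ?t k \<omega>"
      using esd_moment[of 0] esd_integrable[of "\<lambda>_. 1"] by (simp_all add: esd_integrable esd_moment)
  qed
  have nn: "0 \<le> x ^ (2 * k) + 1" "0 \<le> (x ^ (2 * k) + 1) + x ^ k" for x :: real
  proof -
    have "0 \<le> y * y + 1 + y" for y :: real
      using zero_le_power2[of "y + 1 / 2"] by (simp add: power2_eq_square algebra_simps)
    from this[of "x ^ k"] show "0 \<le> (x ^ (2 * k) + 1) + x ^ k" by (simp add: mult_2 power_add)
    show "0 \<le> x ^ (2 * k) + 1" by (simp add: add_nonneg_nonneg)
  qed
  have it: "integrable M (?t k)" for k using int by simp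
  have i1: "integrable M (\<lambda>\<omega>. ?t (2 * k) \<omega> + ?t 0 \<omega>)"
    and i2: "integrable M (\<lambda>\<omega>. (?t (2 * k) \<omega> + ?t 0 \<omega>) + ?t k \<omega>)"
    by (intro Bochner_Integration.integrable_add it)+
  have m1: "(\<lambda>x::real. x ^ (2 * k) + 1) \<in> borel_measurable borel"
    and m2: "(\<lambda>x::real. (x ^ (2 * k) + 1) + x ^ k) \<in> borel_measurable borel" by measurable
  note h1 = eesd_has_integral_nonneg[OF m1 nn(1), unfolded J, OF i1]
  note h2 = eesd_has_integral_nonneg[OF m2 nn(2), unfolded J, OF i2]
  have "(\<integral>\<omega>. (?t (2 * k) \<omega> + ?t 0 \<omega>) + ?t k \<omega> \<partial>M) - (\<integral>\<omega>. ?t (2 * k) \<omega> + ?t 0 \<omega> \<partial>M) = (\<integral>\<omega>. ?t k \<omega> \<partial>M)"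
    by (simp only: Bochner_Integration.integral_add[OF i1 it] add_diff_cancel_left')
  with has_bochner_integral_diff[OF h2 h1] show ?thesis by simp
qed

end

section \<open>Moments of the expected spectral distribution\<close>

lemma mat_pow_eq_sum_paths:
  fixes A :: "real mat"
  assumes A: "A \<in> carrier_mat n n" and i: "i < n"
  shows "j < n \<Longrightarrow> (A ^\<^sub>m k) $$ (i, j) =
    (\<Sum>\<pi> | \<pi> \<in> PiE {..k} (\<lambda>_. {..<n}) \<and> \<pi> 0 = i \<and> \<pi> k = j. \<Prod>l\<in>{1..k}. A $$ (\<pi> (l - 1), \<pi> l))"
proof (induction k arbitrary: j)
  case 0
  have "{\<pi>. \<pi> \<in> PiE {..0::nat} (\<lambda>_. {..<n}) \<and> \<pi> 0 = i \<and> \<pi> 0 = j} = (if i = j then {\<lambda>l\<in>{..0}. i} else {})"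
    using i by (auto simp: PiE_iff fun_eq_iff extensional_def)
  thus ?case using A i 0 by simp
next
  case (Suc k)
  define P where "P k j = {\<pi>. \<pi> \<in> PiE {..k} (\<lambda>_. {..<n}) \<and> \<pi> 0 = i \<and> \<pi> k = j}" for k j :: nat
  have fin: "finite (P k j)" for k j
    by (rule finite_subset[of _ "PiE {..k} (\<lambda>_. {..<n})"]) (auto simp: P_def intro: finite_PiE)
  have "(A ^\<^sub>m Suc k) $$ (i, j) = (\<Sum>l<n. (A ^\<^sub>m k) $$ (i, l) * A $$ (l, j))"
    using A i Suc.prems pow_carrier_mat[OF A, of k] by (simp add: scalar_prod_def lessThan_atLeast0)
  also have "\<dots> = (\<Sum>l<n. \<Sum>\<pi>\<in>P k l. (\<Prod>r\<in>{1..k}. A $$ (\<pi> (r - 1), \<pi> r)) * A $$ (l, j))"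
    by (intro sum.cong refl) (simp add: Suc.IH P_def sum_distrib_right)
  also have "\<dots> = (\<Sum>(l, \<pi>)\<in>Sigma {..<n} (P k). (\<Prod>r\<in>{1..k}. A $$ (\<pi> (r - 1), \<pi> r)) * A $$ (l, j))"
    by (rule sum.Sigma) (auto simp: fin)
  also have "\<dots> = (\<Sum>\<pi>\<in>P (Suc k) j. \<Prod>r\<in>{1..Suc k}. A $$ (\<pi> (r - 1), \<pi> r))"
  proof (rule sum.reindex_bij_witness[where j = "\<lambda>(l, \<pi>). \<pi>(Suc k := j)" and i = "\<lambda>\<pi>. (\<pi> k, restrict \<pi> {..k})"])
    fix x assume x: "x \<in> Sigma {..<n} (P k)"
    obtain l \<pi> where [simp]: "x = (l, \<pi>)" by (cases x)
    have \<pi>: "l < n" "\<pi> \<in> PiE {..k} (\<lambda>_. {..<n})" "\<pi> 0 = i" "\<pi> k = l" using x by (auto simp: P_def)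
    show "(((case x of (l, \<pi>) \<Rightarrow> \<pi>(Suc k := j)) k), restrict (case x of (l, \<pi>) \<Rightarrow> \<pi>(Suc k := j)) {..k}) = x"
      using \<pi> by (auto simp: fun_eq_iff PiE_iff extensional_def)
    show "(case x of (l, \<pi>) \<Rightarrow> \<pi>(Suc k := j)) \<in> P (Suc k) j"
      using \<pi> Suc.prems by (auto simp: P_def PiE_iff extensional_def le_Suc_eq)
    have "(\<Prod>r\<in>{1..k}. A $$ ((\<pi>(Suc k := j)) (r - 1), (\<pi>(Suc k := j)) r)) = (\<Prod>r\<in>{1..k}. A $$ (\<pi> (r - 1), \<pi> r))"
      by (intro prod.cong refl) auto
    thus "(\<Prod>r\<in>{1..Suc k}. A $$ ((case x of (l, \<pi>) \<Rightarrow> \<pi>(Suc k := j)) (r - 1), (case x of (l, \<pi>) \<Rightarrow> \<pi>(Suc k := j)) r))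
       = (case x of (l, \<pi>) \<Rightarrow> (\<Prod>r\<in>{1..k}. A $$ (\<pi> (r - 1), \<pi> r)) * A $$ (l, j))"
      using \<pi> by (simp add: mult.commute)
  next
    fix \<pi> assume \<pi>: "\<pi> \<in> P (Suc k) j"
    show "(case (\<pi> k, restrict \<pi> {..k}) of (l, \<pi>) \<Rightarrow> \<pi>(Suc k := j)) = \<pi>"
      using \<pi> by (auto simp: P_def fun_eq_iff PiE_iff extensional_def restrict_def le_Suc_eq)
    show "(\<pi> k, restrict \<pi> {..k}) \<in> Sigma {..<n} (P k)"
      using \<pi> by (auto simp: P_def PiE_iff)
  qed
  finally show ?case by (simp only: P_def)
qed

lemma finite_circuits: "finite (circuits n k)"
  by (rule finite_subset[of _ "PiE {..k} (\<lambda>_. {..<n})"]) (auto simp: circuits_def intro: finite_PiE)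

lemma mat_trace_pow_eq_sum_circuits:
  assumes A: "A \<in> carrier_mat n n"
  shows "mat_trace (A ^\<^sub>m k) = (\<Sum>\<pi>\<in>circuits n k. \<Prod>l\<in>{1..k}. A $$ (\<pi> (l - 1), \<pi> l))"
proof -
  have "mat_trace (A ^\<^sub>m k) = (\<Sum>i<n. (A ^\<^sub>m k) $$ (i, i))" using A by (simp add: mat_trace_def)
  also have "\<dots> = (\<Sum>i<n. \<Sum>\<pi> | \<pi> \<in> circuits n k \<and> \<pi> 0 = i. \<Prod>l\<in>{1..k}. A $$ (\<pi> (l - 1), \<pi> l))"
    by (intro sum.cong refl) (auto simp: mat_pow_eq_sum_paths[OF A] circuits_def intro!: sum.cong)
  also have "\<dots> = (\<Sum>\<pi>\<in>circuits n k. \<Prod>l\<in>{1..k}. A $$ (\<pi> (l - 1), \<pi> l))"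
    by (intro sum.group finite_circuits) (auto simp: circuits_def)
  finally show ?thesis .
qed

definition partitions :: "nat \<Rightarrow> nat set set set" where
  "partitions k = {\<sigma>. partition_on {1..k} \<sigma>}"

lemma finite_partitions: "finite (partitions k)"
  unfolding partitions_def by (rule finitely_many_partition_on) simp

locale iid_entries = prob_space M for M :: "'a measure" +
  fixes x :: "nat \<Rightarrow> 'a \<Rightarrow> real"
  assumes iid: "iid M x" and moments: "\<And>i k. integrable M (\<lambda>\<omega>. x i \<omega> ^ k)"
begin

lemma indep: "indep_vars (\<lambda>_. borel) x UNIV" and same_distr: "distr M borel (x i) = distr M borel (x 0)"
  using iid by (auto simp: iid_def)

lemma x_measurable: "x i \<in> borel_measurable M"
  using indep by (auto simp: indep_vars_def2)

definition entry_moment :: "nat \<Rightarrow> real" where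
  "entry_moment k = (\<integral>\<omega>. x 0 \<omega> ^ k \<partial>M)"

lemma integral_power: "(\<integral>\<omega>. x i \<omega> ^ k \<partial>M) = entry_moment k"
proof -
  have "(\<integral>\<omega>. x i \<omega> ^ k \<partial>M) = (\<integral>y. y ^ k \<partial>distr M borel (x i))"
    using x_measurable by (subst integral_distr) auto
  also have "\<dots> = entry_moment k"
    unfolding same_distr[of i] entry_moment_def using x_measurable by (subst integral_distr) auto
  finally show ?thesis .
qed

text \<open>Equal indices are collected into powers of independent variables.\<close>

lemma integral_prod:
  fixes f :: "nat \<Rightarrow> nat"
  shows "has_bochner_integral M (\<lambda>\<omega>. \<Prod>j\<in>{1..k}. x (f j) \<omega>) (\<Prod>V\<in>level_sets k f. entry_moment (card V))"
proof -
  define F where "F v = {j \<in> {1..k}. f j = v}" for v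
  let ?S = "f ` {1..k}"
  have prod: "(\<Prod>j\<in>{1..k}. x (f j) \<omega>) = (\<Prod>v\<in>?S. x v \<omega> ^ card (F v))" for \<omega>
  proof -
    have "(\<Prod>j\<in>{1..k}. x (f j) \<omega>) = (\<Prod>v\<in>?S. \<Prod>j\<in>F v. x (f j) \<omega>)"
      unfolding F_def by (rule prod.image_gen) simp
    also have "\<dots> = (\<Prod>v\<in>?S. \<Prod>j\<in>F v. x v \<omega>)"
      by (intro prod.cong refl) (auto simp: F_def)
    finally show ?thesis by simp
  qed
  have "indep_vars (\<lambda>_. borel) (\<lambda>v \<omega>. x v \<omega> ^ card (F v)) UNIV"
    by (rule indep_vars_compose2[OF indep]) simp
  hence ind: "indep_vars (\<lambda>_. borel) (\<lambda>v \<omega>. x v \<omega> ^ card (F v)) ?S"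
    by (rule indep_vars_subset) simp
  have "level_sets k f = F ` ?S" by (auto simp: level_sets_def F_def)
  moreover have "inj_on F ?S"
  proof (rule inj_onI)
    fix v w assume "v \<in> ?S" and eq: "F v = F w"
    then obtain j where "j \<in> {1..k}" "f j = v" by blast
    hence "j \<in> F w" unfolding eq[symmetric] by (simp add: F_def)
    thus "v = w" using \<open>f j = v\<close> by (simp add: F_def)
  qed
  ultimately have ker: "(\<Prod>V\<in>level_sets k f. entry_moment (card V)) = (\<Prod>v\<in>?S. entry_moment (card (F v)))"
    by (simp add: prod.reindex)
  show ?thesis
    unfolding prod ker has_bochner_integral_iff
    using indep_vars_integrable[OF _ ind] indep_vars_lebesgue_integral[OF _ ind] moments
    by (simp add: integral_power)
qed

text \<open>The circuits that stay within the band are sorted by the partition of their positions.\<close>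

lemma expected_trace:
  assumes n: "0 < n"
  shows "has_bochner_integral M (\<lambda>\<omega>. mat_trace (band_matrix p n m (\<lambda>i. x i \<omega>) ^\<^sub>m k))
    (\<Sum>\<sigma>\<in>partitions k. card (band_circuits p n m k \<sigma>) * (\<Prod>V\<in>\<sigma>. entry_moment (card V)))"
proof -
  let ?A = "\<lambda>\<omega>. band_matrix p n m (\<lambda>i. x i \<omega>)"
  define B where "B = {\<pi> \<in> circuits n k. \<forall>j\<in>{1..k}. in_band p n m (link_at p n \<pi> j)}"
  have finB: "finite B" unfolding B_def using finite_circuits by simp
  have mat_trace: "mat_trace (?A \<omega> ^\<^sub>m k) = (\<Sum>\<pi>\<in>B. \<Prod>j\<in>{1..k}. x (link_at p n \<pi> j) \<omega>)" for \<omega>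
  proof -
    have "mat_trace (?A \<omega> ^\<^sub>m k) = (\<Sum>\<pi>\<in>circuits n k. \<Prod>l\<in>{1..k}. ?A \<omega> $$ (\<pi> (l - 1), \<pi> l))"
      by (rule mat_trace_pow_eq_sum_circuits) (simp add: band_matrix_def)
    also have "\<dots> = (\<Sum>\<pi>\<in>circuits n k. if \<pi> \<in> B then \<Prod>j\<in>{1..k}. x (link_at p n \<pi> j) \<omega> else 0)"
    proof (rule sum.cong[OF refl])
      fix \<pi> assume \<pi>: "\<pi> \<in> circuits n k"
      have less: "\<pi> j < n" if "j \<le> k" for j using \<pi> that by (auto simp: circuits_def)
      have e: "?A \<omega> $$ (\<pi> (l - 1), \<pi> l) = (if in_band p n m (link_at p n \<pi> l) then x (link_at p n \<pi> l) \<omega> else 0)"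
        if "l \<in> {1..k}" for l
      proof -
        have "\<pi> l < n" "\<pi> (l - 1) < n" using that by (auto intro!: less)
        thus ?thesis by (simp add: band_matrix_def link_at_def Let_def)
      qed
      show "(\<Prod>l\<in>{1..k}. ?A \<omega> $$ (\<pi> (l - 1), \<pi> l)) = (if \<pi> \<in> B then \<Prod>j\<in>{1..k}. x (link_at p n \<pi> j) \<omega> else 0)"
      proof (cases "\<pi> \<in> B")
        case True
        hence "(\<Prod>l\<in>{1..k}. ?A \<omega> $$ (\<pi> (l - 1), \<pi> l)) = (\<Prod>j\<in>{1..k}. x (link_at p n \<pi> j) \<omega>)"
          by (intro prod.cong refl) (simp only: e, simp add: B_def)
        thus ?thesis using True by simp
      next
        case False
        then obtain l where "l \<in> {1..k}" "\<not> in_band p n m (link_at p n \<pi> l)" using \<pi> by (auto simp: B_def)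
        hence "(\<Prod>l\<in>{1..k}. ?A \<omega> $$ (\<pi> (l - 1), \<pi> l)) = 0"
          by (intro prod_zero) (auto simp del: One_nat_def simp: e)
        thus ?thesis using False by simp
      qed
    qed
    also have "\<dots> = (\<Sum>\<pi>\<in>B. \<Prod>j\<in>{1..k}. x (link_at p n \<pi> j) \<omega>)"
    proof -
      have "circuits n k \<inter> B = B" by (auto simp: B_def)
      thus ?thesis using finite_circuits by (simp add: sum.inter_restrict[symmetric])
    qed
    finally show ?thesis .
  qed
  have "has_bochner_integral M (\<lambda>\<omega>. mat_trace (?A \<omega> ^\<^sub>m k)) (\<Sum>\<pi>\<in>B. \<Prod>V\<in>level_sets k (link_at p n \<pi>). entry_moment (card V))"
    unfolding mat_trace by (intro has_bochner_integral_sum integral_prod)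
  also have "(\<Sum>\<pi>\<in>B. \<Prod>V\<in>level_sets k (link_at p n \<pi>). entry_moment (card V))
     = (\<Sum>\<sigma>\<in>partitions k. \<Sum>\<pi> | \<pi> \<in> B \<and> level_sets k (link_at p n \<pi>) = \<sigma>. \<Prod>V\<in>level_sets k (link_at p n \<pi>). entry_moment (card V))"
    by (intro sum.group[symmetric] finB finite_partitions) (auto simp: partitions_def partition_on_level_sets simp del: One_nat_def)
  also have "\<dots> = (\<Sum>\<sigma>\<in>partitions k. card (band_circuits p n m k \<sigma>) * (\<Prod>V\<in>\<sigma>. entry_moment (card V)))"
  proof (rule sum.cong[OF refl])
    fix \<sigma>
    have "(\<Sum>\<pi> | \<pi> \<in> B \<and> level_sets k (link_at p n \<pi>) = \<sigma>. \<Prod>V\<in>level_sets k (link_at p n \<pi>). entry_moment (card V))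
       = (\<Sum>\<pi>\<in>band_circuits p n m k \<sigma>. \<Prod>V\<in>\<sigma>. entry_moment (card V))"
      by (intro sum.cong) (auto simp: band_circuits_def B_def)
    thus "(\<Sum>\<pi> | \<pi> \<in> B \<and> level_sets k (link_at p n \<pi>) = \<sigma>. \<Prod>V\<in>level_sets k (link_at p n \<pi>). entry_moment (card V))
       = card (band_circuits p n m k \<sigma>) * (\<Prod>V\<in>\<sigma>. entry_moment (card V))" by simp
  qed
  finally show ?thesis .
qed

lemma band_matrix_random: 
  assumes n: "0 < n"
  shows "symmetric_random_matrix M (\<lambda>\<omega>. band_matrix p n m (\<lambda>i. x i \<omega>)) n"
proof (intro symmetric_random_matrix.intro symmetric_random_matrix_axioms.intro prob_space_axioms)
  have link_sym: "link p n i j = link p n j i" for i j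
    by (cases p) (auto simp: add.commute abs_minus_commute)
  show "symmetric_matrix (band_matrix p n m (\<lambda>i. x i \<omega>)) n" for \<omega>
  proof unfold_locales
    show "band_matrix p n m (\<lambda>i. x i \<omega>) $$ (i, j) = band_matrix p n m (\<lambda>i. x i \<omega>) $$ (j, i)" if "i < n" "j < n" for i j
      using that by (simp add: band_matrix_def link_sym[of "Suc i" "Suc j"])
  qed (simp_all add: n band_matrix_def)
  fix i j assume "i < n" "j < n"
  thus "(\<lambda>\<omega>. band_matrix p n m (\<lambda>i. x i \<omega>) $$ (i, j)) \<in> borel_measurable M"
    using x_measurable by (simp add: band_matrix_def Let_def)
qed

lemma eesd_band:
  fixes p m
  assumes n: "0 < n"
  defines "E \<equiv> eesd M (\<lambda>\<omega>. band_matrix p n m (\<lambda>i. x i \<omega>))"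
  shows "real_distribution E" "all_moments E"
    "moment E k = (\<Sum>\<sigma>\<in>partitions k. real (card (band_circuits p n m k \<sigma>)) / real n ^ Suc (card \<sigma>) * (\<Prod>V\<in>\<sigma>. real n * entry_moment (card V)))"
proof -
  interpret symmetric_random_matrix M "\<lambda>\<omega>. band_matrix p n m (\<lambda>i. x i \<omega>)" n by (rule band_matrix_random[OF n])
  show "real_distribution E" unfolding E_def by (rule real_distribution_eesd)
  have int: "integrable M (\<lambda>\<omega>. mat_trace (band_matrix p n m (\<lambda>i. x i \<omega>) ^\<^sub>m k))" for k
    by (rule integrable.intros[OF expected_trace[OF n]])
  note mo = eesd_moment[OF int, folded E_def]
  show "all_moments E" unfolding all_moments_def using mo by (blast intro: integrable.intros)
  have "moment E k = (\<Sum>\<sigma>\<in>partitions k. card (band_circuits p n m k \<sigma>) * (\<Prod>V\<in>\<sigma>. entry_moment (card V))) / n"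
    unfolding moment_def has_bochner_integral_integral_eq[OF mo] has_bochner_integral_integral_eq[OF expected_trace[OF n]] ..
  also have "\<dots> = (\<Sum>\<sigma>\<in>partitions k. real (card (band_circuits p n m k \<sigma>)) / real n ^ Suc (card \<sigma>) * (\<Prod>V\<in>\<sigma>. real n * entry_moment (card V)))"
    using n by (simp add: sum_divide_distrib prod.distrib mult_ac)
  finally show "moment E k = \<dots>" .
qed

end

definition weight :: "pattern \<Rightarrow> nat \<Rightarrow> real \<Rightarrow> nat set set \<Rightarrow> real" where
  "weight p k \<alpha> \<sigma> = (SOME c. is_weight p k \<alpha> \<sigma> c)"

lemma is_weight: "\<sigma> \<in> partitions k \<Longrightarrow> is_weight p k \<alpha> \<sigma> (weight p k \<alpha> \<sigma>)"
  unfolding weight_def partitions_def using someI_ex[OF ex_weight] by blast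

definition even_partitions :: "nat \<Rightarrow> nat set set set" where
  "even_partitions k = {\<sigma>. partition_on {1..k} \<sigma> \<and> (\<forall>V\<in>\<sigma>. even (card V))}"

text \<open>The argument \<open>c j\<close> stands for the cumulant of order \<open>2 * j + 2\<close>, so that a block of even size \<open>r\<close>
has the cumulant \<open>c (r div 2 - 1)\<close>.\<close>

definition limit_moment :: "pattern \<Rightarrow> (nat \<Rightarrow> real) \<Rightarrow> real \<Rightarrow> nat \<Rightarrow> real" where
  "limit_moment p c \<alpha> k = (\<Sum>\<sigma>\<in>even_partitions k. weight p k \<alpha> \<sigma> * (\<Prod>V\<in>\<sigma>. c (card V div 2 - 1)))"

lemma block_card:
  fixes k :: nat
  assumes "partition_on {1..k} \<sigma>" "V \<in> \<sigma>"
  shows "1 \<le> card V"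
proof -
  have "V \<noteq> {}" using assms partition_onD3 by blast
  moreover have "V \<subseteq> {1..k}" using assms partition_onD1 by blast
  hence "finite V" by (rule finite_subset) simp
  ultimately show ?thesis by (simp add: Suc_le_eq card_gt_0_iff)
qed

lemma even_block_coefficient:
  assumes "\<sigma> \<in> even_partitions k" "V \<in> \<sigma>"
  shows "2 * Suc (card V div 2 - 1) = card V"
  using assms block_card[of k \<sigma> V] by (auto simp: even_partitions_def elim!: evenE)

lemma limit_moment_odd: "odd k \<Longrightarrow> limit_moment p c \<alpha> k = 0"
proof -
  assume k: "odd k"
  have "even_partitions k = {}"
  proof (rule ccontr)
    assume "even_partitions k \<noteq> {}"
    then obtain \<sigma> where \<sigma>: "partition_on {1..k} \<sigma>" "\<And>V. V \<in> \<sigma> \<Longrightarrow> even (card V)" by (auto simp: even_partitions_def)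
    have "card (\<Union>\<sigma>) = (\<Sum>V\<in>\<sigma>. card V)"
    proof (rule card_Union_disjoint)
      show "pairwise disjnt \<sigma>" using partition_onD2[OF \<sigma>(1)] by (auto simp: pairwise_def disjoint_def disjnt_def)
      fix V assume "V \<in> \<sigma>"
      hence "V \<subseteq> {1..k}" using partition_onD1[OF \<sigma>(1)] by blast
      thus "finite V" by (rule finite_subset) simp
    qed
    hence "k = (\<Sum>V\<in>\<sigma>. card V)" unfolding partition_onD1[OF \<sigma>(1), symmetric] by simp
    hence "even k" using \<sigma>(2) by (simp add: dvd_sum)
    thus False using k by simp
  qed
  thus ?thesis by (simp add: limit_moment_def)
qed

section \<open>The limit law\<close>

lemma limit_moment_le_even_moment:
  assumes nn: "\<And>j. 1 \<le> j \<Longrightarrow> 0 \<le> C (2 * j)"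
  shows "0 \<le> limit_moment p (\<lambda>k. C (2 * Suc k)) \<alpha> (2 * k)"
    and "limit_moment p (\<lambda>k. C (2 * Suc k)) \<alpha> (2 * k) \<le> 3 * 6 ^ (2 * k) * even_moment C k"
proof -
  have eq: "limit_moment p (\<lambda>k. C (2 * Suc k)) \<alpha> (2 * k) = (\<Sum>\<sigma>\<in>even_partitions (2 * k). weight p (2 * k) \<alpha> \<sigma> * (\<Prod>V\<in>\<sigma>. C (card V)))"
    unfolding limit_moment_def
    by (intro sum.cong refl arg_cong2[where f = "(*)"] prod.cong) (simp only: even_block_coefficient)
  have C: "0 \<le> (\<Prod>V\<in>\<sigma>. C (card V))" if \<sigma>: "\<sigma> \<in> even_partitions (2 * k)" for \<sigma>
  proof (rule prod_nonneg)
    fix V assume "V \<in> \<sigma>"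
    have "0 \<le> C (2 * Suc (card V div 2 - 1))" by (rule nn) simp
    thus "0 \<le> C (card V)" unfolding even_block_coefficient[OF \<sigma> \<open>V \<in> \<sigma>\<close>] .
  qed
  have w: "is_weight p (2 * k) \<alpha> \<sigma> (weight p (2 * k) \<alpha> \<sigma>)" if "\<sigma> \<in> even_partitions (2 * k)" for \<sigma>
    using that by (intro is_weight) (auto simp: even_partitions_def partitions_def)
  show "0 \<le> limit_moment p (\<lambda>k. C (2 * Suc k)) \<alpha> (2 * k)"
    unfolding eq using w C by (intro sum_nonneg mult_nonneg_nonneg) (auto simp: is_weight_def)
  have "limit_moment p (\<lambda>k. C (2 * Suc k)) \<alpha> (2 * k) \<le> (\<Sum>\<sigma>\<in>even_partitions (2 * k). 3 * 6 ^ (2 * k) * (\<Prod>V\<in>\<sigma>. C (card V)))"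
    unfolding eq using w C by (intro sum_mono mult_right_mono) (auto simp: is_weight_def)
  also have "\<dots> = 3 * 6 ^ (2 * k) * even_moment C k"
    by (simp add: even_moment_def even_partitions_def sum_distrib_left)
  finally show "limit_moment p (\<lambda>k. C (2 * Suc k)) \<alpha> (2 * k) \<le> 3 * 6 ^ (2 * k) * even_moment C k" .
qed

lemma inverse_ennreal_antimono:
  assumes "0 \<le> a" "a \<le> b" shows "inverse (ennreal b) \<le> inverse (ennreal a)"
proof (cases "a = 0")
  case False
  hence "0 < a" "0 < b" using assms by auto
  thus ?thesis using assms by (simp add: inverse_ennreal ennreal_leI le_imp_inverse_le)
qed simp

lemma carleman_scale:
  assumes carl: "carleman e" and nn: "\<And>k. 0 \<le> m k" and le: "\<And>k. 1 \<le> k \<Longrightarrow> m k \<le> R ^ (2 * k) * e k" and R: "0 < R"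
  shows "carleman m"
proof -
  have "inverse (ennreal R) * inverse (ennreal (root (2 * Suc k) (e (Suc k)))) \<le> inverse (ennreal (root (2 * Suc k) (m (Suc k))))" for k
  proof -
    have "root (2 * Suc k) (m (Suc k)) \<le> root (2 * Suc k) (R ^ (2 * Suc k) * e (Suc k))"
      using le[of "Suc k"] by (intro real_root_le_mono) auto
    also have "\<dots> = R * root (2 * Suc k) (e (Suc k))"
      using R unfolding real_root_mult by (subst real_root_power_cancel) auto
    finally have *: "root (2 * Suc k) (m (Suc k)) \<le> R * root (2 * Suc k) (e (Suc k))" .
    have "0 \<le> e (Suc k)"
      using order_trans[OF nn le[of "Suc k"]] R by (intro mult_left_le_imp_le[of "R ^ (2 * Suc k)" 0]) auto
    hence e0: "0 \<le> root (2 * Suc k) (e (Suc k))" by (intro real_root_ge_zero)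
    have "inverse (ennreal (R * root (2 * Suc k) (e (Suc k)))) = inverse (ennreal R) * inverse (ennreal (root (2 * Suc k) (e (Suc k))))"
      using R e0 by (subst ennreal_mult) (auto simp: ennreal_inverse_mult)
    moreover have "inverse (ennreal (R * root (2 * Suc k) (e (Suc k)))) \<le> inverse (ennreal (root (2 * Suc k) (m (Suc k))))"
      by (rule inverse_ennreal_antimono[OF real_root_ge_zero[OF nn] *])
    ultimately show ?thesis by simp
  qed
  hence "(\<Sum>k. inverse (ennreal R) * inverse (ennreal (root (2 * Suc k) (e (Suc k))))) \<le> (\<Sum>k. inverse (ennreal (root (2 * Suc k) (m (Suc k)))))"
    by (intro suminf_le) auto
  moreover have "(\<Sum>k. inverse (ennreal R) * inverse (ennreal (root (2 * Suc k) (e (Suc k))))) = \<infinity>"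
    using carl R unfolding carleman_def by (simp add: ennreal_suminf_cmult ennreal_mult_top inverse_ennreal)
  ultimately show ?thesis unfolding carleman_def by (simp add: top_unique)
qed

text \<open>The law is chosen by its moments alone, which makes it a function of the even cumulants and \<open>\<alpha>\<close>.\<close>

definition limit_law :: "pattern \<Rightarrow> (nat \<Rightarrow> real) \<Rightarrow> real \<Rightarrow> real measure" where
  "limit_law p c \<alpha> = (SOME \<mu>. real_distribution \<mu> \<and> all_moments \<mu> \<and> (\<forall>k. moment \<mu> k = limit_moment p c \<alpha> k))"

lemma reflected_moments:
  assumes "real_distribution M" "all_moments M"
  shows "real_distribution (distr M borel uminus)" "all_moments (distr M borel uminus)"
    "moment (distr M borel uminus) k = (- 1) ^ k * moment M k"
proof -
  interpret real_distribution M by fact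
  show "real_distribution (distr M borel uminus)"
    by (rule real_distribution_distr) simp
  have [simp]: "integrable M (\<lambda>x. x ^ k)" for k using assms(2) by (simp add: all_moments_def)
  have minus: "(\<lambda>x::real. (- x) ^ k) = (\<lambda>x. (- 1) ^ k * x ^ k)" for k
    by (rule ext) (rule power_minus)
  have "integrable (distr M borel uminus) (\<lambda>x. x ^ k)" for k
    by (subst integrable_distr_eq) (simp_all only: minus, simp_all)
  thus "all_moments (distr M borel uminus)" unfolding all_moments_def ..
  have "moment (distr M borel uminus) k = (\<integral>x. (- x) ^ k \<partial>M)"
    unfolding moment_def by (rule integral_distr) simp_all
  also have "\<dots> = (- 1) ^ k * moment M k" unfolding minus moment_def by simp
  finally show "moment (distr M borel uminus) k = (- 1) ^ k * moment M k" .
qed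

theorem mainTheorem5:
  fixes p :: pattern
  shows "\<exists>\<mu> :: (nat \<Rightarrow> real) \<Rightarrow> real \<Rightarrow> real measure.
    \<forall>(M :: nat \<Rightarrow> 'a measure) (x :: nat \<Rightarrow> nat \<Rightarrow> 'a \<Rightarrow> real) (C :: nat \<Rightarrow> real)
      (m :: nat \<Rightarrow> int) (\<alpha> :: real).
      (\<forall>n. prob_space (M n)) \<longrightarrow>
      (\<forall>n. iid (M n) (x n)) \<longrightarrow>
      (\<forall>n i k. integrable (M n) (\<lambda>\<omega>. x n i \<omega> ^ k)) \<longrightarrow>
      (\<forall>k\<ge>1. (\<lambda>n. real n * integral\<^sup>L (M n) (\<lambda>\<omega>. x n 0 \<omega> ^ k)) \<longlonglongrightarrow> C k) \<longrightarrow>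
      carleman (even_moment C) \<longrightarrow>
      filterlim m at_top sequentially \<longrightarrow>
      (\<lambda>n. real_of_int (m n) / real n) \<longlonglongrightarrow> \<alpha> \<longrightarrow>
      \<alpha> > 0 \<longrightarrow>
      real_distribution (\<mu> (\<lambda>k. C (2 * Suc k)) \<alpha>) \<and>
      symmetric_measure (\<mu> (\<lambda>k. C (2 * Suc k)) \<alpha>) \<and>
      weak_conv_m
        (\<lambda>n. eesd (M n) (\<lambda>\<omega>. band_matrix p n (m n) (\<lambda>i. x n i \<omega>)))
        (\<mu> (\<lambda>k. C (2 * Suc k)) \<alpha>)"
proof (intro exI[of _ "limit_law p"] allI impI)
  fix M :: "nat \<Rightarrow> 'a measure" and x :: "nat \<Rightarrow> nat \<Rightarrow> 'a \<Rightarrow> real" and C :: "nat \<Rightarrow> real"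
    and m :: "nat \<Rightarrow> int" and \<alpha> :: real
  assume prob: "\<forall>n. prob_space (M n)" and iid: "\<forall>n. iid (M n) (x n)"
    and int: "\<forall>n i k. integrable (M n) (\<lambda>\<omega>. x n i \<omega> ^ k)"
    and C: "\<forall>k\<ge>1. (\<lambda>n. real n * integral\<^sup>L (M n) (\<lambda>\<omega>. x n 0 \<omega> ^ k)) \<longlonglongrightarrow> C k"
    and carl: "carleman (even_moment C)"
    and m: "(\<lambda>n. real_of_int (m n) / real n) \<longlonglongrightarrow> \<alpha>"
  let ?c = "\<lambda>k. C (2 * Suc k)"
  \<comment> \<open>For \<open>n = 0\<close> this is not a probability distribution, so the sequence is used from \<open>1\<close> on.\<close>
  define E where "E n = eesd (M n) (\<lambda>\<omega>. band_matrix p n (m n) (\<lambda>i. x n i \<omega>))" for n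
  have entries: "iid_entries (M n) (x n)" for n
    using prob iid int by (simp add: iid_entries_def iid_entries_axioms_def)
  have E: "real_distribution (E (Suc n))" "all_moments (E (Suc n))" for n
    unfolding E_def by (rule iid_entries.eesd_band[OF entries]; simp)+
  have lim: "(\<lambda>n. moment (E (Suc n)) k) \<longlonglongrightarrow> limit_moment p ?c \<alpha> k" for k
  proof -
    have "(\<lambda>n. \<Sum>\<sigma>\<in>partitions k. real (card (band_circuits p n (m n) k \<sigma>)) / real n ^ Suc (card \<sigma>) *
        (\<Prod>V\<in>\<sigma>. real n * iid_entries.entry_moment (M n) (x n) (card V)))
      \<longlonglongrightarrow> (\<Sum>\<sigma>\<in>partitions k. weight p k \<alpha> \<sigma> * (\<Prod>V\<in>\<sigma>. C (card V)))"
    proof (intro tendsto_sum tendsto_mult tendsto_prod)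
      fix \<sigma> assume \<sigma>: "\<sigma> \<in> partitions k"
      show "(\<lambda>n. real (card (band_circuits p n (m n) k \<sigma>)) / real n ^ Suc (card \<sigma>)) \<longlonglongrightarrow> weight p k \<alpha> \<sigma>"
        using is_weight[OF \<sigma>, of p \<alpha>] m by (simp add: is_weight_def band_widths_def)
      fix V assume "V \<in> \<sigma>"
      hence "1 \<le> card V" using \<sigma> by (intro block_card) (auto simp: partitions_def)
      with C show "(\<lambda>n. real n * iid_entries.entry_moment (M n) (x n) (card V)) \<longlonglongrightarrow> C (card V)"
        by (simp add: iid_entries.entry_moment_def[OF entries])
    qed
    also have "(\<Sum>\<sigma>\<in>partitions k. weight p k \<alpha> \<sigma> * (\<Prod>V\<in>\<sigma>. C (card V))) = (\<Sum>\<sigma>\<in>even_partitions k. weight p k \<alpha> \<sigma> * (\<Prod>V\<in>\<sigma>. C (card V)))"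
    proof (rule sum.mono_neutral_right[OF finite_partitions])
      show "even_partitions k \<subseteq> partitions k" by (auto simp: even_partitions_def partitions_def)
      show "\<forall>\<sigma>\<in>partitions k - even_partitions k. weight p k \<alpha> \<sigma> * (\<Prod>V\<in>\<sigma>. C (card V)) = 0"
      proof
        fix \<sigma> assume \<sigma>: "\<sigma> \<in> partitions k - even_partitions k"
        hence "\<exists>V\<in>\<sigma>. odd (card V)" by (auto simp: even_partitions_def partitions_def)
        hence "weight p k \<alpha> \<sigma> = 0" using is_weight[of \<sigma> k p \<alpha>] \<sigma> by (simp add: is_weight_def)
        thus "weight p k \<alpha> \<sigma> * (\<Prod>V\<in>\<sigma>. C (card V)) = 0" by simp
      qed
    qed
    also have "\<dots> = limit_moment p ?c \<alpha> k"
      unfolding limit_moment_def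
      by (intro sum.cong refl arg_cong2[where f = "(*)"] prod.cong) (simp only: even_block_coefficient)
    finally have "(\<lambda>n. \<Sum>\<sigma>\<in>partitions k. real (card (band_circuits p n (m n) k \<sigma>)) / real n ^ Suc (card \<sigma>) *
        (\<Prod>V\<in>\<sigma>. real n * iid_entries.entry_moment (M n) (x n) (card V))) \<longlonglongrightarrow> limit_moment p ?c \<alpha> k" .
    from LIMSEQ_Suc[OF this] show ?thesis
      unfolding E_def using iid_entries.eesd_band(3)[OF entries, of "Suc _"] by simp
  qed
  have nn: "0 \<le> C (2 * j)" if "1 \<le> j" for j
  proof (rule LIMSEQ_le_const)
    show "(\<lambda>n. real n * integral\<^sup>L (M n) (\<lambda>\<omega>. x n 0 \<omega> ^ (2 * j))) \<longlonglongrightarrow> C (2 * j)" using C that by simp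
    show "\<exists>N. \<forall>n\<ge>N. 0 \<le> real n * integral\<^sup>L (M n) (\<lambda>\<omega>. x n 0 \<omega> ^ (2 * j))"
      by (auto intro!: mult_nonneg_nonneg Bochner_Integration.integral_nonneg)
  qed
  \<comment> \<open>The factor \<open>3\<close> is absorbed by \<open>3 ^ (2 * k)\<close>, which turns \<open>3 * 6 ^ (2 * k)\<close> into \<open>18 ^ (2 * k)\<close>.\<close>
  have "carleman (\<lambda>k. limit_moment p ?c \<alpha> (2 * k))"
  proof (rule carleman_scale[OF carl])
    show "0 \<le> limit_moment p ?c \<alpha> (2 * k)" for k by (rule limit_moment_le_even_moment[where C = C, OF nn])
    fix k :: nat assume k: "1 \<le> k"
    have "0 \<le> 3 * 6 ^ (2 * k) * even_moment C k"
      using limit_moment_le_even_moment[where C = C, OF nn, of p \<alpha> k] by linarith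
    hence e: "0 \<le> even_moment C k" by (intro mult_left_le_imp_le[of "3 * 6 ^ (2 * k)" 0]) auto
    have "3 \<le> (3::real) ^ (2 * k)" using power_increasing[of 1 "2 * k" "3::real"] k by simp
    hence "3 * 6 ^ (2 * k) \<le> (3::real) ^ (2 * k) * 6 ^ (2 * k)" by (intro mult_right_mono) auto
    also have "\<dots> = 18 ^ (2 * k)" by (simp flip: power_mult_distrib)
    finally have "3 * 6 ^ (2 * k) * even_moment C k \<le> 18 ^ (2 * k) * even_moment C k" using e by (intro mult_right_mono)
    with limit_moment_le_even_moment(2)[where C = C, OF nn, of p \<alpha> k]
    show "limit_moment p ?c \<alpha> (2 * k) \<le> 18 ^ (2 * k) * even_moment C k" by simp
  qed simp
  hence carl': "(\<Sum>k. inverse (ennreal (root (2 * Suc k) (limit_moment p ?c \<alpha> (2 * Suc k))))) = \<infinity>"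
    by (simp only: carleman_def)
  obtain \<nu> where \<nu>: "real_distribution \<nu>" "all_moments \<nu>" "\<And>k. moment \<nu> k = limit_moment p ?c \<alpha> k"
    "weak_conv_m (\<lambda>n. E (Suc n)) \<nu>"
    using method_of_moments[OF E lim carl'] by blast
  define \<mu> where "\<mu> = limit_law p ?c \<alpha>"
  have "\<exists>\<mu>. real_distribution \<mu> \<and> all_moments \<mu> \<and> (\<forall>k. moment \<mu> k = limit_moment p ?c \<alpha> k)" using \<nu> by blast
  from someI_ex[OF this] have \<mu>: "real_distribution \<mu>" "all_moments \<mu>" "\<And>k. moment \<mu> k = limit_moment p ?c \<alpha> k"
    by (simp_all add: \<mu>_def limit_law_def)
  have unique: "\<rho> = \<mu>" if "real_distribution \<rho>" "all_moments \<rho>" "\<And>k. moment \<rho> k = limit_moment p ?c \<alpha> k" for \<rho>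
    using that \<mu> carl' by (intro carleman_unique) auto
  have "weak_conv_m (\<lambda>n. E (Suc n)) \<mu>" using \<nu>(4) unique[OF \<nu>(1-3)] by simp
  have "weak_conv_m E \<mu>"
    unfolding weak_conv_m_def weak_conv_def
  proof (intro allI impI)
    fix y assume "isCont (cdf \<mu>) y"
    with \<open>weak_conv_m (\<lambda>n. E (Suc n)) \<mu>\<close> have "(\<lambda>n. cdf (E (Suc n)) y) \<longlonglongrightarrow> cdf \<mu> y"
      by (simp add: weak_conv_m_def weak_conv_def)
    thus "(\<lambda>n. cdf (E n) y) \<longlonglongrightarrow> cdf \<mu> y" by (rule LIMSEQ_imp_Suc)
  qed
  moreover have "distr \<mu> borel uminus = \<mu>"
  proof (rule unique)
    show "moment (distr \<mu> borel uminus) k = limit_moment p ?c \<alpha> k" for k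
      unfolding reflected_moments(3)[OF \<mu>(1,2)] \<mu>(3)
      by (cases "odd k") (simp_all add: limit_moment_odd)
  qed (rule reflected_moments[OF \<mu>(1,2)])+
  ultimately show "real_distribution (limit_law p ?c \<alpha>) \<and> symmetric_measure (limit_law p ?c \<alpha>) \<and>
      weak_conv_m (\<lambda>n. eesd (M n) (\<lambda>\<omega>. band_matrix p n (m n) (\<lambda>i. x n i \<omega>))) (limit_law p ?c \<alpha>)"
    using \<mu>(1) unfolding symmetric_measure_def E_def[abs_def] \<mu>_def by blast
qed

end
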